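(* There is a single-valued $\mathsf{FS_2P}$ algorithm $A$ solving Range Avoidance: for every $n$ and every Boolean circuit $C:\{0,1\}^n\to\{0,1\}^{n+1}$ given as input, $A(C)$ outputs a string $y_C\in\{0,1\}^{n+1}$ with $y_C\notin \mathrm{Im}(C)$, i.e. $C(x)\neq y_C$ for all $x\in\{0,1\}^n$.
   Context: A single-valued $\mathsf{FS_2P}$ algorithm $A$ is specified by a polynomial $\ell(\cdot)$ and a deterministic polynomial-time algorithm $V_A(x,\pi_1,\pi_2)$. On input $x$, $A$ outputs $y_x$ if (1) there is $\pi_1\in\{0,1\}^{\ell(|x|)}$ such that for every $\pi_2\in\{0,1\}^{\ell(|x|)}$, $V_A(x,\pi_1,\pi_2)=y_x$, and (2) there is $\pi_2\in\{0,1\}^{\ell(|x|)}$ such that for every $\pi_1\in\{0,1\}^{\ell(|x|)}$, $V_A(x,\pi_1,\pi_2)=y_x$. $A$ solves a search problem if on every input $x$ it outputs such a $y_x$ and $y_x$ is a valid solution for $x$. The algorithm must work for every input length $n$ (not just infinitely many). *)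

theory Defs
  imports Main "HOL-Computational_Algebra.Polynomial"
begin

datatype sym = Bk | B0 | B1 | Hash
datatype dir = Lft | Rgt | Stay

text \<open>A machine is a pair (Q, delta): Q is the (finite) number of states, states are
  0..Q-1, 0 is the start state and 1 is the halting state.\<close>
type_synonym tm = "nat \<times> (nat \<Rightarrow> sym \<Rightarrow> nat \<times> sym \<times> dir)"

definition tm_wf :: "tm \<Rightarrow> bool" where
  "tm_wf M \<longleftrightarrow> fst M \<ge> 2 \<and> (\<forall>q<fst M. \<forall>s. fst (snd M q s) < fst M)"

text \<open>Configuration: (state, reversed left part of tape, tape from head to the right);
  the head reads the first symbol of the right part (blank if empty).\<close>
type_synonym config = "nat \<times> sym list \<times> sym list"

definition hd_sym :: "sym list \<Rightarrow> sym" where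
  "hd_sym rs = (case rs of [] \<Rightarrow> Bk | s # _ \<Rightarrow> s)"

fun tm_step :: "tm \<Rightarrow> config \<Rightarrow> config" where
  "tm_step M (q, ls, rs) =
    (if q = 1 then (q, ls, rs) else
      (case snd M q (hd_sym rs) of (q', w, d) \<Rightarrow>
        let rs' = w # tl rs in
        (case d of
          Stay \<Rightarrow> (q', ls, rs')
        | Rgt \<Rightarrow> (q', w # ls, tl rs')
        | Lft \<Rightarrow> (case ls of [] \<Rightarrow> (q', [], Bk # rs') | l # ls' \<Rightarrow> (q', ls', l # rs')))))"

definition tm_run :: "tm \<Rightarrow> nat \<Rightarrow> sym list \<Rightarrow> config" where
  "tm_run M t w = (tm_step M ^^ t) (0, [], w)"

definition sym_of_bool :: "bool \<Rightarrow> sym" where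
  "sym_of_bool b = (if b then B1 else B0)"

definition bool_of_sym :: "sym \<Rightarrow> bool" where
  "bool_of_sym s = (s = B1)"

definition tm_output :: "config \<Rightarrow> bool list" where
  "tm_output c = map bool_of_sym (takeWhile (\<lambda>s. s = B0 \<or> s = B1) (snd (snd c)))"

definition tm_computes_in_time ::
  "tm \<Rightarrow> (sym list \<Rightarrow> bool list) \<Rightarrow> (nat \<Rightarrow> nat) \<Rightarrow> bool" where
  "tm_computes_in_time M f T \<longleftrightarrow>
     (\<forall>w. \<exists>t \<le> T (length w). fst (tm_run M t w) = 1 \<and> tm_output (tm_run M t w) = f w)"

definition triple_input :: "bool list \<Rightarrow> bool list \<Rightarrow> bool list \<Rightarrow> sym list" where
  "triple_input x p1 p2 =
     map sym_of_bool x @ [Hash] @ map sym_of_bool p1 @ [Hash] @ map sym_of_bool p2"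

definition poly_time_computable3 ::
  "(bool list \<Rightarrow> bool list \<Rightarrow> bool list \<Rightarrow> bool list) \<Rightarrow> bool" where
  "poly_time_computable3 V \<longleftrightarrow>
     (\<exists>M f (p :: nat poly). tm_wf M \<and> tm_computes_in_time M f (poly p) \<and>
        (\<forall>x p1 p2. f (triple_input x p1 p2) = V x p1 p2))"

definition fs2p_outputs ::
  "(nat \<Rightarrow> nat) \<Rightarrow> (bool list \<Rightarrow> bool list \<Rightarrow> bool list \<Rightarrow> bool list) \<Rightarrow>
   bool list \<Rightarrow> bool list \<Rightarrow> bool" where
  "fs2p_outputs l V x y \<longleftrightarrow>
     (\<exists>p1. length p1 = l (length x) \<and>
        (\<forall>p2. length p2 = l (length x) \<longrightarrow> V x p1 p2 = y)) \<and>
     (\<exists>p2. length p2 = l (length x) \<and>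
        (\<forall>p1. length p1 = l (length x) \<longrightarrow> V x p1 p2 = y))"

definition single_valued_FS2P_solves ::
  "(bool list \<Rightarrow> bool list \<Rightarrow> bool) \<Rightarrow> bool" where
  "single_valued_FS2P_solves R \<longleftrightarrow>
     (\<exists>(lp :: nat poly) V. poly_time_computable3 V \<and>
        (\<forall>x. \<exists>y. fs2p_outputs (poly lp) V x y \<and> R x y))"

text \<open>Wires 0..n-1 are the inputs; gate number j defines wire n+j and may only refer to
  wires with smaller index.\<close>
datatype gate = AndG nat nat | OrG nat nat | NotG nat

record circuit =
  c_inputs :: nat
  c_gates :: "gate list"
  c_outputs :: "nat list"

fun gate_refs_ok :: "nat \<Rightarrow> gate \<Rightarrow> bool" where
  "gate_refs_ok k (AndG i j) = (i < k \<and> j < k)"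
| "gate_refs_ok k (OrG i j) = (i < k \<and> j < k)"
| "gate_refs_ok k (NotG i) = (i < k)"

definition circuit_wf :: "circuit \<Rightarrow> bool" where
  "circuit_wf C \<longleftrightarrow>
     (\<forall>j < length (c_gates C). gate_refs_ok (c_inputs C + j) (c_gates C ! j)) \<and>
     (\<forall>i \<in> set (c_outputs C). i < c_inputs C + length (c_gates C))"

fun gate_val :: "bool list \<Rightarrow> gate \<Rightarrow> bool" where
  "gate_val vs (AndG i j) = (vs ! i \<and> vs ! j)"
| "gate_val vs (OrG i j) = (vs ! i \<or> vs ! j)"
| "gate_val vs (NotG i) = (\<not> vs ! i)"

definition wire_values :: "circuit \<Rightarrow> bool list \<Rightarrow> bool list" where
  "wire_values C x = foldl (\<lambda>vs g. vs @ [gate_val vs g]) x (c_gates C)"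

definition circuit_eval :: "circuit \<Rightarrow> bool list \<Rightarrow> bool list" where
  "circuit_eval C x = map (\<lambda>i. wire_values C x ! i) (c_outputs C)"

text \<open>Self-delimiting binary encoding of naturals: little-endian bits b, each written as
  1b, terminated by 00.\<close>
fun bin :: "nat \<Rightarrow> bool list" where
  "bin n = (if n = 0 then [] else odd n # bin (n div 2))"

definition enc_nat :: "nat \<Rightarrow> bool list" where
  "enc_nat n = concat (map (\<lambda>b. [True, b]) (bin n)) @ [False, False]"

fun enc_gate :: "gate \<Rightarrow> bool list" where
  "enc_gate (AndG i j) = [False, False] @ enc_nat i @ enc_nat j"
| "enc_gate (OrG i j) = [False, True] @ enc_nat i @ enc_nat j"
| "enc_gate (NotG i) = [True, False] @ enc_nat i"

definition enc_circuit :: "circuit \<Rightarrow> bool list" where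
  "enc_circuit C = enc_nat (c_inputs C) @ enc_nat (length (c_gates C)) @
     concat (map enc_gate (c_gates C)) @ enc_nat (length (c_outputs C)) @
     concat (map enc_nat (c_outputs C))"

text \<open>y is a valid solution for input x: whenever x encodes a circuit
  C : {0,1}^n \<rightarrow> {0,1}^(n+1), y is an (n+1)-bit string outside the image of C.
  Strings that do not encode such a circuit have every string as a valid solution.\<close>
definition avoid_solution :: "bool list \<Rightarrow> bool list \<Rightarrow> bool" where
  "avoid_solution x y \<longleftrightarrow>
     (\<forall>C. circuit_wf C \<and> length (c_outputs C) = Suc (c_inputs C) \<and> enc_circuit C = x \<longrightarrow>
        length y = Suc (c_inputs C) \<and>
        (\<forall>z. length z = c_inputs C \<longrightarrow> circuit_eval C z \<noteq> y))"

end

theory Submission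
  imports Defs
begin

text \<open>Let \<open>C\<close> map \<open>n\<close> bits to \<open>n + 1\<close> bits. Iterating \<open>C\<close> stretches \<open>n\<close> bits to \<open>n + k\<close> bits. Consider the
  complete binary tree of depth \<open>2n + 1\<close>. Label a leaf with address \<open>p\<close> by the least preimage of \<open>p\<close>
  under the stretch by \<open>n + 1\<close>, and an inner node by the least preimage of the pair of labels of
  its children under the stretch by \<open>n\<close>. The root cannot have a label, since then every leaf
  would have one, so some node fails although both its children are labelled. The first such node
  in postorder, with the labels of the left siblings on the path to it, is a short certificate:
  these labels determine all labels before it. Given two certificates, one of them honest, one
  walks down to the first node on which they disagree. They agree on its children, so the smaller
  label wins, and any label wins against a claimed failure. This singles out one string outside the
  range of a stretch of \<open>C\<close>. Going back through the iteration by least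
  preimages, taken greedily from what both provers offer, ends at a string outside the range
  of \<open>C\<close>.

  As for the running time, programs over three stacks run on a Turing machine with quadratic
  overhead, and the functions that they compute in polynomial time, on data encoded as bit
  strings, are closed under composition, pairing, case distinction and folds whose
  accumulator stays polynomially bounded.\<close>

section \<open>Structured Turing machine programs\<close>

text \<open>The obstacle is single-valuedness: the output may depend on the input alone. Hence every
  choice is canonical (least preimages, first failure in postorder), and an honest certificate has
  to prevail against every opponent in either argument position. A certificate is a list of
  \<open>5 * n + 3\<close> labels: two for each of the \<open>2 * n + 1\<close> levels, and
  \<open>n + 1\<close> places for preimages on the way back. The depth is \<open>n + (n + 1)\<close>
  because a leaf address must have the length of a value of the stretch by \<open>n + 1\<close>; the
  \<open>2 ^ (2 * n + 1)\<close> addresses outnumber the \<open>2 ^ n\<close> possible preimages.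
  Every input string, even one that encodes no circuit, needs an output, so parsing is total and
  always yields some map from \<open>n\<close> to \<open>n + 1\<close> bits; the combinatorial
  argument assumes nothing else of \<open>C\<close>. Time bounds need care because polynomial
  growth, iterated, need not stay polynomial: loops come with a polynomial bound on the accumulator,
  mostly through a growth per step that does not depend on the accumulator.\<close>

datatype tprog =
    Act "sym \<Rightarrow> sym \<times> dir"
  | TSeq tprog tprog
  | TIf "sym set" tprog tprog
  | TWhile "sym set" tprog

type_synonym tape = "int \<Rightarrow> sym"

fun shift :: "dir \<Rightarrow> int \<Rightarrow> int" where
  "shift Lft p = p - 1" | "shift Rgt p = p + 1" | "shift Stay p = p"

text \<open>The clock counts machine steps exactly: one for each test, and one more for the jump
  that leaves the first branch of a conditional or returns to the head of a loop.\<close>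

inductive texec :: "tprog \<Rightarrow> tape \<Rightarrow> int \<Rightarrow> nat \<Rightarrow> tape \<Rightarrow> int \<Rightarrow> bool" where
  Act: "f (T p) = (w, d) \<Longrightarrow> texec (Act f) T p 1 (T(p := w)) (shift d p)"
| Seq: "texec a T p t T' p' \<Longrightarrow> texec b T' p' t' T'' p'' \<Longrightarrow> texec (TSeq a b) T p (t + t') T'' p''"
| IfT: "T p \<in> S \<Longrightarrow> texec a T p t T' p' \<Longrightarrow> texec (TIf S a b) T p (1 + t + 1) T' p'"
| IfF: "T p \<notin> S \<Longrightarrow> texec b T p t T' p' \<Longrightarrow> texec (TIf S a b) T p (1 + t) T' p'"
| WhileF: "T p \<notin> S \<Longrightarrow> texec (TWhile S a) T p 1 T p"
| WhileT: "T p \<in> S \<Longrightarrow> texec a T p t T' p' \<Longrightarrow> texec (TWhile S a) T' p' t' T'' p'' \<Longrightarrow>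
    texec (TWhile S a) T p (1 + t + 1 + t') T'' p''"

type_synonym code = "(sym \<Rightarrow> nat \<times> sym \<times> dir) list"

fun csize :: "tprog \<Rightarrow> nat" where
  "csize (Act f) = 1"
| "csize (TSeq a b) = csize a + csize b"
| "csize (TIf S a b) = csize a + csize b + 2"
| "csize (TWhile S a) = csize a + 2"

text \<open>Targets are absolute state numbers for a block loaded at \<open>n\<close>. Control
  leaves the block at \<open>n + csize a\<close>, so sequential composition needs no jump.\<close>

fun compile :: "tprog \<Rightarrow> nat \<Rightarrow> code" where
  "compile (Act f) n = [\<lambda>s. (n + 1, f s)]"
| "compile (TSeq a b) n = compile a n @ compile b (n + csize a)"
| "compile (TIf S a b) n =
     (\<lambda>s. (if s \<in> S then n + 1 else n + csize a + 2, s, Stay)) # compile a (n + 1) @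
     (\<lambda>s. (n + csize a + 2 + csize b, s, Stay)) # compile b (n + csize a + 2)"
| "compile (TWhile S a) n =
     (\<lambda>s. (if s \<in> S then n + 1 else n + csize a + 2, s, Stay)) # compile a (n + 1) @
     [\<lambda>s. (n, s, Stay)]"

lemma length_compile [simp]: "length (compile a n) = csize a"
  by (induction a arbitrary: n) auto

lemma compile_targets:
  "c \<in> set (compile a n) \<Longrightarrow> fst (c s) \<le> n + csize a"
  by (induction a arbitrary: n c) (fastforce split: if_splits)+

fun astep :: "code \<Rightarrow> nat \<times> tape \<times> int \<Rightarrow> nat \<times> tape \<times> int" where
  "astep K (q, T, p) = (if q = 1 then (q, T, p) else
     (case (K ! q) (T p) of (q', w, d) \<Rightarrow> (q', T(p := w), shift d p)))"

definition holds_at :: "code \<Rightarrow> nat \<Rightarrow> code \<Rightarrow> bool" where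
  "holds_at K n c \<longleftrightarrow> (\<forall>i < length c. K ! (n + i) = c ! i)"

lemma holds_at_append:
  "holds_at K n (c @ d) \<longleftrightarrow> holds_at K n c \<and> holds_at K (n + length c) d"
  unfolding holds_at_def
proof safe
  fix i assume *: "\<forall>i<length (c @ d). K ! (n + i) = (c @ d) ! i"
  { assume "i < length c" with * show "K ! (n + i) = c ! i" by (auto simp: nth_append) }
  { assume "i < length d" with *[rule_format, of "length c + i"]
    show "K ! (n + length c + i) = d ! i" by (auto simp: nth_append add.assoc) }
next
  fix i assume 1: "\<forall>i<length c. K ! (n + i) = c ! i"
    and 2: "\<forall>i<length d. K ! (n + length c + i) = d ! i" and i: "i < length (c @ d)"
  show "K ! (n + i) = (c @ d) ! i"
    using 1[rule_format, of i] 2[rule_format, of "i - length c"] i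
    by (cases "i < length c") (auto simp: nth_append)
qed

lemma holds_at_Cons: "holds_at K n (x # c) \<longleftrightarrow> K ! n = x \<and> holds_at K (Suc n) c"
  using holds_at_append[of K n "[x]" c] by (auto simp: holds_at_def)

text \<open>The bound \<open>n \<ge> 2\<close> keeps the block clear of state 1, in which
  \<open>astep\<close> halts.\<close>

lemma compile_correct:
  assumes "texec a T p t T' p'" "holds_at K n (compile a n)" "n \<ge> 2"
  shows "(astep K ^^ t) (n, T, p) = (n + csize a, T', p')"
  using assms
proof (induction arbitrary: n rule: texec.induct)
  case (Act f T p w d)
  then show ?case by (auto simp: holds_at_Cons)
next
  case (Seq a T p t T' p' b t' T'' p'')
  then have "(astep K ^^ t) (n, T, p) = (n + csize a, T', p')"
    "(astep K ^^ t') (n + csize a, T', p') = (n + csize a + csize b, T'', p'')"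
    by (auto simp: holds_at_append)
  then show ?case by (simp add: add.commute[of t t'] funpow_add add.assoc)
next
  case (IfT T p S a t T' p' b)
  let ?e = "astep K"
  from IfT have 1: "?e (n, T, p) = (n + 1, T, p)" by (auto simp: holds_at_Cons)
  from IfT have 2: "(?e ^^ t) (n + 1, T, p) = (n + 1 + csize a, T', p')"
    by (auto simp: holds_at_Cons holds_at_append)
  from IfT have 3: "?e (n + 1 + csize a, T', p') = (n + csize a + 2 + csize b, T', p')"
    by (auto simp: holds_at_Cons holds_at_append)
  have "(?e ^^ (1 + t + 1)) (n, T, p) = ?e ((?e ^^ t) (?e (n, T, p)))"
    by (simp add: funpow_swap1)
  then show ?case using 1 2 3 by simp
next
  case (IfF T p S b t T' p' a)
  let ?e = "astep K"
  from IfF have 1: "?e (n, T, p) = (n + csize a + 2, T, p)" by (auto simp: holds_at_Cons)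
  from IfF have 2: "(?e ^^ t) (n + csize a + 2, T, p) = (n + csize a + 2 + csize b, T', p')"
    by (auto simp: holds_at_Cons holds_at_append)
  have "(?e ^^ (1 + t)) (n, T, p) = (?e ^^ t) (?e (n, T, p))" by (simp add: funpow_swap1)
  then show ?case using 1 2 by simp
next
  case (WhileF T p S a)
  then show ?case by (auto simp: holds_at_Cons)
next
  case (WhileT T p S a t T' p' t' T'' p'')
  let ?e = "astep K"
  from WhileT have 1: "?e (n, T, p) = (n + 1, T, p)" by (auto simp: holds_at_Cons)
  from WhileT have 2: "(?e ^^ t) (n + 1, T, p) = (n + 1 + csize a, T', p')"
    by (auto simp: holds_at_Cons holds_at_append)
  from WhileT have 3: "?e (n + 1 + csize a, T', p') = (n, T', p')"
    by (auto simp: holds_at_Cons holds_at_append)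
  from WhileT have 4: "(?e ^^ t') (n, T', p') = (n + csize (TWhile S a), T'', p'')"
    by blast
  have "(?e ^^ (1 + t + 1 + t')) (n, T, p) = (?e ^^ t') (?e ((?e ^^ t) (?e (n, T, p))))"
  proof -
    have "(?e ^^ (t' + (1 + (t + 1)))) (n, T, p) = (?e ^^ t') (?e ((?e ^^ t) (?e (n, T, p))))"
      unfolding funpow_add by simp
    then show ?thesis by (simp add: algebra_simps)
  qed
  then show ?case using 1 2 3 4 by simp
qed

text \<open>The start state 0 jumps over the halting state 1 to the code at state 2, and the last
  state jumps to 1. These two jumps are the two extra steps in \<open>machine_runs\<close>.\<close>

definition machine :: "tprog \<Rightarrow> tm" where
  "machine a = (let K = [\<lambda>s. (2, s, Stay), \<lambda>s. (1, s, Stay)] @ compile a 2 @ [\<lambda>s. (1, s, Stay)]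
     in (length K, \<lambda>q. K ! q))"

lemma tm_wf_machine: "tm_wf (machine a)"
proof -
  define K where "K = [\<lambda>s. (2, s, Stay), \<lambda>s. (1, s, Stay)] @ compile a 2 @ [\<lambda>s. (1, s, Stay)]"
  have "fst (c s) < length K" if "c \<in> set K" for c :: "sym \<Rightarrow> nat \<times> sym \<times> dir" and s
    using that compile_targets[of c a 2 s] by (auto simp: K_def)
  moreover have "machine a = (length K, \<lambda>q. K ! q)" by (simp add: machine_def K_def Let_def)
  moreover have "length K \<ge> 2" by (simp add: K_def)
  ultimately show ?thesis by (simp add: tm_wf_def)
qed

section \<open>Configurations as tapes indexed by the integers\<close>

definition nthb :: "sym list \<Rightarrow> nat \<Rightarrow> sym" where
  "nthb xs i = (if i < length xs then xs ! i else Bk)"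

lemma nthb_simps [simp]:
  "nthb [] i = Bk" "nthb (x # xs) 0 = x" "nthb (x # xs) (Suc i) = nthb xs i"
  by (auto simp: nthb_def)

lemma nthb_tl: "nthb (tl xs) i = nthb xs (Suc i)"
  by (cases xs) auto

lemma nthb_0: "nthb xs 0 = hd_sym xs"
  by (cases xs) (auto simp: hd_sym_def)

text \<open>On the integer tape every cell keeps a fixed address, so programs can be verified by
  arithmetic on positions; cells beyond either list count as blank.\<close>

definition tape_rel :: "sym list \<Rightarrow> sym list \<Rightarrow> tape \<Rightarrow> int \<Rightarrow> bool" where
  "tape_rel ls rs T p \<longleftrightarrow> (\<forall>i. T (p + int i) = nthb rs i) \<and> (\<forall>i. T (p - 1 - int i) = nthb ls i)"

lemma tape_rel_head: "tape_rel ls rs T p \<Longrightarrow> T p = hd_sym rs"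
  unfolding tape_rel_def using nthb_0 by (metis add.right_neutral of_nat_0)

lemma tape_rel_write:
  assumes "tape_rel ls rs T p" shows "tape_rel ls (w # tl rs) (T(p := w)) p"
  unfolding tape_rel_def
proof (intro conjI allI)
  fix i show "(T(p := w)) (p + int i) = nthb (w # tl rs) i"
  proof (cases i)
    case (Suc j) then show ?thesis
      using assms[unfolded tape_rel_def, THEN conjunct1, rule_format, of "Suc j"]
      by (simp add: nthb_tl)
  qed simp
  show "(T(p := w)) (p - 1 - int i) = nthb ls i"
    using assms by (auto simp: tape_rel_def)
qed

lemma tape_rel_right:
  assumes "tape_rel ls (r # rs) T p" shows "tape_rel (r # ls) rs T (p + 1)"
  unfolding tape_rel_def
proof (intro conjI allI)
  fix i show "T (p + 1 + int i) = nthb rs i"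
    using assms[unfolded tape_rel_def, THEN conjunct1, rule_format, of "Suc i"]
    by (simp add: algebra_simps)
  show "T (p + 1 - 1 - int i) = nthb (r # ls) i"
  proof (cases i)
    case 0 then show ?thesis
      using assms[unfolded tape_rel_def, THEN conjunct1, rule_format, of 0] by simp
  next
    case (Suc j) then show ?thesis
      using assms[unfolded tape_rel_def, THEN conjunct2, rule_format, of j]
      by (simp add: algebra_simps)
  qed
qed

lemma tape_rel_left:
  assumes "tape_rel ls rs T p" shows "tape_rel (tl ls) (hd_sym ls # rs) T (p - 1)"
  unfolding tape_rel_def
proof (intro conjI allI)
  fix i show "T (p - 1 + int i) = nthb (hd_sym ls # rs) i"
  proof (cases i)
    case 0 then show ?thesis
      using assms[unfolded tape_rel_def, THEN conjunct2, rule_format, of 0] by (simp add: nthb_0[of ls])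
  next
    case (Suc j) then show ?thesis
      using assms[unfolded tape_rel_def, THEN conjunct1, rule_format, of j]
      by (simp add: algebra_simps)
  qed
  show "T (p - 1 - 1 - int i) = nthb (tl ls) i"
    using assms[unfolded tape_rel_def, THEN conjunct2, rule_format, of "Suc i"]
    by (simp add: algebra_simps nthb_tl)
qed

definition conf_rel :: "config \<Rightarrow> nat \<times> tape \<times> int \<Rightarrow> bool" where
  "conf_rel c a \<longleftrightarrow> fst c = fst a \<and> tape_rel (fst (snd c)) (snd (snd c)) (fst (snd a)) (snd (snd a))"

lemma tm_step_astep:
  assumes "conf_rel c a" "M = (N, \<lambda>q. K ! q)"
  shows "conf_rel (tm_step M c) (astep K a)"
proof -
  obtain q ls rs where c: "c = (q, ls, rs)" by (cases c) auto
  obtain q0 T p where a: "a = (q0, T, p)" by (cases a) auto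
  from assms have q0: "q0 = q" and R: "tape_rel ls rs T p" by (auto simp: conf_rel_def c a)
  obtain q' w d where d: "(K ! q) (hd_sym rs) = (q', w, d)" by (cases "(K ! q) (hd_sym rs)") auto
  have R1: "tape_rel ls (w # tl rs) (T(p := w)) p" using R by (rule tape_rel_write)
  show ?thesis
  proof (cases "q = 1")
    case True then show ?thesis using R by (simp add: c a q0 conf_rel_def)
  next
    case False
    then show ?thesis
      using d tape_rel_head[OF R] R1 tape_rel_right[OF R1] tape_rel_left[OF R1]
      by (cases d; cases ls) (auto simp: c a q0 assms conf_rel_def Let_def hd_sym_def)
  qed
qed

lemma tm_steps_asteps:
  assumes "conf_rel c a" "M = (N, \<lambda>q. K ! q)"
  shows "conf_rel ((tm_step M ^^ t) c) ((astep K ^^ t) a)"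
  using assms(1) by (induction t) (auto intro: tm_step_astep[OF _ assms(2)])

lemma takeWhile_nthb:
  assumes "\<And>i. i < length out \<Longrightarrow> nthb rs i = out ! i" "nthb rs (length out) = e" "\<not> P e"
    "\<forall>x \<in> set out. P x" "\<not> P Bk"
  shows "takeWhile P rs = out"
  using assms
proof (induction out arbitrary: rs)
  case Nil then show ?case by (cases rs) auto
next
  case (Cons x out)
  from Cons.prems(1)[of 0] have "nthb rs 0 = x" by simp
  with Cons.prems(4,5) obtain rs' where rs: "rs = x # rs'" by (cases rs) auto
  have "takeWhile P rs' = out"
    using Cons.prems(1)[of "Suc i" for i] Cons.prems(2-) by (intro Cons.IH) (auto simp: rs)
  with Cons.prems(4) show ?case by (simp add: rs)
qed

text \<open>The origin of the integer coordinates is arbitrary; starting the head at cell 2 leaves room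
  for the bookkeeping cells 0 and 1 between the stacks and the input.\<close>

definition input_tape :: "sym list \<Rightarrow> tape" where
  "input_tape w p = (if p < 2 then Bk else nthb w (nat (p - 2)))"

text \<open>The closing \<open>Hash\<close> delimits the result, since \<open>tm_output\<close>
  reads up to the first symbol that is not a bit.\<close>

lemma machine_runs:
  assumes "texec a (input_tape w) 2 t T p"
    and "\<And>i. i < length out \<Longrightarrow> T (p + int i) = sym_of_bool (out ! i)"
    and "T (p + int (length out)) = Hash"
  shows "\<exists>t' \<le> t + 2. fst (tm_run (machine a) t' w) = 1 \<and> tm_output (tm_run (machine a) t' w) = out"
proof -
  define K where "K = [\<lambda>s. (2, s, Stay), \<lambda>s. (1, s, Stay)] @ compile a 2 @ [\<lambda>s. (1, s, Stay)]"
  have M: "machine a = (length K, \<lambda>q. K ! q)" by (simp add: machine_def K_def Let_def)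
  have K0: "K ! 0 = (\<lambda>s. (2, s, Stay))" by (simp add: K_def)
  have Ke: "K ! (2 + csize a) = (\<lambda>s. (1, s, Stay))" by (simp add: K_def nth_append)
  have Kh: "holds_at K 2 (compile a 2)" by (auto simp: K_def holds_at_def nth_append)
  have 1: "astep K (0, input_tape w, 2) = (2, input_tape w, 2)" by (simp add: K0)
  have 2: "(astep K ^^ t) (2, input_tape w, 2) = (2 + csize a, T, p)"
    using compile_correct[OF assms(1) Kh] by simp
  have 3: "astep K (2 + csize a, T, p) = (1, T, p)" using Ke by simp
  have "(astep K ^^ (Suc (Suc t))) (0, input_tape w, 2) = (1, T, p)"
    using 1 2 3 by (simp add: funpow_swap1)
  moreover have "conf_rel (0, [], w) (0, input_tape w, 2)"
    by (auto simp: conf_rel_def tape_rel_def input_tape_def)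
  ultimately have C: "conf_rel (tm_run (machine a) (Suc (Suc t)) w) (1, T, p)"
    unfolding tm_run_def using tm_steps_asteps[OF _ M] by metis
  obtain q ls rs where c: "tm_run (machine a) (Suc (Suc t)) w = (q, ls, rs)"
    by (cases "tm_run (machine a) (Suc (Suc t)) w") auto
  from C have q: "q = 1" and R: "\<And>i. nthb rs i = T (p + int i)"
    by (auto simp: conf_rel_def c tape_rel_def)
  have "takeWhile (\<lambda>s. s = B0 \<or> s = B1) rs = map sym_of_bool out"
    by (rule takeWhile_nthb[where e = Hash])
      (use assms(2,3) in \<open>auto simp: R sym_of_bool_def\<close>)
  then have "tm_output (q, ls, rs) = out"
    by (auto simp: tm_output_def bool_of_sym_def sym_of_bool_def intro!: map_idI split: if_splits)
  then show ?thesis using c q by (intro exI[of _ "Suc (Suc t)"]) auto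
qed

section \<open>Programs over three stacks\<close>

text \<open>Exact step counts are weakened to upper bounds, so that runs of different cost can share
  one bound.\<close>

definition trun :: "tprog \<Rightarrow> tape \<Rightarrow> int \<Rightarrow> nat \<Rightarrow> tape \<Rightarrow> int \<Rightarrow> bool" where
  "trun a T p B T' p' \<longleftrightarrow> (\<exists>t \<le> B. texec a T p t T' p')"

lemma trun_Act: "f (T p) = (w, d) \<Longrightarrow> 1 \<le> B \<Longrightarrow> trun (Act f) T p B (T(p := w)) (shift d p)"
  unfolding trun_def using texec.Act by blast

lemma trun_Seq:
  "trun a T p t T' p' \<Longrightarrow> trun b T' p' t' T'' p'' \<Longrightarrow> t + t' \<le> B \<Longrightarrow> trun (TSeq a b) T p B T'' p''"
  unfolding trun_def using texec.Seq by (meson add_mono le_trans)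

lemma trun_IfT: "T p \<in> S \<Longrightarrow> trun a T p t T' p' \<Longrightarrow> t + 2 \<le> B \<Longrightarrow> trun (TIf S a b) T p B T' p'"
  unfolding trun_def by (elim exE conjE, rule exI, rule conjI[rotated], erule (1) texec.IfT) simp

lemma trun_IfF: "T p \<notin> S \<Longrightarrow> trun b T p t T' p' \<Longrightarrow> t + 2 \<le> B \<Longrightarrow> trun (TIf S a b) T p B T' p'"
  unfolding trun_def by (elim exE conjE, rule exI, rule conjI[rotated], erule (1) texec.IfF) simp

lemma trun_WhileF: "T p \<notin> S \<Longrightarrow> 1 \<le> B \<Longrightarrow> trun (TWhile S a) T p B T p"
  unfolding trun_def using texec.WhileF by blast

lemma trun_WhileT:
  assumes "T p \<in> S" "trun a T p t T' p'" "trun (TWhile S a) T' p' t' T'' p''" "t + t' + 2 \<le> B"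
  shows "trun (TWhile S a) T p B T'' p''"
proof -
  from assms(2,3) obtain u u' where "u \<le> t" "u' \<le> t'" "texec a T p u T' p'"
    "texec (TWhile S a) T' p' u' T'' p''" unfolding trun_def by blast
  moreover from this have "texec (TWhile S a) T p (1 + u + 1 + u') T'' p''"
    using texec.WhileT assms(1) by blast
  ultimately show ?thesis using assms(4) unfolding trun_def
    by (intro exI[of _ "1 + u + 1 + u'"]) auto
qed

lemma trun_mono: "trun a T p t T' p' \<Longrightarrow> t \<le> B \<Longrightarrow> trun a T p B T' p'"
  unfolding trun_def by (meson le_trans)

fun walk :: "dir \<Rightarrow> nat \<Rightarrow> tprog" where
  "walk d 0 = Act (\<lambda>s. (s, Stay))"
| "walk d (Suc n) = TSeq (Act (\<lambda>s. (s, d))) (walk d n)"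

lemma trun_walkL: "n + 1 \<le> B \<Longrightarrow> q = p - int n \<Longrightarrow> trun (walk Lft n) T p B T q"
proof (induction n arbitrary: p B)
  case 0 then show ?case using trun_Act[of "\<lambda>s. (s, Stay)" T p "T p" Stay B] by simp
next
  case (Suc n)
  have "trun (Act (\<lambda>s. (s, Lft))) T p 1 T (p - 1)"
    using trun_Act[of "\<lambda>s. (s, Lft)" T p "T p" Lft 1] by simp
  moreover have "trun (walk Lft n) T (p - 1) (n + 1) T q" using Suc by auto
  ultimately show ?case using Suc.prems by (auto elim!: trun_Seq)
qed

lemma trun_walkR: "n + 1 \<le> B \<Longrightarrow> q = p + int n \<Longrightarrow> trun (walk Rgt n) T p B T q"
proof (induction n arbitrary: p B)
  case 0 then show ?case using trun_Act[of "\<lambda>s. (s, Stay)" T p "T p" Stay B] by simp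
next
  case (Suc n)
  have "trun (Act (\<lambda>s. (s, Rgt))) T p 1 T (p + 1)"
    using trun_Act[of "\<lambda>s. (s, Rgt)" T p "T p" Rgt 1] by simp
  moreover have "trun (walk Rgt n) T (p + 1) (n + 1) T q" using Suc by auto
  ultimately show ?case using Suc.prems by (auto elim!: trun_Seq)
qed

text \<open>One round costs \<open>k + 3\<close>: the walk takes \<open>k + 1\<close> steps, the
  test and the jump back one each. The failing test gives the final \<open>+ 1\<close>.\<close>

lemma trun_scanL:
  assumes "\<And>i. i < m \<Longrightarrow> T (p - int k * int i) \<in> S" "T (p - int k * int m) \<notin> S"
    "q = p - int k * int m" "(k + 3) * m + 1 \<le> B"
  shows "trun (TWhile S (walk Lft k)) T p B T q"
  using assms
proof (induction m arbitrary: p B)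
  case 0 then show ?case by (auto intro: trun_WhileF)
next
  case (Suc m)
  have "trun (TWhile S (walk Lft k)) T (p - int k) ((k + 3) * m + 1) T q"
  proof (rule Suc.IH)
    fix i assume "i < m"
    then show "T (p - int k - int k * int i) \<in> S"
      using Suc.prems(1)[of "Suc i"] by (simp add: algebra_simps)
  qed (use Suc.prems in \<open>auto simp: algebra_simps\<close>)
  moreover have "trun (walk Lft k) T p (k + 1) T (p - int k)" by (rule trun_walkL) auto
  moreover have "T p \<in> S" using Suc.prems(1)[of 0] by simp
  ultimately show ?case using Suc.prems(4) by (elim trun_WhileT) auto
qed

lemma trun_scanR:
  assumes "\<And>i. i < m \<Longrightarrow> T (p + int k * int i) \<in> S" "T (p + int k * int m) \<notin> S"
    "q = p + int k * int m" "(k + 3) * m + 1 \<le> B"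
  shows "trun (TWhile S (walk Rgt k)) T p B T q"
  using assms
proof (induction m arbitrary: p B)
  case 0 then show ?case by (auto intro: trun_WhileF)
next
  case (Suc m)
  have "trun (TWhile S (walk Rgt k)) T (p + int k) ((k + 3) * m + 1) T q"
  proof (rule Suc.IH)
    fix i assume "i < m"
    then show "T (p + int k + int k * int i) \<in> S"
      using Suc.prems(1)[of "Suc i"] by (simp add: algebra_simps)
  qed (use Suc.prems in \<open>auto simp: algebra_simps\<close>)
  moreover have "trun (walk Rgt k) T p (k + 1) T (p + int k)" by (rule trun_walkR) auto
  moreover have "T p \<in> S" using Suc.prems(1)[of 0] by simp
  ultimately show ?case using Suc.prems(4) by (elim trun_WhileT) auto
qed

datatype sprog =
    Skip
  | Push nat sym
  | Pop nat
  | SSeq sprog sprog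
  | SIf nat "sym set" sprog sprog
  | SWhile nat "sym set" sprog

type_synonym stacks = "nat \<Rightarrow> sym list"

inductive sexec :: "sprog \<Rightarrow> stacks \<Rightarrow> nat \<Rightarrow> stacks \<Rightarrow> bool" where
  Skip: "sexec Skip \<sigma> 1 \<sigma>"
| Push: "r < 3 \<Longrightarrow> s \<noteq> Bk \<Longrightarrow> sexec (Push r s) \<sigma> 1 (\<sigma>(r := s # \<sigma> r))"
| Pop: "r < 3 \<Longrightarrow> sexec (Pop r) \<sigma> 1 (\<sigma>(r := tl (\<sigma> r)))"
| Seq: "sexec a \<sigma> t \<sigma>' \<Longrightarrow> sexec b \<sigma>' t' \<sigma>'' \<Longrightarrow> sexec (SSeq a b) \<sigma> (t + t') \<sigma>''"
| IfT: "r < 3 \<Longrightarrow> hd_sym (\<sigma> r) \<in> S \<Longrightarrow> sexec a \<sigma> t \<sigma>' \<Longrightarrow> sexec (SIf r S a b) \<sigma> (1 + t) \<sigma>'"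
| IfF: "r < 3 \<Longrightarrow> hd_sym (\<sigma> r) \<notin> S \<Longrightarrow> sexec b \<sigma> t \<sigma>' \<Longrightarrow> sexec (SIf r S a b) \<sigma> (1 + t) \<sigma>'"
| WhileF: "r < 3 \<Longrightarrow> hd_sym (\<sigma> r) \<notin> S \<Longrightarrow> sexec (SWhile r S a) \<sigma> 1 \<sigma>"
| WhileT: "r < 3 \<Longrightarrow> hd_sym (\<sigma> r) \<in> S \<Longrightarrow> sexec a \<sigma> t \<sigma>' \<Longrightarrow> sexec (SWhile r S a) \<sigma>' t' \<sigma>'' \<Longrightarrow>
    sexec (SWhile r S a) \<sigma> (1 + t + t') \<sigma>''"

definition stacks_ok :: "stacks \<Rightarrow> bool" where
  "stacks_ok \<sigma> \<longleftrightarrow> (\<forall>r < 3. Bk \<notin> set (\<sigma> r))"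

definition height :: "stacks \<Rightarrow> nat" where
  "height \<sigma> = (\<Sum>r<3. length (\<sigma> r))"

lemma height_upd: "r < 3 \<Longrightarrow> height (\<sigma>(r := l)) + length (\<sigma> r) = height \<sigma> + length l"
  by (auto simp: height_def eval_nat_numeral less_Suc_eq)

lemma length_le_height: "r < 3 \<Longrightarrow> length (\<sigma> r) \<le> height \<sigma>"
  by (auto simp: height_def eval_nat_numeral less_Suc_eq)

text \<open>A step pushes at most one symbol. This turns running times into bounds on the distances
  that the head has to scan.\<close>

lemma sexec_height: "sexec a \<sigma> t \<sigma>' \<Longrightarrow> height \<sigma>' \<le> height \<sigma> + t"
proof (induction rule: sexec.induct)
  case (Push r s \<sigma>) then show ?case using height_upd[of r \<sigma> "s # \<sigma> r"] by (simp del: fun_upd_apply)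
next
  case (Pop r \<sigma>) then show ?case using height_upd[of r \<sigma> "tl (\<sigma> r)"] by (simp del: fun_upd_apply)
qed auto

lemma in_tl: "x \<in> set (tl xs) \<Longrightarrow> x \<in> set xs"
  by (cases xs) auto

lemma sexec_ok: "sexec a \<sigma> t \<sigma>' \<Longrightarrow> stacks_ok \<sigma> \<Longrightarrow> stacks_ok \<sigma>'"
  by (induction rule: sexec.induct) (auto simp: stacks_ok_def dest: in_tl)

text \<open>The three stacks are tracks of the nonpositive half of the tape, growing to the left:
  entry \<open>j\<close> (counted from the bottom) of stack \<open>r\<close> sits in cell \<open>-(4(j+1) + r + 1)\<close>.
  Track 0 carries only the end marker in cell 0, and the row of that marker is otherwise
  blank, so that looking at the top of an empty stack reads a blank.\<close>

definition tape_of :: "tape \<Rightarrow> stacks \<Rightarrow> tape" where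
  "tape_of R \<sigma> p = (if p > 0 then R p else
     (let k = nat (- p); j = k div 4; r = k mod 4 in
      if j = 0 then (if r = 0 then Hash else Bk)
      else if r = 0 then Bk else nthb (rev (\<sigma> (r - 1))) (j - 1)))"

lemma tape_of_track0: "tape_of R \<sigma> (- (4 * int j)) = (if j = 0 then Hash else Bk)"
proof -
  have "nat (4 * int j) = 4 * j" by simp
  then show ?thesis by (auto simp: tape_of_def Let_def)
qed

definition cell :: "nat \<Rightarrow> nat \<Rightarrow> int" where
  "cell r j = - (4 * int j + int r + 1)"

lemma nat_cell: "nat (- cell r j) = 4 * j + (r + 1)" by (simp add: cell_def)

lemma cell_div: "r < 3 \<Longrightarrow> (4 * j + (r + 1)) div 4 = (j :: nat)" by presburger
lemma cell_mod: "r < 3 \<Longrightarrow> (4 * j + (r + 1)) mod 4 = (r + 1 :: nat)" by presburger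

lemma tape_of_cell:
  "r < 3 \<Longrightarrow> tape_of R \<sigma> (cell r j) = (if j = 0 then Bk else nthb (rev (\<sigma> r)) (j - 1))"
  unfolding tape_of_def Let_def nat_cell cell_div cell_mod by (auto simp: cell_def)

lemma cell_cases:
  assumes "p \<le> 0" "nat (- p) mod 4 \<noteq> 0"
  obtains r j where "r < 3" "p = cell r j"
proof -
  define k where "k = nat (- p)"
  have p: "p = - int k" using assms by (simp add: k_def)
  show ?thesis
  proof (rule that[of "k mod 4 - 1" "k div 4"])
    have "k mod 4 \<noteq> 0" "k mod 4 < 4" using assms by (auto simp: k_def)
    then show "k mod 4 - 1 < 3" by simp
    have "4 * (k div 4) + k mod 4 = k" by simp
    with \<open>k mod 4 \<noteq> 0\<close> show "p = cell (k mod 4 - 1) (k div 4)" unfolding p cell_def by linarith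
  qed
qed

lemma cell_inj: "r < 3 \<Longrightarrow> r' < 3 \<Longrightarrow> cell r j = cell r' j' \<longleftrightarrow> r = r' \<and> j = j'"
  by (metis nat_cell cell_div cell_mod add_right_cancel)

text \<open>The lists are reversed because entries are numbered from the bottom. Row 0 must stay
  blank; the case \<open>j = 0\<close> arises when an empty stack is popped.\<close>

lemma tape_of_update:
  assumes r: "r < 3"
    and "\<And>i. nthb (rev l) i = (if Suc i = j then s else nthb (rev (\<sigma> r)) i)"
    and "j = 0 \<Longrightarrow> s = Bk"
  shows "(tape_of R \<sigma>)(cell r j := s) = tape_of R (\<sigma>(r := l))"
proof
  fix p
  show "((tape_of R \<sigma>)(cell r j := s)) p = tape_of R (\<sigma>(r := l)) p"
  proof (cases "p \<le> 0 \<and> nat (- p) mod 4 \<noteq> 0")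
    case False
    moreover have "nat (- cell r j) mod 4 \<noteq> 0" unfolding nat_cell cell_mod[OF r] by simp
    moreover have "cell r j \<le> 0" by (simp add: cell_def)
    ultimately have "p \<noteq> cell r j" by auto
    with False show ?thesis by (auto simp: tape_of_def Let_def)
  next
    case True
    then obtain r' j' where r': "r' < 3" and p: "p = cell r' j'" by (auto elim: cell_cases)
    show ?thesis using r r' assms(3) by (auto simp: p cell_inj tape_of_cell assms(2))
  qed
qed

lemma tape_of_push:
  "r < 3 \<Longrightarrow> (tape_of R \<sigma>)(cell r (Suc (length (\<sigma> r))) := s) = tape_of R (\<sigma>(r := s # \<sigma> r))"
  by (rule tape_of_update) (auto simp: nthb_def nth_append less_Suc_eq)

lemma tape_of_pop:
  "r < 3 \<Longrightarrow> (tape_of R \<sigma>)(cell r (length (\<sigma> r)) := Bk) = tape_of R (\<sigma>(r := tl (\<sigma> r)))"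
  by (cases "\<sigma> r"; rule tape_of_update) (auto simp: nthb_def nth_append less_Suc_eq)

lemma tape_of_top: "r < 3 \<Longrightarrow> tape_of R \<sigma> (cell r (length (\<sigma> r))) = hd_sym (\<sigma> r)"
  by (cases "\<sigma> r") (auto simp: tape_of_cell nthb_def nth_append hd_sym_def)

text \<open>From cell 0, \<open>r + 5\<close> steps lead to \<open>cell r 1\<close>, the place of
  the bottom entry; strides of 4 then stay on the track of stack \<open>r\<close> up to its first
  blank.\<close>

definition goto :: "nat \<Rightarrow> tprog" where
  "goto r = TSeq (walk Lft (r + 5)) (TWhile {B0, B1, Hash} (walk Lft 4))"

definition peek :: "nat \<Rightarrow> tprog" where
  "peek r = TSeq (goto r) (walk Rgt 4)"

text \<open>The walk changes to track 0, on which the only \<open>Hash\<close> is the marker in cell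
  0.\<close>

definition home :: "nat \<Rightarrow> tprog" where
  "home r = TSeq (walk Rgt (r + 1)) (TWhile {Bk, B0, B1} (walk Rgt 4))"

lemma trun_goto:
  assumes r: "r < 3" and ok: "stacks_ok \<sigma>" and H: "length (\<sigma> r) \<le> B"
  shows "trun (goto r) (tape_of R \<sigma>) 0 (9 + 7 * B) (tape_of R \<sigma>) (cell r (Suc (length (\<sigma> r))))"
  unfolding goto_def
proof (rule trun_Seq)
  show "trun (walk Lft (r + 5)) (tape_of R \<sigma>) 0 (r + 6) (tape_of R \<sigma>) (cell r 1)"
    by (rule trun_walkL) (auto simp: cell_def)
  have eq: "cell r 1 - int 4 * int i = cell r (Suc i)" for i by (simp add: cell_def)
  show "trun (TWhile {B0, B1, Hash} (walk Lft 4)) (tape_of R \<sigma>) (cell r 1) (7 * B + 1)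
     (tape_of R \<sigma>) (cell r (Suc (length (\<sigma> r))))"
  proof (rule trun_scanL[where m = "length (\<sigma> r)"])
    fix i assume i: "i < length (\<sigma> r)"
    then have "rev (\<sigma> r) ! i \<noteq> Bk" using ok r
      by (metis stacks_ok_def length_rev nth_mem set_rev)
    with i show "tape_of R \<sigma> (cell r 1 - int 4 * int i) \<in> {B0, B1, Hash}"
      unfolding eq by (cases "rev (\<sigma> r) ! i") (auto simp: tape_of_cell[OF r] nthb_def)
  next
    show "tape_of R \<sigma> (cell r 1 - int 4 * int (length (\<sigma> r))) \<notin> {B0, B1, Hash}"
      unfolding eq by (auto simp: tape_of_cell[OF r] nthb_def)
  qed (use H eq in auto)
qed (use r in auto)

lemma trun_peek:
  assumes r: "r < 3" and ok: "stacks_ok \<sigma>" and H: "length (\<sigma> r) \<le> B"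
  shows "trun (peek r) (tape_of R \<sigma>) 0 (14 + 7 * B) (tape_of R \<sigma>) (cell r (length (\<sigma> r)))"
  unfolding peek_def
  by (rule trun_Seq[OF trun_goto[OF assms] trun_walkR[of _ 5]]) (auto simp: cell_def)

lemma trun_home:
  assumes r: "r < 3" and j: "j \<le> Suc B"
  shows "trun (home r) (tape_of R \<sigma>) (cell r j) (12 + 7 * B) (tape_of R \<sigma>) 0"
  unfolding home_def
proof (rule trun_Seq)
  show "trun (walk Rgt (r + 1)) (tape_of R \<sigma>) (cell r j) (r + 2) (tape_of R \<sigma>) (- (4 * int j))"
    by (rule trun_walkR) (auto simp: cell_def)
  show "trun (TWhile {Bk, B0, B1} (walk Rgt 4)) (tape_of R \<sigma>) (- (4 * int j)) (7 * B + 8)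
     (tape_of R \<sigma>) 0"
  proof (rule trun_scanR[where m = j])
    fix i assume i: "i < j"
    then have "- (4 * int j) + int 4 * int i = - (4 * int (j - i))" by (simp add: of_nat_diff)
    then show "tape_of R \<sigma> (- (4 * int j) + int 4 * int i) \<in> {Bk, B0, B1}"
      using i by (simp only: tape_of_track0) auto
  next
    show "tape_of R \<sigma> (- (4 * int j) + int 4 * int j) \<notin> {Bk, B0, B1}"
      using tape_of_track0[of R \<sigma> 0] by simp
  qed (use j in auto)
qed (use r in auto)

fun s2t :: "sprog \<Rightarrow> tprog" where
  "s2t Skip = walk Lft 0"
| "s2t (Push r s) = TSeq (goto r) (TSeq (Act (\<lambda>_. (s, Stay))) (home r))"
| "s2t (Pop r) = TSeq (peek r) (TSeq (Act (\<lambda>_. (Bk, Stay))) (home r))"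
| "s2t (SSeq a b) = TSeq (s2t a) (s2t b)"
| "s2t (SIf r S a b) = TSeq (peek r) (TIf S (TSeq (home r) (s2t a)) (TSeq (home r) (s2t b)))"
| "s2t (SWhile r S a) = TSeq (peek r)
     (TSeq (TWhile S (TSeq (home r) (TSeq (s2t a) (peek r)))) (home r))"

lemma trun_SeqE:
  assumes "trun (TSeq a b) T p B T'' p''"
  obtains t t' T' p' where "trun a T p t T' p'" "trun b T' p' t' T'' p''" "t + t' \<le> B"
proof -
  from assms obtain u where "u \<le> B" "texec (TSeq a b) T p u T'' p''" unfolding trun_def by blast
  then obtain t t' T' p' where "texec a T p t T' p'" "texec b T' p' t' T'' p''" "u = t + t'"
    by (auto elim: texec.cases)
  with \<open>u \<le> B\<close> show ?thesis by (intro that[of t T' p' t']) (auto simp: trun_def)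
qed

text \<open>Every stack operation starts and ends with the head in cell 0 and scans to the top of a
  stack and back. Heights never exceed the initial height plus the time, so \<open>B\<close> bounds
  every scan and one step costs an amount linear in \<open>B\<close>.\<close>

lemma s2t_correct:
  assumes "sexec a \<sigma> t \<sigma>'" "stacks_ok \<sigma>" "height \<sigma> + t \<le> B"
  shows "trun (s2t a) (tape_of R \<sigma>) 0 (t * (100 + 100 * B)) (tape_of R \<sigma>') 0"
  using assms
proof (induction rule: sexec.induct)
  case (Skip \<sigma>)
  then show ?case by (auto intro: trun_walkL[of 0, simplified])
next
  case (Push r s \<sigma>)
  then have L: "length (\<sigma> r) \<le> B" using length_le_height[of r \<sigma>] by simp
  have 1: "trun (Act (\<lambda>_. (s, Stay))) (tape_of R \<sigma>) (cell r (Suc (length (\<sigma> r)))) 1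
     (tape_of R (\<sigma>(r := s # \<sigma> r))) (cell r (Suc (length (\<sigma> r))))"
    using trun_Act[of "\<lambda>_. (s, Stay)" "tape_of R \<sigma>" "cell r (Suc (length (\<sigma> r)))" s Stay 1]
    by (simp add: tape_of_push Push)
  show ?case unfolding s2t.simps
    by (rule trun_Seq[OF trun_goto[where \<sigma> = \<sigma> and r = r, OF _ _ L] trun_Seq[OF 1 trun_home[where B = B]]]) (use Push L in auto)
next
  case (Pop r \<sigma>)
  then have L: "length (\<sigma> r) \<le> B" using length_le_height[of r \<sigma>] by simp
  have 1: "trun (Act (\<lambda>_. (Bk, Stay))) (tape_of R \<sigma>) (cell r (length (\<sigma> r))) 1
     (tape_of R (\<sigma>(r := tl (\<sigma> r)))) (cell r (length (\<sigma> r)))"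
    using trun_Act[of "\<lambda>_. (Bk, Stay)" "tape_of R \<sigma>" "cell r (length (\<sigma> r))" Bk Stay 1]
    by (simp add: tape_of_pop Pop)
  show ?case unfolding s2t.simps
    by (rule trun_Seq[OF trun_peek[where \<sigma> = \<sigma> and r = r, OF _ _ L] trun_Seq[OF 1 trun_home[where B = B]]]) (use Pop L in auto)
next
  case (Seq a \<sigma> t \<sigma>' b t' \<sigma>'')
  have "height \<sigma>' + t' \<le> B" using sexec_height[OF Seq.hyps(1)] Seq.prems by simp
  moreover have "stacks_ok \<sigma>'" using sexec_ok[OF Seq.hyps(1)] Seq.prems by simp
  ultimately show ?case using Seq unfolding s2t.simps
    by (intro trun_Seq[OF Seq.IH(1) Seq.IH(2)]) (auto simp: algebra_simps)
next
  case (IfT r \<sigma> S a t \<sigma>' b)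
  then have L: "length (\<sigma> r) \<le> B" using length_le_height[of r \<sigma>] by simp
  show ?case unfolding s2t.simps
    by (rule trun_Seq[OF trun_peek[where \<sigma> = \<sigma> and r = r, OF _ _ L] trun_IfT[OF _ trun_Seq[OF trun_home[where B = B] IfT.IH order.refl] order.refl]])
      (use IfT L in \<open>auto simp: tape_of_top algebra_simps\<close>)
next
  case (IfF r \<sigma> S b t \<sigma>' a)
  then have L: "length (\<sigma> r) \<le> B" using length_le_height[of r \<sigma>] by simp
  show ?case unfolding s2t.simps
    by (rule trun_Seq[OF trun_peek[where \<sigma> = \<sigma> and r = r, OF _ _ L] trun_IfF[OF _ trun_Seq[OF trun_home[where B = B] IfF.IH order.refl] order.refl]])
      (use IfF L in \<open>auto simp: tape_of_top algebra_simps\<close>)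
next
  case (WhileF r \<sigma> S a)
  then have L: "length (\<sigma> r) \<le> B" using length_le_height[of r \<sigma>] by simp
  show ?case unfolding s2t.simps
    by (rule trun_Seq[OF trun_peek[where \<sigma> = \<sigma> and r = r, OF _ _ L] trun_Seq[OF trun_WhileF[OF _ order.refl] trun_home[where B = B] order.refl]])
      (use WhileF L in \<open>auto simp: tape_of_top algebra_simps\<close>)
next
  case (WhileT r \<sigma> S a t \<sigma>' t' \<sigma>'')
  then have L: "length (\<sigma> r) \<le> B" using length_le_height[of r \<sigma>] by simp
  have h: "height \<sigma>' + t' \<le> B" using sexec_height[OF WhileT.hyps(3)] WhileT.prems by simp
  moreover have ok: "stacks_ok \<sigma>'" using sexec_ok[OF WhileT.hyps(3)] WhileT.prems by simp
  ultimately have "trun (s2t (SWhile r S a)) (tape_of R \<sigma>') 0 (t' * (100 + 100 * B)) (tape_of R \<sigma>'') 0"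
    using WhileT by blast
  \<comment> \<open>The compiled loop consists of \<open>peek\<close>, the loop proper and
    \<open>home\<close>. The induction hypothesis for the remaining rounds thus begins with a
    \<open>peek\<close>; it is split off and becomes the \<open>peek\<close> that ends the body of
    the present round.\<close>
  then obtain t1 t2 t3 T1 p1 T2 p2 where
    1: "trun (peek r) (tape_of R \<sigma>') 0 t1 T1 p1" and
    2: "trun (TWhile S (TSeq (home r) (TSeq (s2t a) (peek r)))) T1 p1 t2 T2 p2" and
    3: "trun (home r) T2 p2 t3 (tape_of R \<sigma>'') 0" and
    le: "t1 + (t2 + t3) \<le> t' * (100 + 100 * B)"
    unfolding s2t.simps by (elim trun_SeqE) (meson add_left_mono order_trans)
  have a: "trun (s2t a) (tape_of R \<sigma>) 0 (t * (100 + 100 * B)) (tape_of R \<sigma>') 0"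
    using WhileT by simp
  have body: "trun (TSeq (home r) (TSeq (s2t a) (peek r))) (tape_of R \<sigma>) (cell r (length (\<sigma> r)))
     (12 + 7 * B + (t * (100 + 100 * B) + t1)) T1 p1"
    by (rule trun_Seq[OF trun_home[where B = B] trun_Seq[OF a 1 order.refl]]) (use WhileT L in auto)
  show ?case unfolding s2t.simps
    by (rule trun_Seq[OF trun_peek[where \<sigma> = \<sigma> and r = r, OF _ _ L] trun_Seq[OF trun_WhileT[OF _ body 2 order.refl] 3 order.refl]])
      (use WhileT L le in \<open>auto simp: tape_of_top algebra_simps\<close>)
qed

section \<open>Polynomial-time functions on encoded data\<close>

definition srun :: "sprog \<Rightarrow> stacks \<Rightarrow> nat \<Rightarrow> stacks \<Rightarrow> bool" where
  "srun a \<sigma> B \<sigma>' \<longleftrightarrow> (\<exists>t \<le> B. sexec a \<sigma> t \<sigma>')"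

lemma srun_mono: "srun a \<sigma> t \<sigma>' \<Longrightarrow> t \<le> B \<Longrightarrow> srun a \<sigma> B \<sigma>'"
  unfolding srun_def by (meson le_trans)

lemma srun_Skip: "1 \<le> B \<Longrightarrow> srun Skip \<sigma> B \<sigma>"
  unfolding srun_def using sexec.Skip by blast

lemma srun_Push: "r < 3 \<Longrightarrow> s \<noteq> Bk \<Longrightarrow> \<sigma>' = \<sigma>(r := s # \<sigma> r) \<Longrightarrow> 1 \<le> B \<Longrightarrow> srun (Push r s) \<sigma> B \<sigma>'"
  unfolding srun_def using sexec.Push by blast

lemma srun_Pop: "r < 3 \<Longrightarrow> \<sigma>' = \<sigma>(r := tl (\<sigma> r)) \<Longrightarrow> 1 \<le> B \<Longrightarrow> srun (Pop r) \<sigma> B \<sigma>'"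
  unfolding srun_def using sexec.Pop by blast

lemma srun_Seq: "srun a \<sigma> t \<sigma>' \<Longrightarrow> srun b \<sigma>' t' \<sigma>'' \<Longrightarrow> t + t' \<le> B \<Longrightarrow> srun (SSeq a b) \<sigma> B \<sigma>''"
  unfolding srun_def using sexec.Seq by (meson add_mono le_trans)

lemma srun_IfT: "r < 3 \<Longrightarrow> hd_sym (\<sigma> r) \<in> S \<Longrightarrow> srun a \<sigma> t \<sigma>' \<Longrightarrow> 1 + t \<le> B \<Longrightarrow> srun (SIf r S a b) \<sigma> B \<sigma>'"
  unfolding srun_def using sexec.IfT by (meson add_left_mono le_trans)

lemma srun_IfF: "r < 3 \<Longrightarrow> hd_sym (\<sigma> r) \<notin> S \<Longrightarrow> srun b \<sigma> t \<sigma>' \<Longrightarrow> 1 + t \<le> B \<Longrightarrow> srun (SIf r S a b) \<sigma> B \<sigma>'"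
  unfolding srun_def using sexec.IfF by (meson add_left_mono le_trans)

lemma srun_WhileF: "r < 3 \<Longrightarrow> hd_sym (\<sigma> r) \<notin> S \<Longrightarrow> 1 \<le> B \<Longrightarrow> srun (SWhile r S a) \<sigma> B \<sigma>"
  unfolding srun_def using sexec.WhileF by blast

lemma srun_WhileT:
  assumes "r < 3" "hd_sym (\<sigma> r) \<in> S" "srun a \<sigma> t \<sigma>'" "srun (SWhile r S a) \<sigma>' t' \<sigma>''" "1 + t + t' \<le> B"
  shows "srun (SWhile r S a) \<sigma> B \<sigma>''"
proof -
  from assms(3,4) obtain u u' where "u \<le> t" "u' \<le> t'" "sexec a \<sigma> u \<sigma>'"
    "sexec (SWhile r S a) \<sigma>' u' \<sigma>''" unfolding srun_def by blast
  moreover from this have "sexec (SWhile r S a) \<sigma> (1 + u + u') \<sigma>''"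
    using sexec.WhileT assms(1,2) by blast
  ultimately show ?thesis using assms(5) unfolding srun_def
    by (intro exI[of _ "1 + u + u'"]) auto
qed

definition st :: "sym list \<Rightarrow> sym list \<Rightarrow> sym list \<Rightarrow> stacks" where
  "st l a b = (\<lambda>_. [])(0 := l, 1 := a, 2 := b)"

lemma st_simps [simp]:
  "st l a b 0 = l" "st l a b (Suc 0) = a" "st l a b 2 = b"
  "(st l a b)(0 := x) = st x a b" "(st l a b)(Suc 0 := x) = st l x b" "(st l a b)(2 := x) = st l a x"
  by (auto simp: st_def)

abbreviation stk :: "sym list \<Rightarrow> stacks" where "stk l \<equiv> st l [] []"

abbreviation syms :: "bool list \<Rightarrow> sym list" where "syms u \<equiv> map sym_of_bool u"

definition W :: "bool list \<Rightarrow> sym list" where "W u = syms u @ [Hash]"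

lemma hd_sym_simps [simp]: "hd_sym [] = Bk" "hd_sym (x # xs) = x"
  by (auto simp: hd_sym_def)

lemma sob_simps [simp]: "sym_of_bool True = B1" "sym_of_bool False = B0"
  by (auto simp: sym_of_bool_def)

fun pushes :: "nat \<Rightarrow> bool list \<Rightarrow> sprog" where
  "pushes j [] = Skip"
| "pushes j (x # xs) = SSeq (pushes j xs) (Push j (sym_of_bool x))"

lemma srun_pushes: "j < 3 \<Longrightarrow> Suc (length xs) \<le> B \<Longrightarrow> srun (pushes j xs) \<sigma> B (\<sigma>(j := syms xs @ \<sigma> j))"
proof (induction xs arbitrary: B)
  case Nil then show ?case by (simp add: srun_Skip)
next
  case (Cons x xs)
  have "srun (pushes j xs) \<sigma> (Suc (length xs)) (\<sigma>(j := syms xs @ \<sigma> j))" using Cons.prems by (intro Cons.IH) auto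
  moreover have "srun (Push j (sym_of_bool x)) (\<sigma>(j := syms xs @ \<sigma> j)) 1 (\<sigma>(j := syms (x # xs) @ \<sigma> j))"
    by (rule srun_Push) (use Cons.prems in \<open>auto simp: sym_of_bool_def\<close>)
  ultimately have "srun (pushes j (x # xs)) \<sigma> (Suc (length xs) + 1) (\<sigma>(j := syms (x # xs) @ \<sigma> j))"
    unfolding pushes.simps using srun_Seq by blast
  then show ?case by (rule srun_mono) (use Cons.prems in simp)
qed

text \<open>Moving bits from stack to stack reverses their order, while \<open>pushes\<close> keeps
  each block \<open>f b\<close> readable from the top.\<close>

definition transfer :: "nat \<Rightarrow> nat \<Rightarrow> (bool \<Rightarrow> bool list) \<Rightarrow> sprog" where
  "transfer i j f = SWhile i {B0, B1}
     (SIf i {B1} (SSeq (Pop i) (pushes j (f True))) (SSeq (Pop i) (pushes j (f False))))"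

lemma srun_transfer:
  assumes "i < 3" "j < 3" "i \<noteq> j" "\<And>b. length (f b) \<le> k" "hd_sym rest \<notin> {B0, B1}"
    and "\<sigma> i = syms u @ rest" "\<sigma>' = \<sigma>(i := rest, j := syms (concat (map f (rev u))) @ \<sigma> j)"
    and "(k + 4) * length u + 1 \<le> B"
  shows "srun (transfer i j f) \<sigma> B \<sigma>'"
  using assms(6-8)
proof (induction u arbitrary: \<sigma> B)
  case Nil
  then have "\<sigma>' = \<sigma>" using assms(3) by auto
  moreover have "hd_sym (\<sigma> i) \<notin> {B0, B1}" using Nil assms(5) by simp
  ultimately show ?case unfolding transfer_def using assms(1) Nil(3) by (auto intro: srun_WhileF)
next
  case (Cons b u)
  define \<sigma>1 where "\<sigma>1 = \<sigma>(i := syms u @ rest, j := syms (f b) @ \<sigma> j)"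
  have step: "srun (SSeq (Pop i) (pushes j (f b))) \<sigma> (k + 2) \<sigma>1"
  proof (rule srun_Seq)
    show "srun (Pop i) \<sigma> 1 (\<sigma>(i := syms u @ rest))"
      by (rule srun_Pop) (use assms Cons.prems in auto)
    show "srun (pushes j (f b)) (\<sigma>(i := syms u @ rest)) (k + 1) \<sigma>1"
      using srun_pushes[of j "f b" "k + 1" "\<sigma>(i := syms u @ rest)"] assms(2,3) assms(4)[of b]
      by (simp add: \<sigma>1_def)
  qed simp
  have hd: "hd_sym (\<sigma> i) = sym_of_bool b" using Cons.prems by simp
  have body: "srun (SIf i {B1} (SSeq (Pop i) (pushes j (f True))) (SSeq (Pop i) (pushes j (f False)))) \<sigma> (k + 3) \<sigma>1"
    using step hd assms(1) by (cases b) (auto intro: srun_IfT srun_IfF)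
  have "srun (transfer i j f) \<sigma>1 ((k + 4) * length u + 1) \<sigma>'"
    by (rule Cons.IH) (use Cons.prems assms(3) in \<open>auto simp: \<sigma>1_def fun_upd_twist\<close>)
  then show ?case unfolding transfer_def
    by (intro srun_WhileT[OF assms(1) _ body]) (use hd Cons.prems in \<open>auto simp: sym_of_bool_def transfer_def algebra_simps\<close>)
qed

abbreviation mv :: "nat \<Rightarrow> nat \<Rightarrow> sprog" where "mv i j \<equiv> transfer i j (\<lambda>b. [b])"

lemma concat_singletons [simp]: "concat (map (\<lambda>b. [b]) xs) = xs"
  by (induction xs) auto

lemma srun_mv:
  assumes "i < 3" "j < 3" "i \<noteq> j" "hd_sym rest \<notin> {B0, B1}"
    and "\<sigma> i = syms u @ rest" "\<sigma>' = \<sigma>(i := rest, j := syms (rev u) @ \<sigma> j)"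
    and "5 * length u + 1 \<le> B"
  shows "srun (mv i j) \<sigma> B \<sigma>'"
  by (rule srun_transfer[where k = 1 and u = u and rest = rest]) (use assms in auto)

definition fork :: sprog where
  "fork = SWhile 1 {B0, B1}
     (SIf 1 {B1} (SSeq (Pop 1) (SSeq (Push 0 B1) (Push 2 B1))) (SSeq (Pop 1) (SSeq (Push 0 B0) (Push 2 B0))))"

lemma srun_fork:
  "srun fork (st l (syms u) b) (5 * length u + 1) (st (syms (rev u) @ l) [] (syms (rev u) @ b))"
proof (induction u arbitrary: l b)
  case Nil then show ?case unfolding fork_def by (auto intro: srun_WhileF)
next
  case (Cons x u)
  have step: "srun (SSeq (Pop 1) (SSeq (Push 0 (sym_of_bool x)) (Push 2 (sym_of_bool x))))
     (st l (syms (x # u)) b) 3 (st (sym_of_bool x # l) (syms u) (sym_of_bool x # b))"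
    by (rule srun_Seq[OF srun_Pop srun_Seq[OF srun_Push srun_Push], OF _ refl order.refl _ _ refl order.refl _ _ _ order.refl])
      (auto simp: sym_of_bool_def)
  have body: "srun (SIf 1 {B1} (SSeq (Pop 1) (SSeq (Push 0 B1) (Push 2 B1))) (SSeq (Pop 1) (SSeq (Push 0 B0) (Push 2 B0))))
     (st l (syms (x # u)) b) 4 (st (sym_of_bool x # l) (syms u) (sym_of_bool x # b))"
    using step by (cases x) (auto intro: srun_IfT srun_IfF)
  from srun_WhileT[OF _ _ body Cons.IH[unfolded fork_def] order.refl] show ?case unfolding fork_def
    by (cases x) (auto elim!: srun_mono)
qed

definition erase :: sprog where "erase = SWhile 0 {B0, B1} (Pop 0)"

lemma srun_erase:
  "2 * length u + 1 \<le> B \<Longrightarrow> srun erase (st (syms u @ Hash # rest) a b) B (st (Hash # rest) a b)"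
proof (induction u arbitrary: B)
  case Nil then show ?case unfolding erase_def by (auto intro: srun_WhileF)
next
  case (Cons x u)
  have "srun (Pop 0) (st (syms (x # u) @ Hash # rest) a b) 1 (st (syms u @ Hash # rest) a b)"
    by (rule srun_Pop) auto
  moreover have "srun erase (st (syms u @ Hash # rest) a b) (2 * length u + 1) (st (Hash # rest) a b)"
    using Cons by simp
  ultimately show ?case using Cons.prems unfolding erase_def
    by (elim srun_WhileT[rotated 2]) (auto simp: sym_of_bool_def)
qed

text \<open>The quantified \<open>rest\<close> is a frame: the program works on the top word of
  stack 0, delimited by \<open>Hash\<close>, and the other two stacks are empty before and after.
  Such a program can run while other values wait underneath.\<close>

definition wrun :: "sprog \<Rightarrow> bool list \<Rightarrow> nat \<Rightarrow> bool list \<Rightarrow> bool" where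
  "wrun a u B v \<longleftrightarrow> (\<forall>rest. srun a (stk (W u @ rest)) B (stk (W v @ rest)))"

definition const_prog :: "bool list \<Rightarrow> sprog" where "const_prog w = SSeq erase (pushes 0 w)"

lemma wrun_mono: "wrun a u t v \<Longrightarrow> t \<le> B \<Longrightarrow> wrun a u B v"
  unfolding wrun_def by (meson srun_mono)

lemma wrun_const: "2 * length u + length w + 2 \<le> B \<Longrightarrow> wrun (const_prog w) u B w"
  unfolding wrun_def const_prog_def W_def
proof
  fix rest assume B: "2 * length u + length w + 2 \<le> B"
  show "srun (SSeq erase (pushes 0 w)) (stk ((syms u @ [Hash]) @ rest)) B (stk ((syms w @ [Hash]) @ rest))"
    using srun_Seq[OF srun_erase[OF order.refl, of u rest "[]" "[]"] srun_pushes[OF _ order.refl, of 0 w "stk (Hash # rest)"] ] B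
    by simp
qed

definition dup_prog :: sprog where
  "dup_prog = SSeq (mv 0 1) (SSeq fork (SSeq (Push 0 Hash) (SSeq (mv 2 1) (mv 1 0))))"

lemma srun_dup: "srun dup_prog (stk (W u @ rest)) (20 * length u + 5) (stk (W u @ W u @ rest))"
proof -
  have 1: "srun (mv 0 1) (stk (W u @ rest)) (5 * length u + 1) (st (Hash # rest) (syms (rev u)) [])"
    by (rule srun_mv[where u = u and rest = "Hash # rest"]) (auto simp: W_def)
  have 2: "srun fork (st (Hash # rest) (syms (rev u)) []) (5 * length u + 1) (st (W u @ rest) [] (syms u))"
    using srun_fork[of "Hash # rest" "rev u" "[]"] by (simp add: W_def)
  have 3: "srun (Push 0 Hash) (st (W u @ rest) [] (syms u)) 1 (st (Hash # W u @ rest) [] (syms u))"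
    by (rule srun_Push) auto
  have 4: "srun (mv 2 1) (st (Hash # W u @ rest) [] (syms u)) (5 * length u + 1) (st (Hash # W u @ rest) (syms (rev u)) [])"
    by (rule srun_mv[where u = u and rest = "[]"]) auto
  have 5: "srun (mv 1 0) (st (Hash # W u @ rest) (syms (rev u)) []) (5 * length u + 1) (st (W u @ W u @ rest) [] [])"
    by (rule srun_mv[where u = "rev u" and rest = "[]"]) (auto simp: W_def)
  show ?thesis unfolding dup_prog_def
    by (rule srun_Seq[OF 1 srun_Seq[OF 2 srun_Seq[OF 3 srun_Seq[OF 4 5 order.refl] order.refl] order.refl]]) simp
qed

definition swap_prog :: sprog where
  "swap_prog = SSeq (mv 0 1) (SSeq (Pop 0) (SSeq (mv 0 2) (SSeq (mv 1 0) (SSeq (Push 0 Hash) (mv 2 0)))))"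

lemma srun_swap:
  "srun swap_prog (stk (W u @ W v @ rest)) (10 * length u + 10 * length v + 6) (stk (W v @ W u @ rest))"
proof -
  have 1: "srun (mv 0 1) (stk (W u @ W v @ rest)) (5 * length u + 1) (st (Hash # W v @ rest) (syms (rev u)) [])"
    by (rule srun_mv[where u = u and rest = "Hash # W v @ rest"]) (auto simp: W_def)
  have 2: "srun (Pop 0) (st (Hash # W v @ rest) (syms (rev u)) []) 1 (st (W v @ rest) (syms (rev u)) [])"
    by (rule srun_Pop) auto
  have 3: "srun (mv 0 2) (st (W v @ rest) (syms (rev u)) []) (5 * length v + 1) (st (Hash # rest) (syms (rev u)) (syms (rev v)))"
    by (rule srun_mv[where u = v and rest = "Hash # rest"]) (auto simp: W_def)
  have 4: "srun (mv 1 0) (st (Hash # rest) (syms (rev u)) (syms (rev v))) (5 * length u + 1) (st (W u @ rest) [] (syms (rev v)))"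
    by (rule srun_mv[where u = "rev u" and rest = "[]"]) (auto simp: W_def)
  have 5: "srun (Push 0 Hash) (st (W u @ rest) [] (syms (rev v))) 1 (st (Hash # W u @ rest) [] (syms (rev v)))"
    by (rule srun_Push) auto
  have 6: "srun (mv 2 0) (st (Hash # W u @ rest) [] (syms (rev v))) (5 * length v + 1) (st (W v @ W u @ rest) [] [])"
    by (rule srun_mv[where u = "rev v" and rest = "[]"]) (auto simp: W_def)
  show ?thesis unfolding swap_prog_def
    by (rule srun_Seq[OF 1 srun_Seq[OF 2 srun_Seq[OF 3 srun_Seq[OF 4 srun_Seq[OF 5 6 order.refl] order.refl] order.refl] order.refl]]) simp
qed

definition dbl :: "bool list \<Rightarrow> bool list" where "dbl u = concat (map (\<lambda>b. [True, b]) u)"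

text \<open>A prefix code for the first component only: its bits are marked by \<open>True\<close>
  and closed by \<open>False\<close>. The second component keeps its length, so right-nested tuples
  and list tails are not inflated.\<close>

definition wpair :: "bool list \<Rightarrow> bool list \<Rightarrow> bool list" where "wpair u v = dbl u @ False # v"

lemma length_dbl [simp]: "length (dbl u) = 2 * length u"
  by (induction u) (auto simp: dbl_def)

lemma length_wpair [simp]: "length (wpair u v) = 2 * length u + length v + 1"
  by (simp add: wpair_def)

definition pair_prog :: sprog where
  "pair_prog = SSeq (mv 0 1) (SSeq (Pop 0) (SSeq (Push 0 B0) (transfer 1 0 (\<lambda>b. [True, b]))))"

lemma srun_pair: "srun pair_prog (stk (W u @ W v @ rest)) (11 * length u + 4) (stk (W (wpair u v) @ rest))"
proof -
  have 1: "srun (mv 0 1) (stk (W u @ W v @ rest)) (5 * length u + 1) (st (Hash # W v @ rest) (syms (rev u)) [])"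
    by (rule srun_mv[where u = u and rest = "Hash # W v @ rest"]) (auto simp: W_def)
  have 2: "srun (Pop 0) (st (Hash # W v @ rest) (syms (rev u)) []) 1 (st (W v @ rest) (syms (rev u)) [])"
    by (rule srun_Pop) auto
  have 3: "srun (Push 0 B0) (st (W v @ rest) (syms (rev u)) []) 1 (st (B0 # W v @ rest) (syms (rev u)) [])"
    by (rule srun_Push) auto
  have 4: "srun (transfer 1 0 (\<lambda>b. [True, b])) (st (B0 # W v @ rest) (syms (rev u)) []) (6 * length u + 1)
     (st (W (wpair u v) @ rest) [] [])"
    by (rule srun_transfer[where k = 2 and u = "rev u" and rest = "[]"]) (auto simp: W_def wpair_def dbl_def)
  show ?thesis unfolding pair_prog_def
    by (rule srun_Seq[OF 1 srun_Seq[OF 2 srun_Seq[OF 3 4 order.refl] order.refl]]) simp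
qed

definition undbl :: sprog where
  "undbl = SWhile 0 {B1} (SSeq (Pop 0) (SIf 0 {B1} (SSeq (Pop 0) (Push 1 B1)) (SSeq (Pop 0) (Push 1 B0))))"

lemma srun_undbl: "srun undbl (st (syms (dbl u) @ B0 # rest) a b) (5 * length u + 1) (st (B0 # rest) (syms (rev u) @ a) b)"
proof (induction u arbitrary: a)
  case Nil then show ?case unfolding undbl_def by (auto intro: srun_WhileF simp: dbl_def)
next
  case (Cons x u)
  let ?l = "syms (dbl u) @ B0 # rest"
  have 1: "srun (Pop 0) (st (syms (dbl (x # u)) @ B0 # rest) a b) 1 (st (sym_of_bool x # ?l) a b)"
    by (rule srun_Pop) (auto simp: dbl_def)
  have "srun (SSeq (Pop 0) (Push 1 (sym_of_bool x))) (st (sym_of_bool x # ?l) a b) 2 (st ?l (sym_of_bool x # a) b)"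
    by (rule srun_Seq[OF srun_Pop srun_Push, OF _ refl order.refl _ _ _ order.refl]) (auto simp: sym_of_bool_def)
  then have "srun (SIf 0 {B1} (SSeq (Pop 0) (Push 1 B1)) (SSeq (Pop 0) (Push 1 B0))) (st (sym_of_bool x # ?l) a b) 3 (st ?l (sym_of_bool x # a) b)"
    by (cases x) (auto intro: srun_IfT srun_IfF)
  note body = srun_Seq[OF 1 this order.refl]
  from Cons.IH[of "sym_of_bool x # a"] show ?case unfolding undbl_def
    by (intro srun_WhileT[OF _ _ body]) (auto simp: undbl_def dbl_def)
qed

definition fst_prog :: sprog where "fst_prog = SSeq undbl (SSeq erase (mv 1 0))"

lemma wrun_fst: "wrun fst_prog (wpair u v) (10 * length u + 2 * length v + 5) u"
  unfolding wrun_def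
proof
  fix rest
  have 1: "srun undbl (stk (W (wpair u v) @ rest)) (5 * length u + 1) (st (syms (False # v) @ Hash # rest) (syms (rev u)) [])"
    using srun_undbl[of u "syms v @ Hash # rest" "[]" "[]"] by (simp add: W_def wpair_def)
  have 2: "srun erase (st (syms (False # v) @ Hash # rest) (syms (rev u)) []) (2 * length v + 3) (st (Hash # rest) (syms (rev u)) [])"
    by (rule srun_erase) simp
  have 3: "srun (mv 1 0) (st (Hash # rest) (syms (rev u)) []) (5 * length u + 1) (stk (W u @ rest))"
    by (rule srun_mv[where u = "rev u" and rest = "[]"]) (auto simp: W_def)
  show "srun fst_prog (stk (W (wpair u v) @ rest)) (10 * length u + 2 * length v + 5) (stk (W u @ rest))"
    unfolding fst_prog_def by (rule srun_Seq[OF 1 srun_Seq[OF 2 3 order.refl]]) simp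
qed

definition snd_prog :: sprog where "snd_prog = SSeq undbl (SSeq (Pop 0) (SWhile 1 {B0, B1} (Pop 1)))"

lemma srun_clear: "srun (SWhile 1 {B0, B1} (Pop 1)) (st l (syms u) b) (2 * length u + 1) (st l [] b)"
proof (induction u)
  case Nil then show ?case by (auto intro: srun_WhileF)
next
  case (Cons x u)
  have "srun (Pop 1) (st l (syms (x # u)) b) 1 (st l (syms u) b)" by (rule srun_Pop) auto
  from srun_WhileT[OF _ _ this Cons.IH order.refl] show ?case by (cases x) (auto elim!: srun_mono)
qed

lemma wrun_snd: "wrun snd_prog (wpair u v) (7 * length u + 3) v"
  unfolding wrun_def
proof
  fix rest
  have 1: "srun undbl (stk (W (wpair u v) @ rest)) (5 * length u + 1) (st (B0 # W v @ rest) (syms (rev u)) [])"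
    using srun_undbl[of u "syms v @ Hash # rest" "[]" "[]"] by (simp add: W_def wpair_def)
  have 2: "srun (Pop 0) (st (B0 # W v @ rest) (syms (rev u)) []) 1 (st (W v @ rest) (syms (rev u)) [])"
    by (rule srun_Pop) auto
  have 3: "srun (SWhile 1 {B0, B1} (Pop 1)) (st (W v @ rest) (syms (rev u)) []) (2 * length u + 1) (stk (W v @ rest))"
    using srun_clear[of "W v @ rest" "rev u" "[]"] by simp
  show "srun snd_prog (stk (W (wpair u v) @ rest)) (7 * length u + 3) (stk (W v @ rest))"
    unfolding snd_prog_def by (rule srun_Seq[OF 1 srun_Seq[OF 2 3 order.refl]]) simp
qed

text \<open>All coefficients are natural numbers, so no term can decrease.\<close>

lemma poly_mono_nat: "a \<le> b \<Longrightarrow> poly q a \<le> poly q (b :: nat)"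
  by (induction q) (auto intro!: add_mono mult_mono)

section \<open>Encoded data types and closure properties of polynomial time\<close>

class enc =
  fixes wenc :: "'a \<Rightarrow> bool list"

abbreviation esz :: "'a::enc \<Rightarrow> nat" where "esz x \<equiv> length (wenc x)"

instantiation unit :: enc begin
definition wenc_unit :: "unit \<Rightarrow> bool list" where "wenc_unit u = []"
instance ..
end

instantiation bool :: enc begin
definition wenc_bool :: "bool \<Rightarrow> bool list" where "wenc_bool b = (if b then [True] else [])"
instance ..
end

text \<open>Unary: the code is as long as the value, so a number can drive a loop of that many
  rounds within polynomial time.\<close>

instantiation nat :: enc begin
definition wenc_nat :: "nat \<Rightarrow> bool list" where "wenc_nat n = replicate n False"
instance ..
end

instantiation prod :: (enc, enc) enc begin
definition wenc_prod :: "'a \<times> 'b \<Rightarrow> bool list" where "wenc_prod p = wpair (wenc (fst p)) (wenc (snd p))"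
instance ..
end

text \<open>A nonempty list has the code of the pair of its head and tail, and only the empty list
  has the empty code. Thus \<open>hd\<close>, \<open>tl\<close> and \<open>Cons\<close> amount to
  projections and pairing.\<close>

instantiation list :: (enc) enc begin
primrec wenc_list :: "'a list \<Rightarrow> bool list" where
  "wenc_list [] = []" | "wenc_list (x # xs) = wpair (wenc x) (wenc_list xs)"
instance ..
end

instantiation option :: (enc) enc begin
definition wenc_option :: "'a option \<Rightarrow> bool list" where
  "wenc_option x = (case x of None \<Rightarrow> [] | Some y \<Rightarrow> wenc [y])"
instance ..
end

definition ptime :: "('a::enc \<Rightarrow> 'b::enc) \<Rightarrow> bool" where
  "ptime f \<longleftrightarrow> (\<exists>a (q :: nat poly). \<forall>x. wrun a (wenc x) (poly q (esz x)) (wenc (f x)))"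

definition pbounded :: "('a::enc \<Rightarrow> nat) \<Rightarrow> bool" where
  "pbounded h \<longleftrightarrow> (\<exists>q :: nat poly. \<forall>x. h x \<le> poly q (esz x))"

lemma pbdI: "(\<And>x. h x \<le> poly q (esz x)) \<Longrightarrow> pbounded h"
  unfolding pbounded_def by blast

lemma pbounded_const: "pbounded (\<lambda>_. c)"
  by (rule pbdI[of _ "[:c:]"]) simp

lemma pbounded_add: "pbounded h \<Longrightarrow> pbounded k \<Longrightarrow> pbounded (\<lambda>x. h x + k x)"
  unfolding pbounded_def by (elim exE, rename_tac p q, rule_tac x = "p + q" in exI) (auto intro: add_mono)

lemma pbounded_mult: "pbounded h \<Longrightarrow> pbounded k \<Longrightarrow> pbounded (\<lambda>x. h x * k x)"
  unfolding pbounded_def by (elim exE, rename_tac p q, rule_tac x = "p * q" in exI) (auto intro: mult_mono)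

lemma pbounded_self: "pbounded (\<lambda>x. esz x)"
  by (rule pbdI[of _ "[:0, 1:]"]) simp

lemma pbounded_le: "pbounded k \<Longrightarrow> (\<And>x. h x \<le> k x) \<Longrightarrow> pbounded h"
  unfolding pbounded_def by (meson le_trans)

lemma pbounded_poly: "pbounded h \<Longrightarrow> pbounded (\<lambda>x. poly q (h x))"
proof -
  assume "pbounded h"
  then obtain q' :: "nat poly" where "\<And>x. h x \<le> poly q' (esz x)" unfolding pbounded_def by blast
  then have "poly q (h x) \<le> poly (pcompose q q') (esz x)" for x
    by (simp add: poly_pcompose poly_mono_nat)
  then show ?thesis by (rule pbdI)
qed

lemma pbounded_Suc: "pbounded h \<Longrightarrow> pbounded (\<lambda>x. Suc (h x))"
  using pbounded_add[OF pbounded_const[of 1]] by simp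

lemmas pbounded_intros = pbounded_const pbounded_add pbounded_mult pbounded_self pbounded_poly pbounded_Suc

lemma ptime_altI: "(\<And>x. wrun a (wenc x) (h x) (wenc (f x))) \<Longrightarrow> pbounded h \<Longrightarrow> ptime f"
  unfolding ptime_def pbounded_def wrun_def by (meson srun_mono)

lemma height_stk: "height (stk l) = length l"
  by (auto simp: height_def eval_nat_numeral st_def)

lemma wrun_size: "wrun a u B v \<Longrightarrow> length v \<le> length u + B"
proof -
  assume "wrun a u B v"
  then obtain t where "t \<le> B" "sexec a (stk (W u)) t (stk (W v))"
    unfolding wrun_def srun_def by (metis append.right_neutral)
  from sexec_height[OF this(2)] this(1) show ?thesis by (simp add: height_stk W_def)
qed

text \<open>Running time bounds the size of the result. Composition depends on this, because the
  second program is charged in the size of the first result.\<close>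

lemma pbounded_esz: assumes "ptime f" shows "pbounded (\<lambda>x. esz (f x))"
proof -
  from assms obtain a and q :: "nat poly" where "\<And>x. wrun a (wenc x) (poly q (esz x)) (wenc (f x))"
    unfolding ptime_def by blast
  from wrun_size[OF this] show ?thesis
    by (rule pbounded_le[rotated]) (intro pbounded_intros)
qed

lemma wrun_Seq: "wrun a u t v \<Longrightarrow> wrun b v t' w \<Longrightarrow> t + t' \<le> B \<Longrightarrow> wrun (SSeq a b) u B w"
  unfolding wrun_def by (meson srun_Seq)

lemma pfE:
  assumes "ptime f"
  obtains a and q :: "nat poly" where "\<And>x. wrun a (wenc x) (poly q (esz x)) (wenc (f x))"
  using assms unfolding ptime_def by blast

lemma ptime_compose: assumes "ptime f" "ptime g" shows "ptime (\<lambda>x. g (f x))"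
proof -
  obtain a q where a: "\<And>x. wrun a (wenc x) (poly q (esz x)) (wenc (f x))" using assms(1) pfE by blast
  obtain b q' where b: "\<And>x. wrun b (wenc x) (poly q' (esz x)) (wenc (g x))" using assms(2) pfE by blast
  show ?thesis
    by (rule ptime_altI[OF wrun_Seq[OF a b order.refl]]) (intro pbounded_intros pbounded_esz assms)
qed

text \<open>Since \<open>ptime\<close> speaks of codes only, functions with equal codes are
  interchangeable even if their types differ.\<close>

lemma ptime_retype: "ptime f \<Longrightarrow> (\<And>x. wenc (g x) = wenc (f x)) \<Longrightarrow> ptime g"
  unfolding ptime_def by simp

lemma ptime_recode: "(\<And>x. wenc (f x) = wenc x) \<Longrightarrow> ptime f"
  by (rule ptime_altI[where a = Skip and h = "\<lambda>_. 1"]) (auto simp: wrun_def intro: srun_Skip pbounded_intros)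

lemma ptime_id: "ptime (\<lambda>x. x)" by (rule ptime_recode) simp

lemma ptime_const: "ptime (\<lambda>_. c)"
  by (rule ptime_altI[OF wrun_const[OF order.refl]]) (intro pbounded_intros)

lemma ptime_Pair:
  fixes f :: "'a::enc \<Rightarrow> 'b::enc" and g :: "'a \<Rightarrow> 'c::enc"
  assumes "ptime f" "ptime g" shows "ptime (\<lambda>x. (f x, g x))"
proof -
  obtain a q where a: "\<And>x. wrun a (wenc x) (poly q (esz x)) (wenc (f x))" using assms(1) pfE by blast
  obtain b q' where b: "\<And>x. wrun b (wenc x) (poly q' (esz x)) (wenc (g x))" using assms(2) pfE by blast
  show ?thesis
  proof (rule ptime_altI, unfold wrun_def, intro allI)
    fix x :: 'a and rest
    \<comment> \<open>The input is duplicated, \<open>g x\<close> is computed on the upper copy and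
      then swapped below the other one, because \<open>pair_prog\<close> expects the first component
      on top.\<close>
    have 1: "srun b (stk (W (wenc x) @ W (wenc x) @ rest)) (poly q' (esz x)) (stk (W (wenc (g x)) @ W (wenc x) @ rest))"
      using b unfolding wrun_def by blast
    have 2: "srun a (stk (W (wenc x) @ W (wenc (g x)) @ rest)) (poly q (esz x)) (stk (W (wenc (f x)) @ W (wenc (g x)) @ rest))"
      using a unfolding wrun_def by blast
    show "srun (SSeq dup_prog (SSeq b (SSeq swap_prog (SSeq a pair_prog)))) (stk (W (wenc x) @ rest))
      (20 * esz x + 5 + (poly q' (esz x) + (10 * esz (g x) + 10 * esz x + 6 + (poly q (esz x) + (11 * esz (f x) + 4)))))
      (stk (W (wenc (f x, g x)) @ rest))"
      unfolding wenc_prod_def fst_conv snd_conv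
      by (rule srun_Seq[OF srun_dup srun_Seq[OF 1 srun_Seq[OF srun_swap srun_Seq[OF 2 srun_pair]]]]) auto
  qed (intro pbounded_intros pbounded_esz assms)
qed

lemma ptime_fst0: "ptime (fst :: 'a::enc \<times> 'b::enc \<Rightarrow> 'a)"
proof (rule ptime_altI)
  fix x :: "'a \<times> 'b"
  show "wrun fst_prog (wenc x) (10 * esz x + 5) (wenc (fst x))"
    unfolding wenc_prod_def[of x] by (rule wrun_mono[OF wrun_fst]) simp
qed (intro pbounded_intros)

lemma ptime_snd0: "ptime (snd :: 'a::enc \<times> 'b::enc \<Rightarrow> 'b)"
proof (rule ptime_altI)
  fix x :: "'a \<times> 'b"
  show "wrun snd_prog (wenc x) (10 * esz x + 5) (wenc (snd x))"
    unfolding wenc_prod_def[of x] by (rule wrun_mono[OF wrun_snd]) simp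
qed (intro pbounded_intros)

lemmas ptime_fst = ptime_compose[OF _ ptime_fst0]
lemmas ptime_snd = ptime_compose[OF _ ptime_snd0]

lemma ptime_if:
  fixes c :: "'a::enc \<Rightarrow> bool" and f g :: "'a \<Rightarrow> 'b::enc"
  assumes "ptime c" "ptime f" "ptime g" shows "ptime (\<lambda>x. if c x then f x else g x)"
proof -
  obtain a q where a: "\<And>x. wrun a (wenc x) (poly q (esz x)) (wenc (f x))" using assms(2) pfE by blast
  obtain b q' where b: "\<And>x. wrun b (wenc x) (poly q' (esz x)) (wenc (g x))" using assms(3) pfE by blast
  obtain d q'' where d: "\<And>x. wrun d (wenc x) (poly q'' (esz x)) (wenc (c x))" using assms(1) pfE by blast
  show ?thesis
  proof (rule ptime_altI, unfold wrun_def, intro allI)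
    fix x :: 'a and rest
    let ?B = "3 + poly q (esz x) + poly q' (esz x)"
    have 1: "srun d (stk (W (wenc x) @ W (wenc x) @ rest)) (poly q'' (esz x)) (stk (W (wenc (c x)) @ W (wenc x) @ rest))"
      using d unfolding wrun_def by blast
    \<comment> \<open>The top symbol is \<open>B1\<close> for \<open>True\<close> and already the
      delimiter \<open>Hash\<close> for \<open>False\<close>; hence two pops in one branch and one
      in the other.\<close>
    have 2: "srun (SIf 0 {B1} (SSeq (Pop 0) (SSeq (Pop 0) a)) (SSeq (Pop 0) b))
      (stk (W (wenc (c x)) @ W (wenc x) @ rest)) ?B (stk (W (wenc (if c x then f x else g x)) @ rest))"
    proof (cases "c x")
      case True
      have "srun (SSeq (Pop 0) (SSeq (Pop 0) a)) (stk (B1 # Hash # W (wenc x) @ rest)) (2 + poly q (esz x)) (stk (W (wenc (f x)) @ rest))"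
        using a[of x, unfolded wrun_def, rule_format, of rest]
        by (intro srun_Seq[OF srun_Pop[OF _ refl order.refl] srun_Seq[OF srun_Pop[OF _ refl order.refl] _ order.refl]]) auto
      with True show ?thesis by (intro srun_IfT[where t = "2 + poly q (esz x)"]) (auto simp: W_def wenc_bool_def)
    next
      case False
      have "srun (SSeq (Pop 0) b) (stk (Hash # W (wenc x) @ rest)) (1 + poly q' (esz x)) (stk (W (wenc (g x)) @ rest))"
        using b[of x, unfolded wrun_def, rule_format, of rest]
        by (intro srun_Seq[OF srun_Pop[OF _ refl order.refl]]) auto
      with False show ?thesis by (intro srun_IfF[where t = "1 + poly q' (esz x)"]) (auto simp: W_def wenc_bool_def)
    qed
    show "srun (SSeq dup_prog (SSeq d (SIf 0 {B1} (SSeq (Pop 0) (SSeq (Pop 0) a)) (SSeq (Pop 0) b)))) (stk (W (wenc x) @ rest))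
      (20 * esz x + 5 + (poly q'' (esz x) + ?B)) (stk (W (wenc (if c x then f x else g x)) @ rest))"
      by (rule srun_Seq[OF srun_dup srun_Seq[OF 1 2]]) auto
  qed (intro pbounded_intros pbounded_esz assms)
qed

lemma ptime_null0: "ptime (\<lambda>l :: 'a::enc list. l = [])"
proof (rule ptime_altI[where a = "SIf 0 {Hash} (Push 0 B1) (const_prog [])"], unfold wrun_def, intro allI)
  fix l :: "'a list" and rest
  show "srun (SIf 0 {Hash} (Push 0 B1) (const_prog [])) (stk (W (wenc l) @ rest)) (2 * esz l + 3) (stk (W (wenc (l = [])) @ rest))"
  proof (cases l)
    case Nil then show ?thesis by (auto intro!: srun_IfT[where t = 1] srun_Push simp: W_def wenc_bool_def)
  next
    case (Cons x xs)
    have "hd_sym (W (wenc l) @ rest) \<noteq> Hash"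
      by (cases "wenc x") (auto simp: Cons W_def wpair_def dbl_def)
    with Cons show ?thesis
      using wrun_const[OF order.refl, where u = "wenc l" and w = "[]", unfolded wrun_def, rule_format, of rest]
      by (intro srun_IfF) (auto simp: wenc_bool_def)
  qed
qed (intro pbounded_intros)

text \<open>The value \<open>f []\<close> is fixed even where it is unspecified, as for
  \<open>hd []\<close>, so a constant program can write it. Partial functions therefore enter
  without side conditions.\<close>

lemma ptime_nullcase:
  fixes f :: "'a::enc list \<Rightarrow> 'b::enc"
  assumes "ptime g" "\<And>x xs. wenc (f (x # xs)) = wenc (g (x, xs))" shows "ptime f"
proof -
  obtain b q where b: "\<And>x. wrun b (wenc x) (poly q (esz x)) (wenc (g x))" using assms(1) pfE by blast
  show ?thesis
  proof (rule ptime_altI[where a = "SIf 0 {Hash} (const_prog (wenc (f []))) b"], unfold wrun_def, intro allI)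
    fix l :: "'a list" and rest
    show "srun (SIf 0 {Hash} (const_prog (wenc (f []))) b) (stk (W (wenc l) @ rest))
       (2 * esz l + esz (f []) + 3 + poly q (esz l)) (stk (W (wenc (f l)) @ rest))"
    proof (cases l)
      case Nil
      have "srun (const_prog (wenc (f []))) (stk (W (wenc l) @ rest)) (2 * esz l + esz (f []) + 2) (stk (W (wenc (f [])) @ rest))"
        using wrun_const[OF order.refl, where u = "wenc l" and w = "wenc (f [])"] unfolding wrun_def by blast
      with Nil show ?thesis by (intro srun_IfT) (auto simp: W_def)
    next
      case (Cons x xs)
      have "hd_sym (W (wenc l) @ rest) \<noteq> Hash"
        by (cases "wenc x") (auto simp: Cons W_def wpair_def dbl_def)
      moreover have "wenc l = wenc (x, xs)" by (simp add: Cons wenc_prod_def)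
      ultimately show ?thesis
        using b[of "(x, xs)", unfolded wrun_def, rule_format, of rest]
        by (intro srun_IfF) (auto simp: Cons assms(2))
    qed
  qed (intro pbounded_intros)
qed

lemma ptime_hd0: "ptime (hd :: 'a::enc list \<Rightarrow> 'a)"
  by (rule ptime_nullcase[OF ptime_fst0]) simp

lemma ptime_tl0: "ptime (tl :: 'a::enc list \<Rightarrow> 'a list)"
  by (rule ptime_nullcase[OF ptime_snd0]) simp

lemmas ptime_null = ptime_compose[OF _ ptime_null0]
lemmas ptime_hd = ptime_compose[OF _ ptime_hd0]
lemmas ptime_tl = ptime_compose[OF _ ptime_tl0]

lemma ptime_Cons: "ptime f \<Longrightarrow> ptime g \<Longrightarrow> ptime (\<lambda>x. f x # g x)"
  by (rule ptime_retype[OF ptime_Pair]) (auto simp: wenc_prod_def)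

text \<open>The loop maintains the triple of remaining list, accumulator and environment. A pair
  code starts with \<open>True\<close> exactly if its first component has a nonempty code, so the
  top symbol tells whether the list is exhausted. The bound \<open>H\<close> on all intermediate
  accumulators bounds the cost of every round.\<close>

lemma ptime_foldl:
  fixes step :: "'e::enc \<Rightarrow> 's::enc \<Rightarrow> 'x::enc \<Rightarrow> 's"
  assumes l: "ptime l" and init: "ptime init"
    and step: "ptime (\<lambda>t. step (fst t) (fst (snd t)) (snd (snd t)))"
    and H: "pbounded H" and bd: "\<And>e i. i \<le> length (l e) \<Longrightarrow> esz (foldl (step e) (init e) (take i (l e))) \<le> H e"
  shows "ptime (\<lambda>e. foldl (step e) (init e) (l e))"
proof -
  define body where "body t = (tl (fst t), step (snd (snd t)) (fst (snd t)) (hd (fst t)), snd (snd t))"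
    for t :: "'x list \<times> 's \<times> 'e"
  have "ptime body" unfolding body_def
    by (intro ptime_Pair ptime_tl ptime_fst ptime_snd ptime_id
        ptime_compose[OF _ step, where f = "\<lambda>t. (snd (snd t), fst (snd t), hd (fst t))", simplified] ptime_hd)
  then obtain b q where b: "\<And>t. wrun b (wenc t) (poly q (esz t)) (wenc (body t))" using pfE by blast
  have loop: "srun (SWhile 0 {B1} b) (stk (W (wenc (xs, s, e)) @ rest))
      (length xs * (1 + poly q (2 * L + 2 * K + esz e + 2)) + 1) (stk (W (wenc ([] :: 'x list, foldl (step e) s xs, e)) @ rest))"
    if "\<forall>i \<le> length xs. esz (foldl (step e) s (take i xs)) \<le> K" "esz xs \<le> L" for xs s e L K rest
    using that
  proof (induction xs arbitrary: s)
    case Nil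
    then show ?case by (auto intro!: srun_WhileF simp: W_def wenc_prod_def wpair_def dbl_def)
  next
    case (Cons x xs)
    let ?P = "poly q (2 * L + 2 * K + esz e + 2)"
    have "esz (x # xs, s, e) \<le> 2 * L + 2 * K + esz e + 2"
      using Cons.prems(1)[rule_format, of 0] Cons.prems(2) by (simp add: wenc_prod_def)
    then have 1: "srun b (stk (W (wenc (x # xs, s, e)) @ rest)) ?P (stk (W (wenc (xs, step e s x, e)) @ rest))"
      using b[of "(x # xs, s, e)", unfolded wrun_def, rule_format, of rest]
      by (auto simp: body_def intro: srun_mono poly_mono_nat)
    have 2: "srun (SWhile 0 {B1} b) (stk (W (wenc (xs, step e s x, e)) @ rest)) (length xs * (1 + ?P) + 1)
      (stk (W (wenc ([] :: 'x list, foldl (step e) (step e s x) xs, e)) @ rest))"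
    proof (rule Cons.IH)
      show "\<forall>i\<le>length xs. esz (foldl (step e) (step e s x) (take i xs)) \<le> K"
        using Cons.prems(1)[rule_format, of "Suc i" for i] by auto
    qed (use Cons.prems in auto)
    have "hd_sym (W (wenc (x # xs, s, e)) @ rest) = B1"
      by (cases "wenc x") (auto simp: W_def wenc_prod_def wpair_def dbl_def)
    then show ?case unfolding foldl.simps by (intro srun_WhileT[OF _ _ 1 2]) auto
  qed
  have len: "length xs \<le> esz xs" for xs :: "'x list" by (induction xs) auto
  define loopf where "loopf t = ([] :: 'x list, foldl (step (snd (snd t))) (fst (snd t)) (fst t), snd (snd t))"
    for t :: "'x list \<times> 's \<times> 'e"
  obtain a qa where a: "\<And>e. wrun a (wenc e) (poly qa (esz e)) (wenc (l e, init e, e))"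
    using pfE[OF ptime_Pair[OF l ptime_Pair[OF init ptime_id]]] by blast
  have "ptime (\<lambda>e. loopf (l e, init e, e))"
  proof (rule ptime_altI)
    fix e
    have "wrun (SWhile 0 {B1} b) (wenc (l e, init e, e))
      (esz (l e) * (1 + poly q (2 * esz (l e) + 2 * H e + esz e + 2)) + 1) (wenc (loopf (l e, init e, e)))"
      unfolding wrun_def
      using loop[of "l e" e "init e" "H e" "esz (l e)"] bd len[of "l e"]
      by (auto intro!: srun_mono[OF loop] add_mono mult_right_mono simp: loopf_def)
    from wrun_Seq[OF a this order.refl]
    show "wrun (SSeq a (SWhile 0 {B1} b)) (wenc e) (poly qa (esz e) +
      (esz (l e) * (1 + poly q (2 * esz (l e) + 2 * H e + esz e + 2)) + 1)) (wenc (loopf (l e, init e, e)))" .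
  qed (intro pbounded_intros pbounded_esz l H)
  from ptime_fst[OF ptime_snd[OF this]] show ?thesis by (simp add: loopf_def)
qed

text \<open>Growth by an amount independent of the accumulator sums up to at most the number of
  rounds times \<open>H e\<close>, whereas repeated doubling could become exponential.\<close>

lemma ptime_foldl_additive:
  fixes step :: "'e::enc \<Rightarrow> 's::enc \<Rightarrow> 'x::enc \<Rightarrow> 's"
  assumes l: "ptime l" and init: "ptime init"
    and step: "ptime (\<lambda>t. step (fst t) (fst (snd t)) (snd (snd t)))"
    and H: "pbounded H" and bd: "\<And>e s x. x \<in> set (l e) \<Longrightarrow> esz (step e s x) \<le> esz s + H e"
  shows "ptime (\<lambda>e. foldl (step e) (init e) (l e))"
proof (rule ptime_foldl[OF l init step])
  have *: "esz (foldl (step e) s xs) \<le> esz s + length xs * H e" if "set xs \<subseteq> set (l e)" for e s xs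
    using that
  proof (induction xs arbitrary: s)
    case (Cons x xs)
    then have "esz (foldl (step e) (step e s x) xs) \<le> esz (step e s x) + length xs * H e" by auto
    moreover have "esz (step e s x) \<le> esz s + H e" using bd Cons.prems by auto
    ultimately show ?case by simp
  qed simp
  have len: "length xs \<le> esz xs" for xs :: "'x list" by (induction xs) auto
  show "pbounded (\<lambda>e. esz (init e) + esz (l e) * H e)" by (intro pbounded_intros pbounded_esz init l H)
  fix e i assume "i \<le> length (l e)"
  have "esz (foldl (step e) (init e) (take i (l e))) \<le> esz (init e) + length (take i (l e)) * H e"
    by (rule *) (auto dest: in_set_takeD)
  also have "\<dots> \<le> esz (init e) + esz (l e) * H e"
    using len[of "l e"] by (auto intro!: mult_right_mono)
  finally show "esz (foldl (step e) (init e) (take i (l e))) \<le> esz (init e) + esz (l e) * H e" .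
qed

section \<open>A library of polynomial-time functions\<close>

lemma esz_simps [simp]:
  "esz (a, b) = 2 * esz a + esz b + 1"
  "esz (x # xs) = 2 * esz x + esz xs + 1"
  "esz ([] :: 'x::enc list) = 0"
  "esz (None :: 'x option) = 0"
  "esz (Some x) = 2 * esz x + 1"
  "esz (n :: nat) = n"
  "esz (u :: unit) = 0"
  by (auto simp: wenc_prod_def wenc_option_def wenc_nat_def wenc_unit_def)

lemma esz_bool: "esz (b :: bool) \<le> 1"
  by (simp add: wenc_bool_def)

lemma esz_append [simp]: "esz (xs @ ys) = esz xs + esz ys"
  by (induction xs) auto

lemma esz_rev [simp]: "esz (rev xs) = esz xs"
  by (induction xs) auto

lemma esz_member: "x \<in> set xs \<Longrightarrow> 2 * esz x + 1 \<le> esz xs"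
  by (induction xs) auto

lemma esz_drop: "esz (drop n xs) \<le> esz xs"
  by (metis append_take_drop_id esz_append le_add2)

lemma esz_take: "esz (take n xs) \<le> esz xs"
  by (metis append_take_drop_id esz_append le_add1)

lemma esz_tl: "esz (tl xs) \<le> esz xs"
  by (cases xs) auto

lemma esz_bools: "esz (xs :: bool list) \<le> 3 * length xs"
proof (induction xs)
  case (Cons x xs) then show ?case using esz_bool[of x] by simp
qed simp

lemma length_le_esz: "length xs \<le> esz xs"
  by (induction xs) auto

named_theorems ptime_intros

lemmas [ptime_intros] = ptime_id ptime_const ptime_Pair ptime_fst ptime_snd ptime_if ptime_Cons ptime_null ptime_hd ptime_tl

lemma ptime_not [ptime_intros]: "ptime f \<Longrightarrow> ptime (\<lambda>x. \<not> f x)"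
  using ptime_if[of f "\<lambda>_. False" "\<lambda>_. True"] by (simp add: ptime_const if_bool_eq_conj)

lemma ptime_conj [ptime_intros]: "ptime f \<Longrightarrow> ptime g \<Longrightarrow> ptime (\<lambda>x. f x \<and> g x)"
  using ptime_if[of f g "\<lambda>_. False"] by (simp add: ptime_const if_bool_eq_disj cong: conj_cong)

lemma ptime_disj [ptime_intros]: "ptime f \<Longrightarrow> ptime g \<Longrightarrow> ptime (\<lambda>x. f x \<or> g x)"
proof -
  have "(a \<or> b) = (if a then True else b)" for a b by simp
  then show "ptime f \<Longrightarrow> ptime g \<Longrightarrow> ?thesis" using ptime_if[of f "\<lambda>_. True" g] by (simp only: ptime_const)
qed

lemma ptime_case_prod [ptime_intros]: "ptime (\<lambda>x. f x (fst (g x)) (snd (g x))) \<Longrightarrow> ptime (\<lambda>x. case g x of (a, b) \<Rightarrow> f x a b)"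
  by (simp add: case_prod_beta)

lemma ptime_Let [ptime_intros]: "ptime (\<lambda>x. f x (g x)) \<Longrightarrow> ptime (\<lambda>x. Let (g x) (f x))"
  by (simp add: Let_def)

text \<open>Each unit contributes a single \<open>False\<close>, so a list of units is a unary
  number. Numbers thereby inherit \<open>Cons\<close>, \<open>tl\<close> and folds.\<close>

lemma wenc_units: "wenc (replicate n ()) = wenc n"
  by (induction n) (auto simp: wenc_nat_def wenc_unit_def wpair_def dbl_def)

lemma ptime_units: "ptime f \<Longrightarrow> ptime (\<lambda>x. replicate (f x) ())"
  by (rule ptime_retype) (auto simp: wenc_units)

lemma ptime_units_length: "ptime f \<Longrightarrow> ptime (\<lambda>x. length (f x :: unit list))"
  by (rule ptime_retype, assumption) (metis wenc_units replicate_length_same old.unit.exhaust)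

lemma ptime_Suc [ptime_intros]: "ptime f \<Longrightarrow> ptime (\<lambda>x. Suc (f x))"
  using ptime_units_length[OF ptime_Cons[OF ptime_const[of "()"] ptime_units]] by simp

lemma ptime_pred: "ptime f \<Longrightarrow> ptime (\<lambda>x. f x - Suc 0)"
  using ptime_units_length[OF ptime_tl[OF ptime_units]] by simp

lemma foldl_replicate: "foldl (\<lambda>s _. f s) s (replicate n x) = (f ^^ n) s"
  by (induction n arbitrary: s) (auto simp: funpow_swap1)

lemma ptime_funpow:
  fixes step :: "'e::enc \<Rightarrow> 's::enc \<Rightarrow> 's"
  assumes k: "ptime k" and init: "ptime init" and step: "ptime (\<lambda>t. step (fst t) (snd t))"
    and H: "pbounded H" and bd: "\<And>e s. esz (step e s) \<le> esz s + H e"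
  shows "ptime (\<lambda>e. (step e ^^ k e) (init e))"
proof -
  have "ptime (\<lambda>t :: 'e \<times> 's \<times> unit. step (fst t) (fst (snd t)))"
    using ptime_compose[OF _ step, of "\<lambda>t :: 'e \<times> 's \<times> unit. (fst t, fst (snd t))"]
    by (simp add: ptime_intros)
  then have "ptime (\<lambda>e. foldl (\<lambda>s _. step e s) (init e) (replicate (k e) ()))"
    by (intro ptime_foldl_additive[OF ptime_units[OF k] init _ H]) (auto simp: bd)
  then show ?thesis by (simp add: foldl_replicate)
qed

lemma ptime_funpow_nonincr:
  fixes step :: "'s::enc \<Rightarrow> 's"
  assumes "ptime k" "ptime init" "ptime step" "\<And>s. esz (step s) \<le> esz s"
  shows "ptime (\<lambda>e. (step ^^ k e) (init e))"
  using assms ptime_compose[OF ptime_snd[OF ptime_id] assms(3)]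
  by (intro ptime_funpow[where H = "\<lambda>_. 0"]) (auto intro: pbounded_intros)

lemma ptime_diff [ptime_intros]: assumes "ptime f" "ptime g" shows "ptime (\<lambda>x. f x - g x :: nat)"
proof -
  have "((\<lambda>k. k - Suc 0) ^^ m) n = n - m" for n m :: nat by (induction m) auto
  with ptime_funpow_nonincr[OF assms(2,1) ptime_pred[OF ptime_id]] show ?thesis by simp
qed

lemma ptime_add [ptime_intros]: assumes "ptime f" "ptime g" shows "ptime (\<lambda>x. f x + g x :: nat)"
proof -
  have "(Suc ^^ m) n = n + m" for n m :: nat by (induction m) (auto simp del: add_Suc)
  moreover have "ptime (\<lambda>x. (Suc ^^ g x) (f x))"
    by (rule ptime_funpow[where H = "\<lambda>_. 1"]) (intro pbounded_intros ptime_intros assms | simp)+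
  ultimately show ?thesis by (simp add: add.commute)
qed

lemma ptime_min [ptime_intros]: "ptime f \<Longrightarrow> ptime g \<Longrightarrow> ptime (\<lambda>x. min (f x) (g x) :: nat)"
proof -
  have "min a b = a - (a - b)" for a b :: nat by simp
  then show "ptime f \<Longrightarrow> ptime g \<Longrightarrow> ?thesis" by (simp add: ptime_diff)
qed

lemma ptime_rev [ptime_intros]: fixes f :: "'a::enc \<Rightarrow> 'b::enc list" assumes "ptime f" shows "ptime (\<lambda>x. rev (f x))"
proof -
  have "foldl (\<lambda>s x. x # s) ys xs = rev xs @ ys" for xs ys :: "'b list"
    by (induction xs arbitrary: ys) auto
  moreover have "ptime (\<lambda>x. foldl (\<lambda>s x. x # s) [] (f x))"
    by (rule ptime_foldl_additive[where H = "\<lambda>x. esz (f x)"])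
      (intro pbounded_esz ptime_intros assms | force dest: esz_member)+
  ultimately show ?thesis by simp
qed

lemma ptime_append [ptime_intros]:
  fixes f g :: "'a::enc \<Rightarrow> 'b::enc list" assumes "ptime f" "ptime g" shows "ptime (\<lambda>x. f x @ g x)"
proof -
  have "foldl (\<lambda>s x. x # s) ys xs = rev xs @ ys" for xs ys :: "'b list"
    by (induction xs arbitrary: ys) auto
  moreover have "ptime (\<lambda>x. foldl (\<lambda>s x. x # s) (g x) (rev (f x)))"
    by (rule ptime_foldl_additive[where H = "\<lambda>x. esz (f x)"])
      (intro pbounded_esz ptime_intros assms | force dest: esz_member)+
  ultimately show ?thesis by simp
qed

lemma ptime_length [ptime_intros]:
  fixes f :: "'a::enc \<Rightarrow> 'b::enc list" assumes "ptime f" shows "ptime (\<lambda>x. length (f x))"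
proof -
  have "foldl (\<lambda>n _. Suc n) n xs = length xs + n" for n and xs :: "'b list"
    by (induction xs arbitrary: n) auto
  moreover have "ptime (\<lambda>x. foldl (\<lambda>n _. Suc n) 0 (f x))"
    by (rule ptime_foldl_additive[where H = "\<lambda>_. 1"]) (intro pbounded_intros ptime_intros assms | simp)+
  ultimately show ?thesis by simp
qed

lemma ptime_drop [ptime_intros]:
  assumes "ptime k" "ptime f" shows "ptime (\<lambda>x. drop (k x) (f x))"
proof -
  have "(tl ^^ n) xs = drop n xs" for n and xs :: "'b list"
    by (induction n) (auto simp: drop_Suc tl_drop)
  with ptime_funpow_nonincr[OF assms ptime_tl0 esz_tl] show ?thesis by simp
qed

lemma ptime_take [ptime_intros]:
  assumes "ptime k" "ptime f" shows "ptime (\<lambda>x. take (k x) (f x))"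
proof -
  have "take n xs = rev (drop (length xs - n) (rev xs))" for n and xs :: "'b list"
    by (cases "n \<le> length xs") (simp_all add: rev_drop)
  then show ?thesis by (simp only:) (intro ptime_intros assms)
qed

lemma ptime_butlast [ptime_intros]: "ptime f \<Longrightarrow> ptime (\<lambda>x. butlast (f x))"
  unfolding butlast_conv_take by (intro ptime_take ptime_pred[simplified] ptime_intros)

lemma ptime_last [ptime_intros]: fixes f :: "'a::enc \<Rightarrow> 'b::enc list" assumes "ptime f" shows "ptime (\<lambda>x. last (f x))"
proof -
  have "last xs = (if xs = [] then last [] else hd (rev xs))" for xs :: "'b list"
    by (simp add: hd_rev)
  from this[of "f x" for x] show ?thesis by (simp only:) (intro ptime_intros assms)
qed

lemma ptime_map:
  fixes g :: "'a::enc \<Rightarrow> 'b::enc \<Rightarrow> 'c::enc"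
  assumes l: "ptime l" and g: "ptime (\<lambda>t. g (fst t) (snd t))" shows "ptime (\<lambda>e. map (g e) (l e))"
proof -
  have eq: "foldl (\<lambda>s x. s @ [g e x]) ys xs = ys @ map (g e) xs" for e xs ys
    by (induction xs arbitrary: ys) auto
  obtain q where q: "\<And>e x. esz (g e x) \<le> poly q (esz (e, x))"
    using pbounded_esz[OF g] unfolding pbounded_def by fastforce
  have "ptime (\<lambda>e. foldl (\<lambda>s x. s @ [g e x]) [] (l e))"
  proof (rule ptime_foldl_additive[where H = "\<lambda>e. 2 * poly q (2 * esz e + esz (l e) + 1) + 1"])
    show "ptime (\<lambda>t. fst (snd t) @ [g (fst t) (snd (snd t))])"
    proof -
      have "ptime (\<lambda>t :: 'a \<times> 'c list \<times> 'b. (fst t, snd (snd t)))" by (intro ptime_intros)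
      from ptime_compose[OF this g] show ?thesis by (intro ptime_intros) simp
    qed
    fix e s x assume "x \<in> set (l e)"
    then have "esz x \<le> esz (l e)" using esz_member by fastforce
    then have "poly q (esz (e, x)) \<le> poly q (2 * esz e + esz (l e) + 1)" by (intro poly_mono_nat) simp
    with q[of e x] show "esz (s @ [g e x]) \<le> esz s + (2 * poly q (2 * esz e + esz (l e) + 1) + 1)" by simp
  qed (auto intro!: pbounded_intros pbounded_esz ptime_intros l)
  then show ?thesis by (simp add: eq)
qed

lemma ptime_takeWhile:
  fixes f :: "'a::enc \<Rightarrow> 'b::enc list"
  assumes "ptime f" "ptime P" shows "ptime (\<lambda>x. takeWhile P (f x))"
proof -
  define stp where "stp s x = (if fst s \<or> \<not> P x then (True, snd s) else (False, x # snd s))" for s :: "bool \<times> 'b list" and x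
  have 1: "snd (foldl stp (True, ys) xs) = ys" for xs ys
    by (induction xs) (auto simp: stp_def)
  have 2: "snd (foldl stp (False, ys) xs) = rev (takeWhile P xs) @ ys" for xs ys
    by (induction xs arbitrary: ys) (auto simp: stp_def 1)
  have "ptime (\<lambda>x. foldl stp (False, []) (f x))"
  proof (rule ptime_foldl_additive[where H = "\<lambda>x. esz (f x) + 2"])
    show "ptime (\<lambda>t :: 'a \<times> (bool \<times> 'b list) \<times> 'b. stp (fst (snd t)) (snd (snd t)))"
      unfolding stp_def by (intro ptime_intros ptime_compose[OF _ assms(2)])
  qed (auto intro!: pbounded_intros pbounded_esz ptime_intros assms(1) simp: stp_def wenc_bool_def dest!: esz_member)
  from ptime_rev[OF ptime_snd[OF this]] show ?thesis by (simp add: 2)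
qed

lemma ptime_Some [ptime_intros]: "ptime f \<Longrightarrow> ptime (\<lambda>x. Some (f x))"
  by (rule ptime_retype[OF ptime_Cons[OF _ ptime_const[of "[]"]]]) (auto simp: wenc_option_def)

lemma ptime_option_list: "ptime f \<Longrightarrow> ptime (\<lambda>x. case f x of None \<Rightarrow> [] | Some y \<Rightarrow> [y])"
  by (rule ptime_retype[of f]) (auto simp: wenc_option_def split: option.splits)

lemma ptime_is_None [ptime_intros]: assumes "ptime f" shows "ptime (\<lambda>x. f x = None)"
proof -
  have "(case y of None \<Rightarrow> [] | Some z \<Rightarrow> [z]) = [] \<longleftrightarrow> y = None" for y :: "'a option"
    by (cases y) auto
  then show ?thesis using ptime_null[OF ptime_option_list[OF assms]] by (simp split: option.splits) 
qed

lemma ptime_the [ptime_intros]: fixes f :: "'a::enc \<Rightarrow> 'b::enc option" assumes "ptime f" shows "ptime (\<lambda>x. the (f x))"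
proof -
  have "the y = (if y = None then the None else hd (case y of None \<Rightarrow> [] | Some z \<Rightarrow> [z]))" for y :: "'b option"
    by (cases y) auto
  from this[of "f x" for x] show ?thesis by (simp only:) (intro ptime_intros ptime_option_list assms)
qed

lemma ptime_bool_eq: assumes "ptime f" "ptime g" shows "ptime (\<lambda>x. f x = (g x :: bool))"
proof -
  have "(a = b) = (if a then b else \<not> b)" for a b :: bool by simp
  then show ?thesis by (simp only:) (intro ptime_intros assms)
qed

text \<open>A fold over one list consumes the other, records any mismatch in a flag, and finally
  requires that nothing is left over.\<close>

lemma ptime_eq [ptime_intros]:
  fixes f g :: "'a::enc \<Rightarrow> bool list" assumes "ptime f" "ptime g" shows "ptime (\<lambda>x. f x = g x)"
proof -
  define stp where "stp s x = (tl (fst s), snd s \<and> fst s \<noteq> [] \<and> hd (fst s) = x)"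
    for s :: "bool list \<times> bool" and x
  define fin where "fin s \<longleftrightarrow> snd s \<and> fst s = []" for s :: "bool list \<times> bool"
  have 1: "\<not> fin (foldl stp (ys, False) xs)" for xs ys
    by (induction xs arbitrary: ys) (auto simp: stp_def fin_def)
  have 2: "fin (foldl stp (ys, True) xs) \<longleftrightarrow> ys = xs" for xs ys
  proof (induction xs arbitrary: ys)
    case (Cons x xs)
    note IH = Cons.IH
    show ?case
    proof (cases ys)
      case Nil
      have "stp ([], True) x = ([], False)" by (simp add: stp_def)
      then show ?thesis using 1[of "[]" xs] Nil by simp
    next
      case (Cons y zs)
      have "stp (y # zs, True) x = (zs, y = x)" by (simp add: stp_def)
      then show ?thesis using IH[of zs] 1[of zs xs] Cons by (cases "y = x") simp_all
    qed
  qed (auto simp: fin_def)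
  have "ptime (\<lambda>x. foldl stp (f x, True) (g x))"
  proof (rule ptime_foldl_additive[where H = "\<lambda>x. 2"])
    show "ptime (\<lambda>t :: 'a \<times> (bool list \<times> bool) \<times> bool. stp (fst (snd t)) (snd (snd t)))"
      unfolding stp_def by (intro ptime_intros ptime_bool_eq)
    show "esz (stp s x) \<le> esz s + 2" for s x
      using esz_tl[of "fst s"] by (cases s) (auto simp: stp_def wenc_bool_def)
  qed (auto intro!: pbounded_intros pbounded_esz ptime_intros assms)
  then have "ptime (\<lambda>x. fin (foldl stp (f x, True) (g x)))"
    unfolding fin_def by (intro ptime_intros)
  then show ?thesis by (simp add: 2)
qed

section \<open>From stack programs to Turing machines\<close>

lemma trun_s2t:
  assumes "srun a \<sigma> t \<sigma>'" "stacks_ok \<sigma>" "height \<sigma> + t \<le> B" "t * (100 + 100 * B) \<le> K"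
  shows "trun (s2t a) (tape_of R \<sigma>) 0 K (tape_of R \<sigma>') 0"
proof -
  from assms(1) obtain u where u: "u \<le> t" "sexec a \<sigma> u \<sigma>'" unfolding srun_def by blast
  have "trun (s2t a) (tape_of R \<sigma>) 0 (u * (100 + 100 * B)) (tape_of R \<sigma>') 0"
    using u assms by (intro s2t_correct) auto
  then show ?thesis
    by (rule trun_mono) (use u assms(4) in \<open>meson le_trans mult_le_mono1\<close>)
qed

lemma stacks_ok_W: "stacks_ok (stk (W u))"
  by (auto simp: stacks_ok_def st_def W_def sym_of_bool_def)

lemma stacks_ok_Nil: "stacks_ok (stk [])"
  by (auto simp: stacks_ok_def st_def)

lemma height_W: "height (stk (W u)) = Suc (length u)"
  by (simp add: height_stk W_def)

lemma tape_of_right: "p > 0 \<Longrightarrow> tape_of R \<sigma> p = R p"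
  by (simp add: tape_of_def)

lemma tape_of_upd_right: "p > 0 \<Longrightarrow> (tape_of R \<sigma>)(p := s) = tape_of (R(p := s)) \<sigma>"
  by (auto simp: tape_of_def)

definition put :: "sym \<Rightarrow> tprog" where "put s = Act (\<lambda>_. (s, Stay))"

lemma trun_put: "1 \<le> B \<Longrightarrow> trun (put s) T p B (T(p := s)) p"
  using trun_Act[of "\<lambda>_. (s, Stay)" T p s Stay B] by (simp add: put_def)

lemma trun_put_right: "p > 0 \<Longrightarrow> 1 \<le> B \<Longrightarrow> trun (put s) (tape_of R \<sigma>) p B (tape_of (R(p := s)) \<sigma>) p"
  using trun_put[of B s "tape_of R \<sigma>" p] by (simp add: tape_of_upd_right)

fun opt_of_sym :: "sym \<Rightarrow> bool option" where
  "opt_of_sym B0 = Some False" | "opt_of_sym B1 = Some True" | "opt_of_sym _ = None"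

abbreviation NB :: "sym set" where "NB \<equiv> {B0, B1, Hash}"

lemma NB_iff: "s \<in> NB \<longleftrightarrow> s \<noteq> Bk" by (cases s) auto

text \<open>The pushed word \<open>dbl (wenc c) @ [False]\<close> is exactly what
  \<open>Cons\<close> puts in front of a list code.\<close>

definition take_in :: "bool option \<Rightarrow> tprog" where
  "take_in c = TSeq (put Bk) (TSeq (walk Lft 1) (TSeq (TWhile NB (walk Lft 1)) (TSeq (walk Lft 1)
     (TSeq (s2t (pushes 0 (dbl (wenc c) @ [False]))) (walk Rgt 2)))))"

lemma esz_bool_option: "esz (c :: bool option) \<le> 3"
proof (cases c)
  case (Some a) then show ?thesis using esz_bool[of a] by simp
qed simp

lemma trun_take_in:
  assumes R: "R 1 = Bk" "\<And>i. i < n \<Longrightarrow> R (2 + int i) \<noteq> Bk" and n: "n \<le> N" and B: "length u + 12 \<le> B"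
  shows "trun (take_in c) (tape_of R (stk (W u))) (2 + int n) (10 * N + 8 * (100 + 100 * B) + 50)
    (tape_of (R(2 + int n := Bk)) (stk (W (wpair (wenc c) u)))) 2"
proof -
  let ?R = "R(2 + int n := Bk)"
  have 1: "trun (put Bk) (tape_of R (stk (W u))) (2 + int n) 1 (tape_of ?R (stk (W u))) (2 + int n)"
    by (rule trun_put_right) auto
  have 2: "trun (walk Lft 1) (tape_of ?R (stk (W u))) (2 + int n) 2 (tape_of ?R (stk (W u))) (1 + int n)"
    by (rule trun_walkL) auto
  have 3: "trun (TWhile NB (walk Lft 1)) (tape_of ?R (stk (W u))) (1 + int n) (4 * n + 1) (tape_of ?R (stk (W u))) 1"
  proof (rule trun_scanL[where m = n])
    fix i assume i: "i < n"
    then have eq: "1 + int n - int 1 * int i = 2 + int (n - Suc i)" by auto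
    have "tape_of ?R (stk (W u)) (1 + int n - int 1 * int i) = R (2 + int (n - Suc i))"
      unfolding eq using i by (simp add: tape_of_right)
    moreover have "R (2 + int (n - Suc i)) \<noteq> Bk" by (rule R(2)) (use i in auto)
    ultimately show "tape_of ?R (stk (W u)) (1 + int n - int 1 * int i) \<in> NB"
      unfolding NB_iff by simp
  qed (use R(1) in \<open>auto simp: tape_of_right\<close>)
  have 4: "trun (walk Lft 1) (tape_of ?R (stk (W u))) 1 2 (tape_of ?R (stk (W u))) 0"
    by (rule trun_walkL) auto
  have "srun (pushes 0 (dbl (wenc c) @ [False])) (stk (W u)) 8 (stk (W (wpair (wenc c) u)))"
    using srun_pushes[of 0 "dbl (wenc c) @ [False]" 8 "stk (W u)"] esz_bool_option[of c]
    by (simp add: W_def wpair_def)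
  then have 5: "trun (s2t (pushes 0 (dbl (wenc c) @ [False]))) (tape_of ?R (stk (W u))) 0
      (8 * (100 + 100 * B)) (tape_of ?R (stk (W (wpair (wenc c) u)))) 0"
    by (rule trun_s2t[where B = B]) (use B in \<open>auto simp: stacks_ok_W height_W\<close>)
  have 6: "trun (walk Rgt 2) (tape_of ?R (stk (W (wpair (wenc c) u)))) 0 3 (tape_of ?R (stk (W (wpair (wenc c) u)))) 2"
    by (rule trun_walkR) auto
  show ?thesis unfolding take_in_def
    by (rule trun_Seq[OF 1 trun_Seq[OF 2 trun_Seq[OF 3 trun_Seq[OF 4 trun_Seq[OF 5 6 order.refl] order.refl] order.refl] order.refl]])
      (use n in simp)
qed

text \<open>The input is consumed from its last symbol, because consing builds a list from its
  end.\<close>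

definition read_last :: tprog where
  "read_last = TSeq (TWhile NB (walk Rgt 1)) (TSeq (walk Lft 1)
     (TIf {B0} (take_in (Some False)) (TIf {B1} (take_in (Some True)) (take_in None))))"

lemma trun_read_last:
  assumes R: "R 1 = Bk" "\<And>i. i \<le> n \<Longrightarrow> R (2 + int i) \<noteq> Bk" "R (3 + int n) = Bk" and n: "n < N"
    and B: "length u + 12 \<le> B"
  shows "trun read_last (tape_of R (stk (W u))) 2 (20 * N + 8 * (100 + 100 * B) + 70)
    (tape_of (R(2 + int n := Bk)) (stk (W (wpair (wenc (opt_of_sym (R (2 + int n)))) u)))) 2"
proof -
  let ?T = "tape_of R (stk (W u))"
  let ?T' = "tape_of (R(2 + int n := Bk)) (stk (W (wpair (wenc (opt_of_sym (R (2 + int n)))) u)))"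
  have 1: "trun (TWhile NB (walk Rgt 1)) ?T 2 (4 * Suc n + 1) ?T (3 + int n)"
  proof (rule trun_scanR[where m = "Suc n"])
    fix i assume "i < Suc n"
    then show "?T (2 + int 1 * int i) \<in> NB"
      unfolding NB_iff using R(2)[of i] by (simp add: tape_of_right)
  qed (use R(3) in \<open>auto simp: tape_of_right algebra_simps\<close>)
  have 2: "trun (walk Lft 1) ?T (3 + int n) 2 ?T (2 + int n)" by (rule trun_walkL) auto
  let ?K = "10 * N + 8 * (100 + 100 * B) + 50"
  have t: "trun (take_in (opt_of_sym (R (2 + int n)))) ?T (2 + int n) ?K ?T' 2"
    by (rule trun_take_in) (use R n B in auto)
  have h: "?T (2 + int n) = R (2 + int n)" by (simp add: tape_of_right)
  have 3: "trun (TIf {B0} (take_in (Some False)) (TIf {B1} (take_in (Some True)) (take_in None)))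
     ?T (2 + int n) (?K + 4) ?T' 2"
  proof (cases "R (2 + int n)")
    case Bk then show ?thesis using R(2)[of n] by simp
  next
    case B0 then show ?thesis using t h by (intro trun_IfT[where t = ?K]) auto
  next
    case B1
    with t h have "trun (TIf {B1} (take_in (Some True)) (take_in None)) ?T (2 + int n) (?K + 2) ?T' 2"
      by (intro trun_IfT[where t = ?K]) auto
    with B1 h show ?thesis by (auto intro!: trun_IfF[where t = "?K + 2" and S = "{B0}"])
  next
    case Hash
    with t h have "trun (TIf {B1} (take_in (Some True)) (take_in None)) ?T (2 + int n) (?K + 2) ?T' 2"
      by (intro trun_IfF[where t = ?K]) auto
    with Hash h show ?thesis by (auto intro!: trun_IfF[where t = "?K + 2" and S = "{B0}"])
  qed
  show ?thesis unfolding read_last_def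
    by (rule trun_Seq[OF 1 trun_Seq[OF 2 3 order.refl]]) (use n in simp)
qed

text \<open>The factor 7 is the largest size of a list cell: an optional bit has size at most 3,
  which is doubled and closed by one more bit. Induction from the end follows the order of
  consumption; the blank in cell 1 stops each scan to the left.\<close>

lemma trun_read:
  assumes "R 1 = Bk" "\<And>i. i < length v \<Longrightarrow> R (2 + int i) = v ! i" "R (2 + int (length v)) = Bk"
    "Bk \<notin> set v" "length v \<le> N" "7 * length v + esz xs + 12 \<le> B"
  shows "\<exists>R'. R' 1 = Bk \<and> trun (TWhile NB read_last) (tape_of R (stk (W (wenc xs)))) 2
    (length v * (20 * N + 8 * (100 + 100 * B) + 72) + 1)
    (tape_of R' (stk (W (wenc (map opt_of_sym v @ xs))))) 2"
  using assms
proof (induction v arbitrary: R xs rule: rev_induct)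
  case Nil
  then show ?case by (intro exI[of _ R]) (auto intro!: trun_WhileF simp: tape_of_right)
next
  case (snoc s v)
  let ?R = "R(2 + int (length v) := Bk)"
  have s: "R (2 + int (length v)) = s" using snoc.prems(2)[of "length v"] by simp
  have v: "R (2 + int i) = v ! i" if "i < length v" for i
    using snoc.prems(2)[of i] that by (simp add: nth_append)
  have "trun read_last (tape_of R (stk (W (wenc xs)))) 2 (20 * N + 8 * (100 + 100 * B) + 70)
    (tape_of ?R (stk (W (wpair (wenc (opt_of_sym (R (2 + int (length v))))) (wenc xs))))) 2"
  proof (rule trun_read_last)
    fix i assume "i \<le> length v"
    then show "R (2 + int i) \<noteq> Bk"
      using snoc.prems(4) s v[of i] by (cases "i = length v") (auto, metis nth_mem le_neq_implies_less)
  qed (use snoc.prems in \<open>auto simp: algebra_simps\<close>)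
  then have 1: "trun read_last (tape_of R (stk (W (wenc xs)))) 2 (20 * N + 8 * (100 + 100 * B) + 70)
    (tape_of ?R (stk (W (wenc (opt_of_sym s # xs))))) 2" by (simp add: s)
  have "\<exists>R'. R' 1 = Bk \<and> trun (TWhile NB read_last) (tape_of ?R (stk (W (wenc (opt_of_sym s # xs))))) 2
    (length v * (20 * N + 8 * (100 + 100 * B) + 72) + 1)
    (tape_of R' (stk (W (wenc (map opt_of_sym v @ opt_of_sym s # xs))))) 2"
    by (rule snoc.IH) (use snoc.prems v esz_bool_option[of "opt_of_sym s"] in auto)
  then obtain R' where R': "R' 1 = Bk" and 2: "trun (TWhile NB read_last) (tape_of ?R (stk (W (wenc (opt_of_sym s # xs))))) 2
    (length v * (20 * N + 8 * (100 + 100 * B) + 72) + 1)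
    (tape_of R' (stk (W (wenc (map opt_of_sym v @ opt_of_sym s # xs))))) 2" by blast
  have "R 2 \<noteq> Bk"
    using s v[of 0] snoc.prems(4) by (cases "length v = 0") (auto, metis length_greater_0_conv nth_mem)
  then have "tape_of R (stk (W (wenc xs))) 2 \<in> NB" unfolding NB_iff by (simp add: tape_of_right)
  from trun_WhileT[OF this 1 2 order.refl] show ?case
    by (intro exI[of _ R'] conjI R') (auto elim!: trun_mono)
qed

text \<open>The new bit overwrites the old end marker and a fresh \<open>Hash\<close> follows it.
  The blank in cell 1 stops the way back.\<close>

definition emit :: "bool \<Rightarrow> tprog" where
  "emit b = TSeq (walk Rgt 2) (TSeq (TWhile {B0, B1} (walk Rgt 1)) (TSeq (put (sym_of_bool b))
     (TSeq (walk Rgt 1) (TSeq (put Hash) (TSeq (walk Lft 1) (TSeq (TWhile {B0, B1} (walk Lft 1)) (walk Lft 1)))))))"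

definition out_region :: "tape \<Rightarrow> bool list \<Rightarrow> bool" where
  "out_region R y \<longleftrightarrow> R 1 = Bk \<and> (\<forall>i < length y. R (2 + int i) = sym_of_bool (y ! i)) \<and> R (2 + int (length y)) = Hash"

lemma sob_in: "sym_of_bool b \<in> {B0, B1}" by (simp add: sym_of_bool_def)

lemma trun_emit:
  assumes R: "out_region R y" and N: "length y \<le> N"
  shows "\<exists>R'. out_region R' (y @ [b]) \<and> trun (emit b) (tape_of R \<sigma>) 0 (10 * N + 30) (tape_of R' \<sigma>) 0"
proof -
  let ?n = "length y"
  let ?R1 = "R(2 + int ?n := sym_of_bool b)"
  let ?R2 = "?R1(3 + int ?n := Hash)"
  have r: "out_region ?R2 (y @ [b])"
    using R by (auto simp: out_region_def nth_append algebra_simps)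
  have 1: "trun (walk Rgt 2) (tape_of R \<sigma>) 0 3 (tape_of R \<sigma>) 2" by (rule trun_walkR) auto
  have 2: "trun (TWhile {B0, B1} (walk Rgt 1)) (tape_of R \<sigma>) 2 (4 * ?n + 1) (tape_of R \<sigma>) (2 + int ?n)"
    by (rule trun_scanR[where m = ?n]) (use R sob_in in \<open>auto simp: tape_of_right out_region_def\<close>)
  have 3: "trun (put (sym_of_bool b)) (tape_of R \<sigma>) (2 + int ?n) 1 (tape_of ?R1 \<sigma>) (2 + int ?n)"
    by (rule trun_put_right) auto
  have 4: "trun (walk Rgt 1) (tape_of ?R1 \<sigma>) (2 + int ?n) 2 (tape_of ?R1 \<sigma>) (3 + int ?n)"
    by (rule trun_walkR) auto
  have 5: "trun (put Hash) (tape_of ?R1 \<sigma>) (3 + int ?n) 1 (tape_of ?R2 \<sigma>) (3 + int ?n)"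
    by (rule trun_put_right) auto
  have 6: "trun (walk Lft 1) (tape_of ?R2 \<sigma>) (3 + int ?n) 2 (tape_of ?R2 \<sigma>) (2 + int ?n)"
    by (rule trun_walkL) auto
  have 7: "trun (TWhile {B0, B1} (walk Lft 1)) (tape_of ?R2 \<sigma>) (2 + int ?n) (4 * Suc ?n + 1) (tape_of ?R2 \<sigma>) 1"
  proof (rule trun_scanL[where m = "Suc ?n"])
    fix i assume i: "i < Suc ?n"
    then have "2 + int ?n - int 1 * int i = 2 + int (?n - i)" by auto
    moreover have "?R2 (2 + int (?n - i)) = sym_of_bool ((y @ [b]) ! (?n - i))"
      using r[unfolded out_region_def, THEN conjunct2, THEN conjunct1, rule_format, of "?n - i"]
      by (simp del: fun_upd_apply)
    ultimately show "tape_of ?R2 \<sigma> (2 + int ?n - int 1 * int i) \<in> {B0, B1}"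
      using sob_in by (simp only: tape_of_right)
  qed (use r in \<open>auto simp: tape_of_right out_region_def\<close>)
  have 8: "trun (walk Lft 1) (tape_of ?R2 \<sigma>) 1 2 (tape_of ?R2 \<sigma>) 0" by (rule trun_walkL) auto
  show ?thesis unfolding emit_def
    by (intro exI[of _ ?R2] conjI r trun_Seq[OF 1 trun_Seq[OF 2 trun_Seq[OF 3 trun_Seq[OF 4 trun_Seq[OF 5 trun_Seq[OF 6
        trun_Seq[OF 7 8 order.refl] order.refl] order.refl] order.refl] order.refl] order.refl]])
      (use N in simp)
qed

text \<open>In a list code the entry \<open>True\<close> occupies the three symbols
  \<open>B1\<close>, \<open>B1\<close>, \<open>B0\<close> and the entry \<open>False\<close> the
  single \<open>B0\<close>; hence three pops against one. The loop ends at the \<open>Hash\<close>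
  that closes the word.\<close>

definition write_out :: tprog where
  "write_out = TSeq (walk Rgt 2) (TSeq (put Hash) (TSeq (walk Lft 2) (TSeq (peek 0)
     (TSeq (TWhile {B0, B1} (TSeq (TIf {B1}
         (TSeq (home 0) (TSeq (s2t (SSeq (Pop 0) (SSeq (Pop 0) (Pop 0)))) (emit True)))
         (TSeq (home 0) (TSeq (s2t (Pop 0)) (emit False)))) (peek 0)))
     (TSeq (home 0) (walk Rgt 2))))))"

lemma trun_write_loop:
  assumes "out_region R y" "length y + length z \<le> N" "esz z + 4 \<le> B"
  shows "\<exists>R'. out_region R' (y @ z) \<and> trun (TWhile {B0, B1} (TSeq (TIf {B1}
         (TSeq (home 0) (TSeq (s2t (SSeq (Pop 0) (SSeq (Pop 0) (Pop 0)))) (emit True)))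
         (TSeq (home 0) (TSeq (s2t (Pop 0)) (emit False)))) (peek 0)))
      (tape_of R (stk (W (wenc z)))) (cell 0 (Suc (esz z))) (length z * (10 * N + 4 * (100 + 100 * B) + 100) + 1)
      (tape_of R' (stk [Hash])) (cell 0 1)"
  using assms
proof (induction z arbitrary: R y)
  case Nil
  have "tape_of R (stk [Hash]) (cell 0 (length (stk [Hash] 0))) = hd_sym (stk [Hash] 0)"
    by (rule tape_of_top) simp
  then have "tape_of R (stk [Hash]) (cell 0 1) = Hash" by simp
  then show ?case using Nil by (intro exI[of _ R]) (auto simp: W_def intro!: trun_WhileF)
next
  case (Cons b z)
  let ?w = "wenc (b # z)"
  from trun_emit[OF Cons.prems(1), of N b "stk (W (wenc z))"] Cons.prems(2)
  obtain R1 where R1: "out_region R1 (y @ [b])"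
    and e: "trun (emit b) (tape_of R (stk (W (wenc z)))) 0 (10 * N + 30) (tape_of R1 (stk (W (wenc z)))) 0" by auto
  from Cons.IH[OF R1] Cons.prems obtain R' where R': "out_region R' (y @ b # z)"
    and rest: "trun (TWhile {B0, B1} (TSeq (TIf {B1}
         (TSeq (home 0) (TSeq (s2t (SSeq (Pop 0) (SSeq (Pop 0) (Pop 0)))) (emit True)))
         (TSeq (home 0) (TSeq (s2t (Pop 0)) (emit False)))) (peek 0)))
      (tape_of R1 (stk (W (wenc z)))) (cell 0 (Suc (esz z))) (length z * (10 * N + 4 * (100 + 100 * B) + 100) + 1)
      (tape_of R' (stk [Hash])) (cell 0 1)" by auto
  have top: "tape_of R (stk (W ?w)) (cell 0 (Suc (length ?w))) = hd_sym (W ?w)"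
    using tape_of_top[of 0 R "stk (W ?w)"] by (simp add: W_def)
  have hm: "trun (home 0) (tape_of R (stk (W ?w))) (cell 0 (Suc (length ?w))) (12 + 7 * B) (tape_of R (stk (W ?w))) 0"
    by (rule trun_home) (use Cons.prems in auto)
  have pk: "trun (peek 0) (tape_of R1 (stk (W (wenc z)))) 0 (14 + 7 * B) (tape_of R1 (stk (W (wenc z)))) (cell 0 (Suc (esz z)))"
    using trun_peek[of 0 "stk (W (wenc z))" B R1] stacks_ok_W Cons.prems by (simp add: W_def)
  let ?K = "3 * (100 + 100 * B)"
  let ?I = "TIf {B1} (TSeq (home 0) (TSeq (s2t (SSeq (Pop 0) (SSeq (Pop 0) (Pop 0)))) (emit True)))
         (TSeq (home 0) (TSeq (s2t (Pop 0)) (emit False)))"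
  have I: "trun ?I (tape_of R (stk (W ?w))) (cell 0 (Suc (length ?w))) (12 + 7 * B + (?K + (10 * N + 30)) + 2)
    (tape_of R1 (stk (W (wenc z)))) 0"
  proof (cases b)
    case True
    have w: "W ?w = B1 # B1 # B0 # W (wenc z)" by (simp add: True W_def wpair_def dbl_def wenc_bool_def)
    have "srun (SSeq (Pop 0) (SSeq (Pop 0) (Pop 0))) (stk (W ?w)) 3 (stk (W (wenc z)))"
      by (rule srun_Seq[OF srun_Pop[OF _ refl order.refl] srun_Seq[OF srun_Pop[OF _ refl order.refl] srun_Pop[OF _ _ order.refl] order.refl]])
        (auto simp: w simp del: wenc_list.simps)
    then have "trun (s2t (SSeq (Pop 0) (SSeq (Pop 0) (Pop 0)))) (tape_of R (stk (W ?w))) 0 ?K (tape_of R (stk (W (wenc z)))) 0"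
      by (rule trun_s2t[where B = B]) (use Cons.prems in \<open>auto simp: stacks_ok_W height_W\<close>)
    note s = this
    have e': "trun (emit True) (tape_of R (stk (W (wenc z)))) 0 (10 * N + 30) (tape_of R1 (stk (W (wenc z)))) 0"
      using e by (simp only: True)
    show ?thesis using trun_IfT[OF _ trun_Seq[OF hm trun_Seq[OF s e' order.refl] order.refl] order.refl, of "{B1}"]
      unfolding top by (simp add: w del: wenc_list.simps s2t.simps)
  next
    case False
    have w: "W ?w = B0 # W (wenc z)" by (simp add: False W_def wpair_def dbl_def wenc_bool_def)
    have "srun (Pop 0) (stk (W ?w)) 1 (stk (W (wenc z)))" by (rule srun_Pop) (auto simp: w simp del: wenc_list.simps)
    then have "trun (s2t (Pop 0)) (tape_of R (stk (W ?w))) 0 ?K (tape_of R (stk (W (wenc z)))) 0"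
      by (rule trun_s2t[where B = B]) (use Cons.prems in \<open>auto simp: stacks_ok_W height_W\<close>)
    note s = this
    have e': "trun (emit False) (tape_of R (stk (W (wenc z)))) 0 (10 * N + 30) (tape_of R1 (stk (W (wenc z)))) 0"
      using e by (simp only: False)
    show ?thesis using trun_IfF[OF _ trun_Seq[OF hm trun_Seq[OF s e' order.refl] order.refl] order.refl, of "{B1}"]
      unfolding top by (simp add: w del: wenc_list.simps s2t.simps)
  qed
  have hd: "tape_of R (stk (W ?w)) (cell 0 (Suc (length ?w))) \<in> {B0, B1}"
    unfolding top by (cases b) (auto simp: W_def wpair_def dbl_def wenc_bool_def)
  show ?case
    by (rule exI[of _ R'], rule conjI[OF R'])
      (rule trun_WhileT[OF hd trun_Seq[OF I pk order.refl] rest], simp)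
qed

lemma trun_write_out:
  assumes R: "R 1 = Bk" and B: "esz z + 4 \<le> B" and N: "length z \<le> N"
  shows "\<exists>R'. out_region R' z \<and> trun write_out (tape_of R (stk (W (wenc z)))) 0
    (N * (10 * N + 4 * (100 + 100 * B) + 100) + 100 + 20 * B) (tape_of R' (stk [Hash])) 2"
proof -
  let ?T = "tape_of R (stk (W (wenc z)))"
  let ?R1 = "R(2 := Hash)"
  let ?T1 = "tape_of ?R1 (stk (W (wenc z)))"
  have 1: "trun (walk Rgt 2) ?T 0 3 ?T 2" by (rule trun_walkR) auto
  have 2: "trun (put Hash) ?T 2 1 ?T1 2" by (rule trun_put_right) auto
  have 3: "trun (walk Lft 2) ?T1 2 3 ?T1 0" by (rule trun_walkL) auto
  have 4: "trun (peek 0) ?T1 0 (14 + 7 * B) ?T1 (cell 0 (Suc (esz z)))"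
    using trun_peek[of 0 "stk (W (wenc z))" B ?R1] stacks_ok_W B by (simp add: W_def)
  have "out_region ?R1 []" using R by (simp add: out_region_def)
  from trun_write_loop[OF this _ B, of N] N obtain R' where R': "out_region R' z"
    and 5: "trun (TWhile {B0, B1} (TSeq (TIf {B1}
         (TSeq (home 0) (TSeq (s2t (SSeq (Pop 0) (SSeq (Pop 0) (Pop 0)))) (emit True)))
         (TSeq (home 0) (TSeq (s2t (Pop 0)) (emit False)))) (peek 0)))
      ?T1 (cell 0 (Suc (esz z))) (length z * (10 * N + 4 * (100 + 100 * B) + 100) + 1)
      (tape_of R' (stk [Hash])) (cell 0 1)" by auto
  have 6: "trun (home 0) (tape_of R' (stk [Hash])) (cell 0 1) (12 + 7 * B) (tape_of R' (stk [Hash])) 0"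
    by (rule trun_home) auto
  have 7: "trun (walk Rgt 2) (tape_of R' (stk [Hash])) 0 3 (tape_of R' (stk [Hash])) 2" by (rule trun_walkR) auto
  have le: "length z * (10 * N + 4 * (100 + 100 * B) + 100) \<le> N * (10 * N + 4 * (100 + 100 * B) + 100)"
    using N by (rule mult_right_mono) simp
  show ?thesis unfolding write_out_def
    by (intro exI[of _ R'] conjI R' trun_Seq[OF 1 trun_Seq[OF 2 trun_Seq[OF 3 trun_Seq[OF 4 trun_Seq[OF 5
        trun_Seq[OF 6 7 order.refl] order.refl] order.refl] order.refl] order.refl]])
      (use le in linarith)
qed

text \<open>The time bound must hold for every word, including words with blanks inside. A blank
  looks like the end of the input, so the function computed is \<open>F\<close> on the part before
  the first blank.\<close>

theorem ptime_computable:
  fixes F :: "bool option list \<Rightarrow> bool list"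
  assumes "ptime F"
  obtains M and p :: "nat poly" where "tm_wf M"
    "tm_computes_in_time M (\<lambda>w. F (map opt_of_sym (takeWhile (\<lambda>s. s \<noteq> Bk) w))) (poly p)"
proof -
  obtain a and q :: "nat poly" where a: "\<And>x. wrun a (wenc x) (poly q (esz x)) (wenc (F x))"
    using pfE[OF assms] by blast
  define prog where "prog = TSeq (walk Lft 2) (TSeq (put Hash) (TSeq (s2t (Push 0 Hash)) (TSeq (walk Rgt 2)
    (TSeq (TWhile NB read_last) (TSeq (walk Lft 2) (TSeq (s2t a) write_out))))))"
  define t where "t N = poly q (7 * N)" for N
  define B where "B N = 7 * N + t N + 20" for N
  define time where "time N = 1000 + 1000 + (N * (20 * N + 8 * (100 + 100 * B N) + 72) + 1) + t N * (100 + 100 * B N) +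
    (B N * (10 * B N + 4 * (100 + 100 * B N) + 100) + 100 + 20 * B N) + 100" for N
  have "pbounded time" unfolding time_def B_def t_def
    using pbounded_self[where 'a = nat] by (intro pbounded_intros) simp_all
  then obtain p :: "nat poly" where p: "\<And>N. time N \<le> poly p N" unfolding pbounded_def by auto
  have "\<exists>t' \<le> poly p (length w). fst (tm_run (machine prog) t' w) = 1 \<and>
     tm_output (tm_run (machine prog) t' w) = F (map opt_of_sym (takeWhile (\<lambda>s. s \<noteq> Bk) w))" for w
  proof -
    define v where "v = takeWhile (\<lambda>s. s \<noteq> Bk) w"
    define N where "N = length w"
    define R where "R = input_tape w"
    let ?x = "map opt_of_sym v"
    have vN: "length v \<le> N" by (simp add: v_def N_def length_takeWhile_le)
    have esz_x: "esz ?x \<le> 7 * length v"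
    proof (induction v)
      case (Cons s v) then show ?case using esz_bool_option[of "opt_of_sym s"] by simp
    qed simp
    have out: "esz (F ?x) \<le> 7 * N + t N" and tle: "poly q (esz ?x) \<le> t N"
      using wrun_size[OF a, of ?x] poly_mono_nat[of "esz ?x" "7 * N" q] esz_x vN by (auto simp: t_def)
    have 1: "trun (walk Lft 2) R 2 3 R 0" by (rule trun_walkL) auto
    \<comment> \<open>On the blank left half, writing the marker alone already yields the layout of
      three empty stacks.\<close>
    have "R(0 := Hash) = tape_of R (stk [])"
      by (rule ext) (auto simp: R_def input_tape_def tape_of_def Let_def st_def nat_eq_iff)
    then have 2: "trun (put Hash) R 0 1 (tape_of R (stk [])) 0" using trun_put[of 1 Hash R 0] by simp
    have "srun (Push 0 Hash) (stk []) 1 (stk (W (wenc ([] :: bool option list))))"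
      by (rule srun_Push) (auto simp: W_def)
    then have 3: "trun (s2t (Push 0 Hash)) (tape_of R (stk [])) 0 1000 (tape_of R (stk (W (wenc ([] :: bool option list))))) 0"
      by (rule trun_s2t[where B = 1]) (auto simp: stacks_ok_Nil height_stk)
    have 4: "trun (walk Rgt 2) (tape_of R (stk (W (wenc ([] :: bool option list))))) 0 3 (tape_of R (stk (W (wenc ([] :: bool option list))))) 2"
      by (rule trun_walkR) auto
    have "\<exists>R'. R' 1 = Bk \<and> trun (TWhile NB read_last) (tape_of R (stk (W (wenc ([] :: bool option list))))) 2
      (length v * (20 * N + 8 * (100 + 100 * B N) + 72) + 1) (tape_of R' (stk (W (wenc (?x @ []))))) 2"
    proof (rule trun_read)
      show "R (2 + int i) = v ! i" if "i < length v" for i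
        using that vN by (auto simp: R_def input_tape_def nthb_def v_def N_def takeWhile_nth)
      show "R (2 + int (length v)) = Bk"
        using nth_length_takeWhile[of "\<lambda>s. s \<noteq> Bk" w] vN
        by (auto simp: R_def input_tape_def nthb_def v_def N_def)
    qed (use vN in \<open>auto simp: R_def input_tape_def v_def B_def dest: set_takeWhileD\<close>)
    then obtain R' where R': "R' 1 = Bk" and 5: "trun (TWhile NB read_last) (tape_of R (stk (W (wenc ([] :: bool option list))))) 2
      (length v * (20 * N + 8 * (100 + 100 * B N) + 72) + 1) (tape_of R' (stk (W (wenc ?x)))) 2" by auto
    have 6: "trun (walk Lft 2) (tape_of R' (stk (W (wenc ?x)))) 2 3 (tape_of R' (stk (W (wenc ?x)))) 0"
      by (rule trun_walkL) auto
    have "srun a (stk (W (wenc ?x))) (t N) (stk (W (wenc (F ?x))))"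
      using a[of ?x, unfolded wrun_def, rule_format, of "[]"] tle by (auto elim: srun_mono)
    then have 7: "trun (s2t a) (tape_of R' (stk (W (wenc ?x)))) 0 (t N * (100 + 100 * B N)) (tape_of R' (stk (W (wenc (F ?x))))) 0"
      by (rule trun_s2t[where B = "B N"]) (use esz_x vN in \<open>auto simp: stacks_ok_W height_W B_def\<close>)
    have "\<exists>R''. out_region R'' (F ?x) \<and> trun write_out (tape_of R' (stk (W (wenc (F ?x))))) 0
      (B N * (10 * B N + 4 * (100 + 100 * B N) + 100) + 100 + 20 * B N) (tape_of R'' (stk [Hash])) 2"
      by (rule trun_write_out) (use R' out length_le_esz[of "F ?x"] in \<open>auto simp: B_def\<close>)
    then obtain R'' where R'': "out_region R'' (F ?x)" and 8: "trun write_out (tape_of R' (stk (W (wenc (F ?x))))) 0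
      (B N * (10 * B N + 4 * (100 + 100 * B N) + 100) + 100 + 20 * B N) (tape_of R'' (stk [Hash])) 2" by blast
    have le: "length v * (20 * N + 8 * (100 + 100 * B N) + 72) \<le> N * (20 * N + 8 * (100 + 100 * B N) + 72)"
      using vN by (rule mult_right_mono) simp
    have "trun prog R 2 (time N - 2) (tape_of R'' (stk [Hash])) 2" unfolding prog_def
      by (rule trun_Seq[OF 1 trun_Seq[OF 2 trun_Seq[OF 3 trun_Seq[OF 4 trun_Seq[OF 5
        trun_Seq[OF 6 trun_Seq[OF 7 8 order.refl] order.refl] order.refl] order.refl] order.refl] order.refl]])
        (use le in \<open>unfold time_def, linarith\<close>)
    then obtain u where u: "u \<le> time N - 2" "texec prog (input_tape w) 2 u (tape_of R'' (stk [Hash])) 2"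
      unfolding trun_def R_def by blast
    have "\<exists>t' \<le> u + 2. fst (tm_run (machine prog) t' w) = 1 \<and> tm_output (tm_run (machine prog) t' w) = F ?x"
      by (rule machine_runs[OF u(2)]) (use R'' in \<open>auto simp: out_region_def tape_of_right\<close>)
    then obtain t' where "t' \<le> u + 2" "fst (tm_run (machine prog) t' w) = 1" "tm_output (tm_run (machine prog) t' w) = F ?x"
      by blast
    moreover have "u + 2 \<le> poly p N" using u(1) p[of N] by (simp add: time_def)
    ultimately show ?thesis by (intro exI[of _ t']) (auto simp: N_def v_def)
  qed
  then show ?thesis
    by (intro that[OF tm_wf_machine, of prog p]) (simp add: tm_computes_in_time_def)
qed

section \<open>Range avoidance by comparing tree labellings\<close>

fun lexle :: "bool list \<Rightarrow> bool list \<Rightarrow> bool" where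
  "lexle (x # xs) (y # ys) = (if x = y then lexle xs ys else y)"
| "lexle _ _ = True"

lemma lexle_antisym: "length xs = length ys \<Longrightarrow> lexle xs ys \<Longrightarrow> lexle ys xs \<Longrightarrow> xs = ys"
  by (induction xs ys rule: lexle.induct) (auto split: if_splits)

lemma lexle_least:
  assumes "S \<noteq> {}" "\<And>z. z \<in> S \<Longrightarrow> length z = n"
  shows "\<exists>z \<in> S. \<forall>z' \<in> S. lexle z z'"
  using assms
proof (induction n arbitrary: S)
  case 0 then show ?case by (metis ex_in_conv length_0_conv lexle.simps(2))
next
  case (Suc n)
  \<comment> \<open>The first bit of the least element; the tails of the members that start with it
    form the smaller instance.\<close>
  define b where "b = (\<forall>xs. False # xs \<notin> S)"
  let ?S = "{xs. b # xs \<in> S}"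
  have "?S \<noteq> {}"
  proof (cases b)
    case True
    from Suc.prems(1) obtain z where z: "z \<in> S" by auto
    with Suc.prems(2)[OF z] obtain c xs where "z = c # xs" by (cases z) auto
    with z True show ?thesis by (cases c) (auto simp: b_def)
  next
    case False
    then obtain xs where "False # xs \<in> S" by (auto simp: b_def)
    with False show ?thesis by auto
  qed
  then obtain z where z: "b # z \<in> S" "\<And>z'. b # z' \<in> S \<Longrightarrow> lexle z z'"
    using Suc.IH[of ?S] Suc.prems(2) by fastforce
  have "lexle (b # z) z'" if z': "z' \<in> S" for z'
  proof -
    obtain c ys where "z' = c # ys" using Suc.prems(2)[OF z'] by (cases z') auto
    with z z' show ?thesis by (auto simp: b_def)
  qed
  with z(1) show ?case by blast
qed

section \<open>The stretch and the comparison of certificates\<close>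

definition ext_step :: "(bool list \<Rightarrow> bool list) \<Rightarrow> bool list \<times> bool list \<Rightarrow> bool list \<times> bool list" where
  "ext_step C s = (butlast (C (fst s)), last (C (fst s)) # snd s)"

text \<open>Each round feeds \<open>n\<close> bits back and sets one aside in front of the earlier
  ones. Undoing the last round therefore replaces the first \<open>n + 1\<close> bits of the string
  by an \<open>n\<close>-bit preimage under \<open>C\<close>.\<close>

definition ext :: "(bool list \<Rightarrow> bool list) \<Rightarrow> nat \<Rightarrow> bool list \<Rightarrow> bool list" where
  "ext C k z = (let r = (ext_step C ^^ k) (z, []) in fst r @ snd r)"

type_synonym label = "bool list option"
type_synonym claim = "label \<times> label list"

text \<open>A claim about a node of the tree is a purported label of it (\<open>None\<close> for "this subtree
  contains a node whose children have labels that together are not in the range of the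
  stretched circuit"), followed by a list which gives the claimed labels of both children of each
  node on the path to that failure. From a claim about a node one reads off claims about its
  children.\<close>

definition kids :: "(bool list \<Rightarrow> bool list) \<Rightarrow> nat \<Rightarrow> claim \<Rightarrow> claim \<times> claim" where
  "kids C n c = (if fst c = None then ((hd (snd c), drop 2 (snd c)), (hd (tl (snd c)), drop 2 (snd c)))
     else ((Some (take n (ext C n (the (fst c)))), drop 2 (snd c)),
           (Some (drop n (ext C n (the (fst c)))), drop 2 (snd c))))"

text \<open>Two failures never count as agreement, since they may sit at different nodes; the
  comparison has to descend further.\<close>

definition same :: "label \<Rightarrow> label \<Rightarrow> bool" where
  "same a b \<longleftrightarrow> a \<noteq> None \<and> b \<noteq> None \<and> the a = the b"

text \<open>Applied only where the claims agree on both children. A label there is a preimage of the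
  agreed pair by construction, because \<open>kids\<close> derives the children from it, so no
  validity test occurs.\<close>

definition beats :: "label \<Rightarrow> label \<Rightarrow> bool" where
  "beats a b \<longleftrightarrow> a \<noteq> None \<and> (b = None \<or> lexle (the a) (the b))"

definition good_leaf :: "(bool list \<Rightarrow> bool list) \<Rightarrow> nat \<Rightarrow> bool list \<Rightarrow> label \<Rightarrow> bool" where
  "good_leaf C n p a \<longleftrightarrow> a \<noteq> None \<and> ext C (Suc n) (the a) = p"

text \<open>A leaf has no children to compare, so here the preimage is tested: an invalid label
  loses to \<open>None\<close>, and two valid ones are compared by size.\<close>

definition beats_leaf :: "(bool list \<Rightarrow> bool list) \<Rightarrow> nat \<Rightarrow> bool list \<Rightarrow> label \<Rightarrow> label \<Rightarrow> bool" where
  "beats_leaf C n p a b = (if good_leaf C n p a then \<not> good_leaf C n p b \<or> lexle (the a) (the b)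
     else a = None \<and> \<not> good_leaf C n p b)"

type_synonym cmp_state = "bool option \<times> bool list \<times> claim \<times> claim"

text \<open>The descent is iterated on an explicit state, the form that \<open>ptime_funpow\<close>
  handles; \<open>cmp_Suc\<close> recovers the recursion over the height.\<close>

definition cmp_step :: "(bool list \<Rightarrow> bool list) \<Rightarrow> nat \<Rightarrow> cmp_state \<Rightarrow> cmp_state" where
  "cmp_step C n s = (case s of (res, p, c, c') \<Rightarrow>
     if res \<noteq> None then (res, p, c, c') else
     let k = kids C n c; k' = kids C n c' in
     if same (fst (fst k)) (fst (fst k')) then
       if same (fst (snd k)) (fst (snd k')) then (Some (beats (fst c) (fst c')), p, c, c')
       else (None, p @ [True], snd k, snd k')
     else (None, p @ [False], fst k, fst k'))"

definition cmp :: "(bool list \<Rightarrow> bool list) \<Rightarrow> nat \<Rightarrow> nat \<Rightarrow> bool list \<Rightarrow> claim \<Rightarrow> claim \<Rightarrow> bool" where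
  "cmp C n h p c c' = (case (cmp_step C n ^^ h) (None, p, c, c') of (res, p, c, c') \<Rightarrow>
     if res \<noteq> None then the res else beats_leaf C n p (fst c) (fst c'))"

lemma cmp_step_done: "(cmp_step C n ^^ h) (Some d, p, c, c') = (Some d, p, c, c')"
  by (induction h) (auto simp: cmp_step_def)

lemma cmp_0: "cmp C n 0 p c c' = beats_leaf C n p (fst c) (fst c')"
  by (simp add: cmp_def)

lemma cmp_Suc: "cmp C n (Suc h) p c c' =
   (if same (fst (fst (kids C n c))) (fst (fst (kids C n c'))) then
      if same (fst (snd (kids C n c))) (fst (snd (kids C n c'))) then beats (fst c) (fst c')
      else cmp C n h (p @ [True]) (snd (kids C n c)) (snd (kids C n c'))
    else cmp C n h (p @ [False]) (fst (kids C n c)) (fst (kids C n c')))"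
  unfolding cmp_def funpow.simps(2) funpow_swap1 o_apply
  by (subst cmp_step_def) (auto simp: cmp_step_done Let_def)

type_synonym fail_state = "bool \<times> bool list \<times> label list"

definition fail_step :: "fail_state \<Rightarrow> fail_state" where
  "fail_step s = (case s of (stop, p, es) \<Rightarrow>
     if stop then s
     else if hd es = None then (False, p @ [False], drop 2 es)
     else if hd (tl es) = None then (False, p @ [True], drop 2 es)
     else (True, the (hd es) @ the (hd (tl es)), []))"

text \<open>Reads off the string that is claimed to have no preimage: the joined labels of the
  children if the failing node is an inner one, the address if it is a leaf.\<close>

definition fail :: "nat \<Rightarrow> bool list \<Rightarrow> label list \<Rightarrow> bool list" where
  "fail h p es = fst (snd ((fail_step ^^ h) (False, p, es)))"

lemma fail_step_done: "(fail_step ^^ h) (True, p, es) = (True, p, es)"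
  by (induction h) (auto simp: fail_step_def)

lemma fail_0: "fail 0 p es = p"
  by (simp add: fail_def)

lemma fail_Suc: "fail (Suc h) p es =
   (if hd es = None then fail h (p @ [False]) (drop 2 es)
    else if hd (tl es) = None then fail h (p @ [True]) (drop 2 es)
    else the (hd es) @ the (hd (tl es)))"
  unfolding fail_def funpow.simps(2) funpow_swap1 o_apply
  by (subst fail_step_def) (auto simp: fail_step_done)

text \<open>Lets one list carry the path and, behind it, the preimages for
  \<open>chain\<close>.\<close>

lemma fail_append: "2 * h \<le> length es \<Longrightarrow> fail h p (es @ r) = fail h p es"
proof (induction h arbitrary: p es)
  case (Suc h)
  then obtain a b fs where "es = a # b # fs" "2 * h \<le> length fs"
    by (cases es; cases "tl es") auto
  with Suc.IH show ?case by (simp add: fail_Suc)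
qed (simp add: fail_0)

type_synonym chain_state = "bool \<times> bool list \<times> label list \<times> label list"

text \<open>Undoes one round of \<open>ext\<close> with the smaller of the valid preimages on offer;
  if there is none, the \<open>n + 1\<close> bits at hand become the answer. Both lists advance
  together, so entries at the same position belong to the same round, whichever prover supplied the
  previous preimage.\<close>

definition chain_step :: "(bool list \<Rightarrow> bool list) \<Rightarrow> chain_state \<Rightarrow> bool \<Rightarrow> chain_state" where
  "chain_step C s b = (case s of (stop, t, us, us') \<Rightarrow>
     if stop then s else
     let v = (hd us \<noteq> None \<and> C (the (hd us)) = t @ [b]);
         v' = (hd us' \<noteq> None \<and> C (the (hd us')) = t @ [b]) in
     if v \<and> (\<not> v' \<or> lexle (the (hd us)) (the (hd us'))) then (False, the (hd us), tl us, tl us')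
     else if v' then (False, the (hd us'), tl us, tl us')
     else (True, t @ [b], us, us'))"

definition chain :: "(bool list \<Rightarrow> bool list) \<Rightarrow> bool list \<Rightarrow> bool list \<Rightarrow> label list \<Rightarrow> label list \<Rightarrow> bool list" where
  "chain C t bs us us' = fst (snd (foldl (chain_step C) (False, t, us, us') bs))"

lemma chain_step_done: "foldl (chain_step C) (True, y, us, us') bs = (True, y, us, us')"
  by (induction bs) (auto simp: chain_step_def)

definition solve :: "(bool list \<Rightarrow> bool list) \<Rightarrow> nat \<Rightarrow> label list \<Rightarrow> label list \<Rightarrow> bool list" where
  "solve C n q q' = (let m = Suc (n + n);
     y = fail m [] (if cmp C n m [] (None, q) (None, q') then q else q')
     in chain C (take n y) (drop n y) (drop (m + m) q) (drop (m + m) q'))"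

definition labels_ok :: "nat \<Rightarrow> label list \<Rightarrow> bool" where
  "labels_ok n es \<longleftrightarrow> (\<forall>z. Some z \<in> set es \<longrightarrow> length z = n)"

section \<open>An honest certificate determines the output\<close>

locale avoid =
  fixes C :: "bool list \<Rightarrow> bool list" and n :: nat
  assumes len_C: "length z = n \<Longrightarrow> length (C z) = Suc n"
begin

lemma ext_step_lengths:
  assumes "length z = n"
  shows "length (fst ((ext_step C ^^ k) (z, []))) = n \<and> length (snd ((ext_step C ^^ k) (z, []))) = k"
  using assms by (induction k) (auto simp: ext_step_def len_C)

lemma length_ext: "length z = n \<Longrightarrow> length (ext C k z) = n + k"
  using ext_step_lengths[of z k] by (simp add: ext_def Let_def)

lemma ext_Suc:
  assumes "length w = n" "length z = n" "ext C k w = z @ bs" "C z = t @ [b]"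
  shows "ext C (Suc k) w = t @ b # bs"
proof -
  have "fst ((ext_step C ^^ k) (w, [])) = z" "snd ((ext_step C ^^ k) (w, [])) = bs"
    using assms(2,3) ext_step_lengths[OF assms(1), of k] by (auto simp: ext_def Let_def)
  then show ?thesis using assms(4) by (simp add: ext_def ext_step_def)
qed

definition least_such :: "(bool list \<Rightarrow> bool) \<Rightarrow> label" where
  "least_such P = (if \<exists>z. length z = n \<and> P z
     then Some (SOME z. length z = n \<and> P z \<and> (\<forall>z'. length z' = n \<longrightarrow> P z' \<longrightarrow> lexle z z')) else None)"

lemma least_such_None: "least_such P = None \<Longrightarrow> length z = n \<Longrightarrow> \<not> P z"
  by (auto simp: least_such_def split: if_splits)

lemma least_such_Some:
  assumes "least_such P = Some z"
  shows "length z = n" "P z" "\<And>z'. length z' = n \<Longrightarrow> P z' \<Longrightarrow> lexle z z'"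
proof -
  have ex: "\<exists>z. length z = n \<and> P z" and z: "z = (SOME z. length z = n \<and> P z \<and> (\<forall>z'. length z' = n \<longrightarrow> P z' \<longrightarrow> lexle z z'))"
    using assms by (auto simp: least_such_def split: if_splits)
  let ?S = "{z. length z = n \<and> P z}"
  have "?S \<noteq> {}" using ex by blast
  then have "\<exists>z \<in> ?S. \<forall>z' \<in> ?S. lexle z z'" by (rule lexle_least[of _ n]) simp
  then have "\<exists>z. length z = n \<and> P z \<and> (\<forall>z'. length z' = n \<longrightarrow> P z' \<longrightarrow> lexle z z')" by blast
  from someI_ex[OF this] show "length z = n" "P z" "\<And>z'. length z' = n \<Longrightarrow> P z' \<Longrightarrow> lexle z z'"
    unfolding z by blast+
qed

fun tree_label :: "nat \<Rightarrow> bool list \<Rightarrow> label" where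
  "tree_label 0 p = least_such (\<lambda>z. ext C (Suc n) z = p)"
| "tree_label (Suc h) p =
    (if tree_label h (p @ [False]) = None \<or> tree_label h (p @ [True]) = None then None
     else least_such (\<lambda>z. ext C n z = the (tree_label h (p @ [False])) @ the (tree_label h (p @ [True]))))"

lemma tree_label_length: "tree_label h p = Some z \<Longrightarrow> length z = n"
  by (cases h) (auto dest: least_such_Some split: if_splits)

text \<open>An inner label exists only together with labels of both children, so a label reaches
  down to every leaf below it. Applied to the root this feeds the counting argument.\<close>

lemma tree_label_leaves:
  "tree_label h p = Some z \<Longrightarrow> length q = h \<Longrightarrow> \<exists>w. length w = n \<and> ext C (Suc n) w = p @ q"
proof (induction h arbitrary: p q z)
  case 0 then show ?case by (auto dest: least_such_Some)
next
  case (Suc h)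
  then obtain b q' where q: "q = b # q'" by (cases q) auto
  from Suc.prems(1) obtain a a' where "tree_label h (p @ [False]) = Some a" "tree_label h (p @ [True]) = Some a'"
    by (auto split: if_splits)
  with Suc.IH[of "p @ [b]" _ q'] Suc.prems(2) show ?case by (cases b) (auto simp: q)
qed

lemma tree_label_root: "tree_label (Suc (n + n)) [] = None"
proof (rule ccontr)
  assume "tree_label (Suc (n + n)) [] \<noteq> None"
  then obtain z where z: "tree_label (Suc (n + n)) [] = Some z" by auto
  have card: "card {xs :: bool list. length xs = k} = 2 ^ k" "finite {xs :: bool list. length xs = k}" for k
    using card_lists_length_eq[of "UNIV :: bool set" k] finite_lists_length_eq[of "UNIV :: bool set" k] by simp_all
  have "{q. length q = Suc (n + n)} \<subseteq> ext C (Suc n) ` {w. length w = n}"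
    using tree_label_leaves[OF z] by (auto simp: image_iff)
  then have "card {q :: bool list. length q = Suc (n + n)} \<le> card {w :: bool list. length w = n}"
    using card(2) by (meson card_image_le card_mono finite_imageI le_trans)
  then have "(2 :: nat) ^ Suc (n + n) \<le> 2 ^ n" unfolding card .
  then show False by (subst (asm) power_increasing_iff) auto
qed

text \<open>If the left child fails, the remaining entries describe the left subtree and say nothing
  about the right one; hence the guard on the last condition.\<close>

fun honest :: "nat \<Rightarrow> bool list \<Rightarrow> claim \<Rightarrow> bool" where
  "honest 0 p c \<longleftrightarrow> fst c = tree_label 0 p"
| "honest (Suc h) p c \<longleftrightarrow> fst c = tree_label (Suc h) p \<and> honest h (p @ [False]) (fst (kids C n c)) \<and>
     (fst (fst (kids C n c)) \<noteq> None \<longrightarrow> honest h (p @ [True]) (snd (kids C n c)))"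

lemma honest_label: "honest h p c \<Longrightarrow> fst c = tree_label h p"
  by (cases h) auto

text \<open>A correct label fixes the labels below it, since its stretch splits into those of the
  children. The list \<open>es\<close> can therefore be arbitrary.\<close>

lemma honest_Some: "tree_label h p = Some z \<Longrightarrow> honest h p (Some z, es)"
proof (induction h arbitrary: p z es)
  case (Suc h)
  then obtain a b where ab: "tree_label h (p @ [False]) = Some a" "tree_label h (p @ [True]) = Some b"
    by (auto split: if_splits)
  with Suc.prems have "ext C n z = a @ b" by (auto dest: least_such_Some)
  moreover have "length a = n" using tree_label_length ab by blast
  ultimately have "kids C n (Some z, es) = ((Some a, drop 2 es), (Some b, drop 2 es))"
    by (simp add: kids_def)
  with Suc ab show ?case by simp
qed simp

text \<open>Entries that the failure path leaves open are filled with \<open>None\<close>, which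
  makes the length depend on \<open>h\<close> only. The arbitrary tail \<open>r\<close> leaves room
  for further entries behind the path.\<close>

lemma honest_exists:
  "\<exists>es. length es = 2 * h \<and> labels_ok n es \<and> (\<forall>r. honest h p (tree_label h p, es @ r))"
proof (induction h arbitrary: p)
  case 0 then show ?case by (auto simp: labels_ok_def)
next
  case (Suc h)
  let ?l = "tree_label h (p @ [False])" and ?r = "tree_label h (p @ [True])"
  show ?case
  proof (cases "tree_label (Suc h) p")
    case (Some z)
    show ?thesis unfolding Some
      by (intro exI[of _ "replicate (2 * Suc h) None"] conjI allI honest_Some[OF Some])
        (auto simp: labels_ok_def)
  next
    case None
    consider "?l = None" | a where "?l = Some a" "?r = None" | a b where "?l = Some a" "?r = Some b"
      by (cases ?l; cases ?r) auto
    then show ?thesis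
    proof cases
      case 1
      obtain es where es: "length es = 2 * h" "labels_ok n es" "\<And>r. honest h (p @ [False]) (?l, es @ r)"
        using Suc by meson
      show ?thesis unfolding None
        by (rule exI[of _ "None # None # es"]) (use es 1 None in \<open>auto simp: kids_def labels_ok_def simp del: tree_label.simps\<close>)
    next
      case (2 a)
      obtain es where es: "length es = 2 * h" "labels_ok n es" "\<And>r. honest h (p @ [True]) (?r, es @ r)"
        using Suc by meson
      show ?thesis unfolding None
        by (rule exI[of _ "Some a # None # es"])
          (use es 2 None honest_Some[OF 2(1)] tree_label_length[OF 2(1)] in \<open>auto simp: kids_def labels_ok_def simp del: tree_label.simps\<close>)
    next
      case (3 a b)
      show ?thesis unfolding None
        by (rule exI[of _ "Some a # Some b # replicate (2 * h) None"])
          (use 3 None honest_Some[OF 3(1)] honest_Some[OF 3(2)] tree_label_length[OF 3(1)] tree_label_length[OF 3(2)]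
            in \<open>auto simp: kids_def labels_ok_def simp del: tree_label.simps\<close>)
    qed
  qed
qed

text \<open>The two kinds of failing nodes give the two possible stretches: \<open>k = n + 1\<close>
  at a leaf and \<open>k = n\<close> at an inner node.\<close>

lemma honest_fail:
  assumes "honest h p (None, es)" "length p + h = Suc (n + n)"
  shows "\<exists>k \<le> Suc n. length (fail h p es) = n + k \<and> (\<forall>z. length z = n \<longrightarrow> ext C k z \<noteq> fail h p es)"
  using assms
proof (induction h arbitrary: p es)
  case 0
  then have "least_such (\<lambda>z. ext C (Suc n) z = p) = None" by simp
  from least_such_None[OF this] 0(2) show ?case by (intro exI[of _ "Suc n"]) (auto simp: fail_0)
next
  case (Suc h)
  let ?l = "tree_label h (p @ [False])" and ?r = "tree_label h (p @ [True])"
  have kids: "kids C n (None, es) = ((hd es, drop 2 es), (hd (tl es), drop 2 es))" by (simp add: kids_def)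
  have hl: "honest h (p @ [False]) (hd es, drop 2 es)" and hr: "hd es \<noteq> None \<Longrightarrow> honest h (p @ [True]) (hd (tl es), drop 2 es)"
    using Suc.prems(1) by (auto simp: kids)
  consider "hd es = None" | a where "hd es = Some a" "hd (tl es) = None" | a b where "hd es = Some a" "hd (tl es) = Some b"
    by (cases "hd es"; cases "hd (tl es)") auto
  then show ?case
  proof cases
    case 1
    then show ?thesis using Suc.IH[of "p @ [False]" "drop 2 es"] hl Suc.prems(2) by (auto simp: fail_Suc)
  next
    case 2
    then show ?thesis using Suc.IH[of "p @ [True]" "drop 2 es"] hr Suc.prems(2) by (auto simp: fail_Suc)
  next
    case (3 a b)
    then have l: "?l = Some a" using honest_label[OF hl] by simp
    from 3 have r: "?r = Some b" using honest_label[OF hr] by simp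
    have "least_such (\<lambda>z. ext C n z = a @ b) = None" using Suc.prems(1) l r by simp
    from least_such_None[OF this] show ?thesis
      using 3 tree_label_length[OF l] tree_label_length[OF r] by (intro exI[of _ n]) (auto simp: fail_Suc)
  qed
qed

text \<open>Well-formedness that even a dishonest certificate has; decoding ensures it, see
  \<open>labels_ok_labels\<close>.\<close>

definition claim_ok :: "nat \<Rightarrow> claim \<Rightarrow> bool" where
  "claim_ok h c \<longleftrightarrow> labels_ok n (fst c # snd c) \<and> 2 * h \<le> length (snd c)"

lemma claim_ok_kids:
  assumes "claim_ok (Suc h) c" shows "claim_ok h (fst (kids C n c))" "claim_ok h (snd (kids C n c))"
proof -
  obtain a es where c: "c = (a, es)" by (cases c)
  from assms obtain x y fs where es: "es = x # y # fs" by (cases es; cases "tl es") (auto simp: c claim_ok_def)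
  have "length (ext C n z) = n + n" if "a = Some z" for z
    using length_ext[of z n] assms that by (auto simp: c claim_ok_def labels_ok_def)
  with assms show "claim_ok h (fst (kids C n c))" "claim_ok h (snd (kids C n c))"
    by (auto simp: c es kids_def claim_ok_def labels_ok_def)
qed

text \<open>In a tie either choice leads to the same string, so the outcome of the comparison does
  not matter.\<close>

definition tie :: "nat \<Rightarrow> bool list \<Rightarrow> claim \<Rightarrow> claim \<Rightarrow> bool" where
  "tie h p c c' \<longleftrightarrow> fst c = None \<and> fst c' = None \<and> fail h p (snd c) = fail h p (snd c')"

lemma kids_None:
  "fst c = None \<Longrightarrow> kids C n c = ((hd (snd c), drop 2 (snd c)), (hd (tl (snd c)), drop 2 (snd c)))"
  by (simp add: kids_def)

lemma kids_fst_None: "fst (fst (kids C n c)) = None \<or> fst (snd (kids C n c)) = None \<Longrightarrow> fst c = None"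
  by (auto simp: kids_def split: if_splits)

lemma same_sym: "same a b = same b a" by (auto simp: same_def)

lemma least_beats:
  assumes "least_such P = Some z" "length z' = n" "P z'" "z' \<noteq> z"
  shows "lexle z z'" "\<not> lexle z' z"
  using least_such_Some[OF assms(1)] assms(2-4) lexle_antisym[of z' z] by auto

text \<open>At the first node, in postorder, on which two claims disagree, both have agreed on the
  children before. So if one of the claims is honest, then the other label is
  either a larger preimage or refuted by a preimage.\<close>

lemma cmp_honest:
  assumes "honest h p c" "claim_ok h c" "claim_ok h c'" "\<not> same (fst c) (fst c')"
  shows "(cmp C n h p c c' \<or> tie h p c c') \<and> (\<not> cmp C n h p c' c \<or> tie h p c c')"
  using assms
proof (induction h arbitrary: p c c')
  case 0
  let ?P = "\<lambda>z. ext C (Suc n) z = p"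
  have len: "length z = n" if "fst c = Some z \<or> fst c' = Some z" for z
    using 0(2,3) that by (auto simp: claim_ok_def labels_ok_def)
  show ?case
  proof (cases "fst c")
    case None
    then have "least_such ?P = None" using 0(1) by simp
    then have "\<not> good_leaf C n p (fst c')"
      using len least_such_None[of ?P] by (cases "fst c'") (simp_all add: good_leaf_def)
    then show ?thesis using None by (auto simp: cmp_0 beats_leaf_def tie_def fail_0 good_leaf_def)
  next
    case (Some z)
    then have l: "least_such ?P = Some z" using 0(1) by simp
    from least_such_Some(2)[OF this] have g: "good_leaf C n p (fst c)" using Some by (simp add: good_leaf_def)
    show ?thesis
    proof (cases "good_leaf C n p (fst c')")
      case True
      then obtain z' where z': "fst c' = Some z'" "?P z'" by (auto simp: good_leaf_def)
      moreover have "z' \<noteq> z" using 0(4) z' Some by (auto simp: same_def)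
      ultimately show ?thesis using least_beats[OF l, of z'] len g True Some by (simp add: cmp_0 beats_leaf_def)
    next
      case False
      then show ?thesis using g by (simp add: cmp_0 beats_leaf_def)
    qed
  qed
next
  case (Suc h)
  define L R L' R' where "L = fst (kids C n c)" and "R = snd (kids C n c)"
    and "L' = fst (kids C n c')" and "R' = snd (kids C n c')"
  note LR = L_def[symmetric] R_def[symmetric] L'_def[symmetric] R'_def[symmetric]
  have ok: "claim_ok h L" "claim_ok h R" "claim_ok h L'" "claim_ok h R'"
    using claim_ok_kids[OF Suc.prems(2)] claim_ok_kids[OF Suc.prems(3)] by (auto simp: LR)
  have hL: "honest h (p @ [False]) L" using Suc.prems(1) by (simp add: LR)
  have eqs: "cmp C n (Suc h) p c c' = (if same (fst L) (fst L') then if same (fst R) (fst R') then beats (fst c) (fst c')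
      else cmp C n h (p @ [True]) R R' else cmp C n h (p @ [False]) L L')"
    "cmp C n (Suc h) p c' c = (if same (fst L) (fst L') then if same (fst R) (fst R') then beats (fst c') (fst c)
      else cmp C n h (p @ [True]) R' R else cmp C n h (p @ [False]) L' L)"
    by (simp_all add: cmp_Suc LR same_sym)
  have kN: "L = (hd (snd c), drop 2 (snd c))" "R = (hd (tl (snd c)), drop 2 (snd c))" if "fst c = None"
    using kids_None[OF that] by (simp_all add: L_def R_def)
  have kN': "L' = (hd (snd c'), drop 2 (snd c'))" "R' = (hd (tl (snd c')), drop 2 (snd c'))" if "fst c' = None"
    using kids_None[OF that] by (simp_all add: L'_def R'_def)
  have up: "fst c = None" if "fst L = None \<or> fst R = None"
    by (rule kids_fst_None) (use that in \<open>simp add: L_def R_def\<close>)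
  have up': "fst c' = None" if "fst L' = None \<or> fst R' = None"
    by (rule kids_fst_None) (use that in \<open>simp add: L'_def R'_def\<close>)
  show ?case
  proof (cases "same (fst L) (fst L')")
    case False
    \<comment> \<open>A tie at a child passes to the parents: a child without label forces both of
      them to be \<open>None\<close>, and \<open>fail\<close> then descends into this same
      child.\<close>
    have "tie (Suc h) p c c'" if t: "tie h (p @ [False]) L L'"
    proof -
      have N: "fst c = None" "fst c' = None" using t up up' by (auto simp: tie_def)
      show ?thesis using t unfolding tie_def fail_Suc kN[OF N(1)] kN'[OF N(2)] by (simp add: N)
    qed
    with Suc.IH[OF hL ok(1,3) False] False show ?thesis unfolding eqs by auto
  next
    case sL: True
    then obtain a where a: "fst L = Some a" "fst L' = Some a" by (auto simp: same_def)
    have hR: "honest h (p @ [True]) R" using Suc.prems(1) a(1) by (simp add: LR)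
    show ?thesis
    proof (cases "same (fst R) (fst R')")
      case False
      have "tie (Suc h) p c c'" if t: "tie h (p @ [True]) R R'"
      proof -
        have N: "fst c = None" "fst c' = None" using t up up' by (auto simp: tie_def)
        show ?thesis using t a unfolding tie_def fail_Suc kN[OF N(1)] kN'[OF N(2)] by (simp add: N)
      qed
      with Suc.IH[OF hR ok(2,4) False] False sL show ?thesis unfolding eqs by auto
    next
      case sR: True
      then obtain b where b: "fst R = Some b" "fst R' = Some b" by (auto simp: same_def)
      let ?P = "\<lambda>z. ext C n z = a @ b"
      have c: "fst c = least_such ?P"
        using Suc.prems(1) a b honest_label[OF hL] honest_label[OF hR] by (auto split: if_splits)
      \<comment> \<open>The agreed children are the two halves of \<open>ext C n z'\<close>, so an
        opposing label is a genuine preimage and can at best be larger than the honest one.\<close>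
      have z': "?P z' \<and> length z' = n" if "fst c' = Some z'" for z'
      proof -
        have "take n (ext C n z') = a" "drop n (ext C n z') = b"
          using that a(2) b(2) by (auto simp: L'_def R'_def kids_def)
        then have "ext C n z' = a @ b" by (metis append_take_drop_id)
        with that Suc.prems(3) show ?thesis by (auto simp: claim_ok_def labels_ok_def)
      qed
      show ?thesis
      proof (cases "fst c")
        case None
        have N: "fst c' = None"
        proof (rule ccontr)
          assume "fst c' \<noteq> None"
          then obtain z' where "fst c' = Some z'" by auto
          from z'[OF this] least_such_None[of ?P z'] c None show False by simp
        qed
        have "tie (Suc h) p c c'"
          using a b None N unfolding tie_def fail_Suc kN[OF None] kN'[OF N] by simp
        then show ?thesis by simp
      next
        case (Some z)
        show ?thesis
        proof (cases "fst c'")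
          case None
          then show ?thesis using Some sL sR unfolding eqs by (simp add: beats_def)
        next
          case (Some z')
          then have "z' \<noteq> z" using Suc.prems(4) \<open>fst c = Some z\<close> by (auto simp: same_def)
          from least_beats[OF c[unfolded \<open>fst c = Some z\<close>, symmetric] _ _ this] z'[OF Some]
          show ?thesis using Some \<open>fst c = Some z\<close> sL sR unfolding eqs by (simp add: beats_def)
        qed
      qed
    qed
  qed
qed

text \<open>Induction on the bits still to be undone. Against honest least preimages an opponent can
  offer only larger valid ones, so the greedy choice is forced in either argument order. The process
  stops before the bits run out, since every \<open>n\<close>-bit string is a value of
  \<open>ext C 0\<close>; this makes the base case contradictory.\<close>

lemma chain_honest:
  assumes "\<And>z. length z = n \<Longrightarrow> ext C (length bs) z \<noteq> t @ bs" "length t = n"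
  shows "\<exists>us y. length us = length bs \<and> labels_ok n us \<and> length y = Suc n \<and> (\<forall>z. length z = n \<longrightarrow> C z \<noteq> y) \<and>
    (\<forall>r us'. labels_ok n us' \<longrightarrow> length bs \<le> length us' \<longrightarrow>
       chain C t bs (us @ r) us' = y \<and> chain C t bs us' (us @ r) = y)"
  using assms
proof (induction bs arbitrary: t)
  case Nil
  from Nil(1)[OF Nil(2)] show ?case by (simp add: ext_def)
next
  case (Cons b bs)
  let ?P = "\<lambda>z. C z = t @ [b]"
  show ?case
  proof (cases "least_such ?P")
    case None
    have inv: "\<not> (hd us' \<noteq> None \<and> ?P (the (hd us')))" if "labels_ok n us'" "length (b # bs) \<le> length us'" for us'
      using that least_such_None[OF None] by (cases us') (auto simp: labels_ok_def)
    let ?us = "replicate (length (b # bs)) (None :: label)"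
    have "chain C t (b # bs) (?us @ r) us' = t @ [b] \<and> chain C t (b # bs) us' (?us @ r) = t @ [b]"
      if "labels_ok n us'" "length (b # bs) \<le> length us'" for r us'
      using inv[OF that] by (auto simp: chain_def chain_step_def[of _ _ b] chain_step_done)
    moreover have "length (t @ [b]) = Suc n" using Cons.prems(2) by simp
    moreover have "labels_ok n ?us" by (auto simp: labels_ok_def)
    moreover have "\<forall>z. length z = n \<longrightarrow> C z \<noteq> t @ [b]" using least_such_None[OF None] by blast
    ultimately show ?thesis by (intro exI[of _ ?us] exI[of _ "t @ [b]"]) auto
  next
    case (Some z)
    note z = least_such_Some[OF Some]
    have "\<exists>us y. length us = length bs \<and> labels_ok n us \<and> length y = Suc n \<and> (\<forall>z. length z = n \<longrightarrow> C z \<noteq> y) \<and>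
      (\<forall>r us'. labels_ok n us' \<longrightarrow> length bs \<le> length us' \<longrightarrow>
       chain C z bs (us @ r) us' = y \<and> chain C z bs us' (us @ r) = y)"
    proof (rule Cons.IH)
      fix w :: "bool list" assume w: "length w = n"
      show "ext C (length bs) w \<noteq> z @ bs"
        using ext_Suc[OF w z(1) _ z(2)] Cons.prems(1)[OF w] by auto
    qed (rule z(1))
    then obtain us y where us: "length us = length bs" "labels_ok n us" "length y = Suc n" "\<forall>z. length z = n \<longrightarrow> C z \<noteq> y"
      and ch: "\<And>r us'. labels_ok n us' \<Longrightarrow> length bs \<le> length us' \<Longrightarrow>
       chain C z bs (us @ r) us' = y \<and> chain C z bs us' (us @ r) = y" by blast
    have "chain C t (b # bs) ((Some z # us) @ r) us' = y \<and> chain C t (b # bs) us' ((Some z # us) @ r) = y"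
      if us': "labels_ok n us'" "length (b # bs) \<le> length us'" for r us'
    proof -
      obtain a vs where vs: "us' = a # vs" using us' by (cases us') auto
      have "labels_ok n vs" "length bs \<le> length vs" using us' by (auto simp: vs labels_ok_def)
      note IH = ch[OF this, of r]
      have la: "length w = n" if "a = Some w" for w using us' that by (auto simp: vs labels_ok_def)
      \<comment> \<open>With the opponent in first position, a valid entry that is not larger wins;
        by minimality and antisymmetry it is the honest one.\<close>
      have eq: "w = z" if "length w = n" "?P w" "lexle w z" for w
        using least_beats(2)[OF Some] that by blast
      have 1: "chain_step C (False, t, (Some z # us) @ r, us') b = (False, z, us @ r, vs)"
        using z la by (auto simp: chain_step_def vs Let_def)
      have 2: "chain_step C (False, t, us', (Some z # us) @ r) b = (False, z, vs, us @ r)"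
        using z la eq by (auto simp: chain_step_def vs Let_def)
      show ?thesis using IH by (simp only: chain_def foldl.simps 1 2)
    qed
    with us z(1) show ?thesis
      by (intro exI[of _ "Some z # us"] exI[of _ y]) (auto simp: labels_ok_def)
  qed
qed

theorem solve_honest:
  "\<exists>q y. length q = 5 * n + 3 \<and> labels_ok n q \<and> length y = Suc n \<and> (\<forall>z. length z = n \<longrightarrow> C z \<noteq> y) \<and>
    (\<forall>q'. length q' = 5 * n + 3 \<longrightarrow> labels_ok n q' \<longrightarrow> solve C n q q' = y \<and> solve C n q' q = y)"
proof -
  let ?m = "Suc (n + n)"
  obtain es where es: "length es = 2 * ?m" "labels_ok n es" "\<And>r. honest ?m [] (None, es @ r)"
    using honest_exists[of ?m "[]"] unfolding tree_label_root by blast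
  define Y where "Y = fail ?m [] es"
  have Yr: "fail ?m [] (es @ r) = Y" for r using es(1) by (simp add: Y_def fail_append)
  obtain k where k: "k \<le> Suc n" "length Y = n + k" "\<And>z. length z = n \<Longrightarrow> ext C k z \<noteq> Y"
    using honest_fail[OF es(3)[of "[]"]] by (auto simp: Y_def)
  obtain us y where us: "length us = k" "labels_ok n us" and y: "length y = Suc n" "\<forall>z. length z = n \<longrightarrow> C z \<noteq> y"
    and ch: "\<And>r us'. labels_ok n us' \<Longrightarrow> k \<le> length us' \<Longrightarrow>
       chain C (take n Y) (drop n Y) (us @ r) us' = y \<and> chain C (take n Y) (drop n Y) us' (us @ r) = y"
    using chain_honest[of "drop n Y" "take n Y"] k by auto
  \<comment> \<open>There are \<open>2 * (2 * n + 1)\<close> entries for the path and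
    \<open>n + 1\<close> for the way back; the padding makes the length independent of
    \<open>k\<close>.\<close>
  define q where "q = es @ us @ replicate (Suc n - k) None"
  have len: "length q = 5 * n + 3" using es us k by (simp add: q_def)
  have okq: "labels_ok n q" using es us by (auto simp: q_def labels_ok_def)
  have "solve C n q q' = y \<and> solve C n q' q = y" if q': "length q' = 5 * n + 3" "labels_ok n q'" for q'
  proof -
    have cok: "claim_ok ?m (None, r)" if "length r = 5 * n + 3" "labels_ok n r" for r
      using that by (auto simp: claim_ok_def labels_ok_def)
    have "honest ?m [] (None, q)" unfolding q_def by (rule es(3))
    then have c: "(cmp C n ?m [] (None, q) (None, q') \<or> tie ?m [] (None, q) (None, q')) \<and>
        (\<not> cmp C n ?m [] (None, q') (None, q) \<or> tie ?m [] (None, q) (None, q'))"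
      by (rule cmp_honest) (use cok len okq q' in \<open>auto simp: same_def\<close>)
    have "fail ?m [] q = Y" unfolding q_def by (rule Yr)
    with c have "fail ?m [] (if cmp C n ?m [] (None, q) (None, q') then q else q') = Y"
      "fail ?m [] (if cmp C n ?m [] (None, q') (None, q) then q' else q) = Y"
      by (auto simp: tie_def)
    moreover have "drop (?m + ?m) q = us @ replicate (Suc n - k) None" using es(1) by (simp add: q_def)
    moreover have "labels_ok n (drop (?m + ?m) q')" "k \<le> length (drop (?m + ?m) q')"
      using q' k by (auto simp: labels_ok_def dest: in_set_dropD)
    ultimately show ?thesis using ch unfolding solve_def Let_def by simp
  qed
  with len okq y show ?thesis by blast
qed

end

section \<open>The verifier\<close>

lemma ptime_compose2: "ptime (\<lambda>t. h (fst t) (snd t)) \<Longrightarrow> ptime f \<Longrightarrow> ptime g \<Longrightarrow> ptime (\<lambda>x. h (f x) (g x))"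
  using ptime_compose[OF ptime_Pair[of f g]] by fastforce

lemma pbounded_nat: "ptime f \<Longrightarrow> pbounded (\<lambda>x. f x :: nat)"
  using pbounded_esz[of f] by simp

lemma ptime_lexle: assumes "ptime f" "ptime g" shows "ptime (\<lambda>x. lexle (f x) (g x))"
proof -
  define stp where "stp s x = (if fst s \<noteq> None then s else if snd s = [] then (Some True, [])
    else if x then (if hd (snd s) then (None, tl (snd s)) else (Some False, []))
    else (if hd (snd s) then (Some True, []) else (None, tl (snd s))))"
    for s :: "bool option \<times> bool list" and x
  define fin where "fin s = (if fst s = None then True else the (fst s))" for s :: "bool option \<times> bool list"
  have 1: "fin (foldl stp (Some b, zs) xs) = b" for b xs zs
    by (induction xs) (auto simp: stp_def fin_def)
  have 2: "fin (foldl stp (None, ys) xs) = lexle xs ys" for xs ys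
  proof (induction xs arbitrary: ys)
    case Nil show ?case by (simp add: fin_def)
  next
    case (Cons x xs)
    have step: "stp (None, ys) x = (if ys = [] then (Some True, []) else if x = hd ys then (None, tl ys)
        else (Some (hd ys), []))"
      by (cases x; cases "hd ys") (simp_all add: stp_def)
    show ?case unfolding foldl.simps step by (cases ys) (simp_all add: Cons.IH 1)
  qed
  have "ptime (\<lambda>x. foldl stp (None, g x) (f x))"
  proof (rule ptime_foldl_additive[where H = "\<lambda>x. 10"])
    show "ptime (\<lambda>t :: 'a \<times> (bool option \<times> bool list) \<times> bool. stp (fst (snd t)) (snd (snd t)))"
      unfolding stp_def by (intro ptime_intros)
    show "esz (stp s x) \<le> esz s + 10" for s x
      using esz_tl[of "snd s"] by (cases s) (auto simp: stp_def wenc_bool_def)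
  qed (intro pbounded_intros ptime_intros assms)+
  then have "ptime (\<lambda>x. fin (foldl stp (None, g x) (f x)))" unfolding fin_def by (intro ptime_intros)
  then show ?thesis by (simp add: 2)
qed

type_synonym circ = "(bool \<times> bool \<times> nat \<times> nat) list \<times> nat list"

definition num :: "nat \<Rightarrow> bool list \<Rightarrow> nat" where
  "num B bs = foldl (\<lambda>v b. min B (if b then Suc (v + v) else v + v)) 0 bs"

definition bit_step :: "bool list \<times> bool list \<Rightarrow> bool list \<times> bool list" where
  "bit_step s = (if fst s \<noteq> [] \<and> hd (fst s) then (tl (tl (fst s)), hd (tl (fst s)) # snd s) else s)"

text \<open>Since \<open>bit_step\<close> stalls at the terminator, \<open>length w\<close> rounds
  always suffice. Collecting the little-endian bits on a stack puts the most significant one first,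
  the order that \<open>num\<close> expects.\<close>

definition take_bits :: "bool list \<Rightarrow> bool list \<times> bool list" where
  "take_bits w = (bit_step ^^ length w) (w, [])"

text \<open>Numbers are read with saturation at a bound \<open>B\<close>, since their unary
  representation could otherwise be exponentially long.\<close>

definition take_nat :: "nat \<Rightarrow> bool list \<Rightarrow> nat \<times> bool list" where
  "take_nat B w = (num B (snd (take_bits w)), drop 2 (fst (take_bits w)))"

definition take_gate :: "nat \<Rightarrow> bool list \<Rightarrow> (bool \<times> bool \<times> nat \<times> nat) \<times> bool list" where
  "take_gate B w = (let a = take_nat B (drop 2 w); b = take_nat B (snd a) in
     if hd w then ((hd w, hd (tl w), fst a, 0), snd a) else ((hd w, hd (tl w), fst a, fst b), snd b))"

definition items :: "(bool list \<Rightarrow> 'a \<times> bool list) \<Rightarrow> nat \<Rightarrow> bool list \<Rightarrow> bool list \<times> 'a list" where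
  "items f k w = ((\<lambda>s. (snd (f (fst s)), snd s @ [fst (f (fst s))])) ^^ k) (w, [])"

text \<open>The encoded number of inputs is read over; \<open>n\<close> is recovered as one less
  than the number of outputs, which is correct for every circuit of the required shape. An empty
  output list is replaced by \<open>[0]\<close>, so that each input string yields some map to
  \<open>n + 1\<close> bits.\<close>

definition parse :: "bool list \<Rightarrow> circ" where
  "parse x = (let a = take_nat (length x) (snd (take_nat (length x) x));
     gs = items (take_gate (length x)) (fst a) (snd a);
     b = take_nat (length x) (fst gs);
     us = items (take_nat (length x)) (fst b) (snd b) in
     (snd gs, if snd us = [] then [0] else snd us))"

text \<open>The form \<open>hd (drop i vs)\<close> of indexing is covered by the closure rules for
  \<open>ptime\<close> and total also for bad indices.\<close>

definition gate_out :: "bool list \<Rightarrow> bool \<times> bool \<times> nat \<times> nat \<Rightarrow> bool" where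
  "gate_out vs g = (let a = hd (drop (fst (snd (snd g))) vs); b = hd (drop (snd (snd (snd g))) vs) in
     if fst g then \<not> a else if fst (snd g) then a \<or> b else a \<and> b)"

definition ceval :: "circ \<Rightarrow> bool list \<Rightarrow> bool list" where
  "ceval G z = map (\<lambda>i. hd (drop i (foldl (\<lambda>vs g. vs @ [gate_out vs g]) z (fst G)))) (snd G)"

definition take_label :: "nat \<Rightarrow> bool list \<Rightarrow> label \<times> bool list" where
  "take_label n w = (if hd w then Some (take n (tl w)) else None, drop (Suc n) w)"

definition labels :: "nat \<Rightarrow> nat \<Rightarrow> bool list \<Rightarrow> label list" where
  "labels n k w = snd (items (take_label n) k w)"

definition verifier :: "bool list \<Rightarrow> bool list \<Rightarrow> bool list \<Rightarrow> bool list" where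
  "verifier x p1 p2 = (let G = parse x; n = length (snd G) - 1; k = n + n + n + n + n + 3 in
     solve (ceval G) n (labels n k p1) (labels n k p2))"

subsection \<open>Parsing\<close>

declare bin.simps [simp del]

lemma bit_step_enc:
  "length bs \<le> k \<Longrightarrow> (bit_step ^^ k) (concat (map (\<lambda>b. [True, b]) bs) @ False # r, acc) = (False # r, rev bs @ acc)"
proof (induction bs arbitrary: k acc)
  case Nil
  have "(bit_step ^^ k) (False # r, acc) = (False # r, acc)" by (induction k) (auto simp: bit_step_def)
  then show ?case by simp
next
  case (Cons b bs)
  then obtain k' where k: "k = Suc k'" "length bs \<le> k'" by (cases k) auto
  have "bit_step (concat (map (\<lambda>b. [True, b]) (b # bs)) @ False # r, acc) =
      (concat (map (\<lambda>b. [True, b]) bs) @ False # r, b # acc)" by (simp add: bit_step_def)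
  with Cons.IH[OF k(2), of "b # acc"] show ?case by (simp add: k(1) funpow_swap1 del: funpow.simps(2) add: funpow.simps(2)[of k'])
qed

lemma length_le_concat: "(\<And>x. x \<in> set xs \<Longrightarrow> k \<le> length (f x)) \<Longrightarrow> k * length xs \<le> length (concat (map f xs))"
  by (induction xs) (auto simp: add_mono)

text \<open>Saturating after each doubling equals saturating once at the end, because a value that
  has reached \<open>B\<close> never falls below it again.\<close>

lemma num_bin: "num B (rev (bin n)) = min B n"
proof (induction n rule: bin.induct)
  case (1 n)
  show ?case
  proof (cases "n = 0")
    case True then show ?thesis by (simp add: num_def bin.simps[of 0])
  next
    case False
    have "num B (rev (bin n)) = min B (if odd n then Suc (num B (rev (bin (n div 2))) + num B (rev (bin (n div 2)))) else
        num B (rev (bin (n div 2))) + num B (rev (bin (n div 2))))"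
      using False by (subst bin.simps) (simp add: num_def)
    also have "\<dots> = min B n" unfolding 1[OF False]
      by (cases "odd n") (auto elim!: oddE evenE simp: min_def)
    finally show ?thesis .
  qed
qed

lemma take_nat_enc: "take_nat B (enc_nat n @ r) = (min B n, r)"
proof -
  have "length (bin n) \<le> length (enc_nat n @ r)"
    using length_le_concat[of "bin n" 1 "\<lambda>b. [True, b]"] by (simp add: enc_nat_def)
  then have "take_bits (enc_nat n @ r) = (False # False # r, rev (bin n))"
    using bit_step_enc[of "bin n" "length (enc_nat n @ r)" "False # r" "[]"]
    unfolding take_bits_def by (simp add: enc_nat_def)
  then show ?thesis by (simp add: take_nat_def num_bin)
qed

fun gate_code :: "gate \<Rightarrow> bool \<times> bool \<times> nat \<times> nat" where
  "gate_code (AndG i j) = (False, False, i, j)"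
| "gate_code (OrG i j) = (False, True, i, j)"
| "gate_code (NotG i) = (True, False, i, 0)"

lemma take_gate_enc: "gate_refs_ok k g \<Longrightarrow> k \<le> B \<Longrightarrow> take_gate B (enc_gate g @ r) = (gate_code g, r)"
  by (cases g) (auto simp: take_gate_def take_nat_enc Let_def min_def)

lemma items_enc:
  assumes "\<And>x r. x \<in> set xs \<Longrightarrow> f (e x @ r) = (c x, r)"
  shows "items f (length xs) (concat (map e xs) @ r) = (r, map c xs)"
proof -
  let ?F = "\<lambda>s. (snd (f (fst s)), snd s @ [fst (f (fst s))])"
  have "(?F ^^ length xs) (concat (map e xs) @ r, acc) = (r, acc @ map c xs)" for acc
    using assms
  proof (induction xs arbitrary: acc)
    case (Cons x xs)
    have "?F (concat (map e (x # xs)) @ r, acc) = (concat (map e xs) @ r, acc @ [c x])"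
      using Cons.prems[of x] by simp
    moreover have "(?F ^^ length xs) (concat (map e xs) @ r, acc @ [c x]) = (r, (acc @ [c x]) @ map c xs)"
      by (rule Cons.IH) (use Cons.prems in auto)
    ultimately show ?case by (simp only: length_Cons funpow_Suc_right o_apply) simp
  qed simp
  then show ?thesis by (simp add: items_def)
qed

lemma length_enc_nat: "2 \<le> length (enc_nat n)" by (simp add: enc_nat_def)

lemma length_enc_gate: "2 \<le> length (enc_gate g)" by (cases g) auto

text \<open>Saturation at the length of the word is harmless for valid codes: each gate and each
  output takes at least two bits, and wire indices lie below the number of inputs plus gates, with
  fewer inputs than outputs.\<close>

lemma parse_enc:
  assumes wf: "circuit_wf C" and out: "length (c_outputs C) = Suc (c_inputs C)"
  shows "parse (enc_circuit C) = (map gate_code (c_gates C), c_outputs C)"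
proof -
  define B where "B = length (enc_circuit C)"
  let ?n = "c_inputs C" and ?gs = "c_gates C" and ?us = "c_outputs C"
  have x: "enc_circuit C = enc_nat ?n @ enc_nat (length ?gs) @ concat (map enc_gate ?gs) @ enc_nat (length ?us) @
      concat (map enc_nat ?us) @ []" by (simp add: enc_circuit_def)
  have "2 * length ?gs \<le> length (concat (map enc_gate ?gs))" "2 * length ?us \<le> length (concat (map enc_nat ?us))"
    using length_le_concat[of ?gs 2 enc_gate] length_le_concat[of ?us 2 enc_nat] length_enc_nat length_enc_gate by auto
  then have B: "2 * length ?gs + 2 * length ?us \<le> B" unfolding B_def x by simp
  have g: "take_gate B (enc_gate g @ r) = (gate_code g, r)" if g: "g \<in> set ?gs" for g r
  proof -
    obtain j where j: "j < length ?gs" "g = ?gs ! j" using g by (auto simp: in_set_conv_nth)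
    then have "gate_refs_ok (?n + j) g" using wf by (simp add: circuit_wf_def)
    then show ?thesis by (rule take_gate_enc) (use j B out in simp)
  qed
  have u: "take_nat B (enc_nat i @ r) = (i, r)" if "i \<in> set ?us" for i r
  proof -
    have "i < ?n + length ?gs" using wf that by (simp add: circuit_wf_def)
    then show ?thesis using B out by (simp add: take_nat_enc)
  qed
  have "items (take_nat B) (length ?us) (concat (map enc_nat ?us) @ []) = ([], map id ?us)"
    using items_enc[of ?us "take_nat B" enc_nat id "[]"] u by simp
  moreover have "items (take_gate B) (length ?gs) (concat (map enc_gate ?gs) @ r) = (r, map gate_code ?gs)" for r
    using items_enc[of ?gs "take_gate B" enc_gate gate_code] g by simp
  moreover have "min B (length ?gs) = length ?gs" "min B (length ?us) = length ?us" using B by auto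
  ultimately show ?thesis using out unfolding parse_def B_def[symmetric]
    unfolding x by (auto simp: take_nat_enc Let_def)
qed

lemma wires_eq:
  assumes "\<forall>j < length gs. gate_refs_ok (n + j) (gs ! j)" "length z = n"
  shows "foldl (\<lambda>vs g. vs @ [gate_out vs g]) z (map gate_code gs) = foldl (\<lambda>vs g. vs @ [gate_val vs g]) z gs \<and>
    length (foldl (\<lambda>vs g. vs @ [gate_val vs g]) z gs) = n + length gs"
  using assms(1)
proof (induction gs rule: rev_induct)
  case Nil then show ?case using assms(2) by simp
next
  case (snoc g gs)
  have "\<forall>j < length gs. gate_refs_ok (n + j) (gs ! j)"
  proof safe
    fix j assume "j < length gs"
    with snoc.prems[rule_format, of j] show "gate_refs_ok (n + j) (gs ! j)" by (simp add: nth_append)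
  qed
  note IH = snoc.IH[OF this]
  have "gate_refs_ok (n + length gs) g" using snoc.prems[rule_format, of "length gs"] by simp
  then have "gate_out vs (gate_code g) = gate_val vs g" if "length vs = n + length gs" for vs
    using that by (cases g) (auto simp: gate_out_def Let_def hd_drop_conv_nth)
  with IH show ?case by simp
qed

lemma ceval_eq:
  assumes "circuit_wf C" "length z = c_inputs C"
  shows "ceval (map gate_code (c_gates C), c_outputs C) z = circuit_eval C z"
  using wires_eq[of "c_gates C" "c_inputs C" z] assms
  by (auto simp: ceval_def circuit_eval_def wire_values_def circuit_wf_def hd_drop_conv_nth)

lemma parse_outputs: "snd (parse x) \<noteq> []"
  by (simp add: parse_def Let_def)

lemma num_le: "num B bs \<le> B"
  by (cases bs rule: rev_cases) (auto simp: num_def)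

lemma take_nat_le: "fst (take_nat B w) \<le> B"
  by (simp add: take_nat_def num_le)

lemma length_items: "length (snd (items f k w)) = k"
  unfolding items_def by (induction k) auto

lemma length_parse: "length (snd (parse x)) \<le> Suc (length x)"
  using take_nat_le[of "length x"] by (auto simp: parse_def Let_def length_items intro: le_SucI)

text \<open>Every long enough word decodes to labels of the right length, so the verifier needs no
  format check on dishonest certificates.\<close>

lemma labels_ok_labels: "k * Suc n \<le> length w \<Longrightarrow> labels_ok n (labels n k w)"
proof -
  let ?F = "\<lambda>s. (snd (take_label n (fst s)), snd s @ [fst (take_label n (fst s))])"
  have "length (fst ((?F ^^ k) (w, []))) = length w - k * Suc n \<and> labels_ok n (snd ((?F ^^ k) (w, [])))"
    if "k * Suc n \<le> length w"
    using that
  proof (induction k)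
    case 0 then show ?case by (simp add: labels_ok_def)
  next
    case (Suc k)
    let ?s = "(?F ^^ k) (w, [])"
    from Suc have IH: "length (fst ?s) = length w - k * Suc n" "labels_ok n (snd ?s)" by auto
    have "Suc n \<le> length (fst ?s)" using IH(1) Suc.prems by simp
    with IH Suc.prems show ?case by (auto simp: take_label_def labels_ok_def split: if_splits)
  qed
  then show "k * Suc n \<le> length w \<Longrightarrow> labels_ok n (labels n k w)"
    by (simp add: labels_def items_def)
qed

definition enc_label :: "nat \<Rightarrow> label \<Rightarrow> bool list" where
  "enc_label n a = (case a of None \<Rightarrow> replicate (Suc n) False | Some z \<Rightarrow> True # z)"

lemma labels_enc: "labels_ok n q \<Longrightarrow> labels n (length q) (concat (map (enc_label n) q) @ r) = q"
  using items_enc[of q "take_label n" "enc_label n" id r]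
  by (fastforce simp: labels_def enc_label_def take_label_def labels_ok_def split: option.splits)

lemma length_enc_labels: "labels_ok n q \<Longrightarrow> length (concat (map (enc_label n) q)) = length q * Suc n"
proof (induction q)
  case (Cons a q)
  then have "length (enc_label n a) = Suc n" "labels_ok n q"
    by (auto simp: enc_label_def labels_ok_def split: option.splits)
  with Cons.IH show ?case by simp
qed simp

text \<open>One word, the encoded honest certificate padded to the prescribed length, is the winning
  choice for both provers.\<close>

lemma verifier_outputs:
  obtains y where "fs2p_outputs (\<lambda>N. 5 * (N + 1) * (N + 1)) verifier x y" "length y = length (snd (parse x))"
    "\<And>z. length z = length (snd (parse x)) - 1 \<Longrightarrow> ceval (parse x) z \<noteq> y"
proof -
  let ?G = "parse x" and ?l = "5 * (length x + 1) * (length x + 1)"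
  define n where "n = length (snd ?G) - 1"
  have n: "length (snd ?G) = Suc n" using parse_outputs[of x] by (cases "snd ?G") (auto simp: n_def)
  have k: "n + n + n + n + n + 3 = 5 * n + 3" by simp
  interpret avoid "ceval ?G" n by standard (simp add: ceval_def n)
  obtain q y where q: "length q = 5 * n + 3" "labels_ok n q" and y: "length y = Suc n" "\<And>z. length z = n \<Longrightarrow> ceval ?G z \<noteq> y"
    and sol: "\<And>q'. length q' = 5 * n + 3 \<Longrightarrow> labels_ok n q' \<Longrightarrow> solve (ceval ?G) n q q' = y \<and> solve (ceval ?G) n q' q = y"
    using solve_honest by blast
  have "n \<le> length x" using length_parse[of x] n by simp
  \<comment> \<open>There are \<open>5 * n + 3\<close> labels of \<open>n + 1\<close> bits each, a
    flag and the label itself.\<close>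
  then have "(5 * n + 3) * Suc n \<le> (5 * (length x + 1)) * (length x + 1)" by (intro mult_mono) auto
  then have le: "(5 * n + 3) * Suc n \<le> ?l" by simp
  define w where "w = concat (map (enc_label n) q)"
  define pi where "pi = w @ replicate (?l - length w) False"
  have "length w = (5 * n + 3) * Suc n" using length_enc_labels[OF q(2)] q(1) by (simp add: w_def)
  then have len: "length pi = ?l" using le by (simp add: pi_def)
  have piq: "labels n (5 * n + 3) pi = q" using labels_enc[OF q(2)] by (simp add: pi_def w_def q(1))
  have "verifier x pi p = y \<and> verifier x p pi = y" if "length p = ?l" for p
  proof -
    have "labels_ok n (labels n (5 * n + 3) p)" by (rule labels_ok_labels) (use le that in simp)
    moreover have "length (labels n (5 * n + 3) p) = 5 * n + 3" by (simp add: labels_def length_items)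
    ultimately show ?thesis using sol unfolding verifier_def Let_def n_def[symmetric] k piq by blast
  qed
  then have "fs2p_outputs (\<lambda>N. 5 * (N + 1) * (N + 1)) verifier x y"
    using len unfolding fs2p_outputs_def by blast
  with y show ?thesis by (intro that) (auto simp: n)
qed

lemma verifier_avoids:
  assumes "length y = length (snd (parse x))" "\<And>z. length z = length (snd (parse x)) - 1 \<Longrightarrow> ceval (parse x) z \<noteq> y"
  shows "avoid_solution x y"
  unfolding avoid_solution_def
proof (intro allI impI, elim conjE)
  fix C assume wf: "circuit_wf C" and out: "length (c_outputs C) = Suc (c_inputs C)" and x: "enc_circuit C = x"
  have p: "parse x = (map gate_code (c_gates C), c_outputs C)" using parse_enc[OF wf out] x by simp
  show "length y = Suc (c_inputs C) \<and> (\<forall>z. length z = c_inputs C \<longrightarrow> circuit_eval C z \<noteq> y)"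
    using assms ceval_eq[OF wf] out unfolding p by auto
qed

subsection \<open>Polynomial running time\<close>

text \<open>Doubling is not additive growth, so the general \<open>ptime_foldl\<close> is applied;
  the saturation bound itself bounds the accumulator.\<close>

lemma ptime_num: "ptime (\<lambda>t. num (fst t) (snd t))"
  unfolding num_def
proof (rule ptime_foldl[where H = fst])
  show "pbounded (fst :: nat \<times> bool list \<Rightarrow> nat)" by (rule pbounded_nat[OF ptime_fst0])
  show "esz (foldl (\<lambda>v b. min (fst e) (if b then Suc (v + v) else v + v)) 0 (take i (snd e))) \<le> fst e"
    for e :: "nat \<times> bool list" and i
    using num_le[of "fst e" "take i (snd e)"] by (simp add: num_def)
qed (intro ptime_intros)+

lemma ptime_take_bits0: "ptime take_bits"
  unfolding take_bits_def
proof (rule ptime_funpow[where H = "\<lambda>_. 10"])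
  show "ptime (\<lambda>t :: bool list \<times> bool list \<times> bool list. bit_step (snd t))"
    unfolding bit_step_def by (intro ptime_intros)
  show "esz (bit_step s) \<le> esz s + 10" for s
    using esz_tl[of "fst s"] esz_tl[of "tl (fst s)"] esz_bool[of "hd (tl (fst s))"]
    by (cases s) (auto simp: bit_step_def)
qed (intro ptime_intros pbounded_intros)+

lemma ptime_take_nat: assumes "ptime B" "ptime w" shows "ptime (\<lambda>x. take_nat (B x) (w x))"
  unfolding take_nat_def
  by (intro ptime_intros ptime_compose2[OF ptime_num] ptime_compose[OF _ ptime_take_bits0] assms)

lemma ptime_take_gate: assumes "ptime B" "ptime w" shows "ptime (\<lambda>x. take_gate (B x) (w x))"
  unfolding take_gate_def by (intro ptime_intros ptime_take_nat assms)

lemma esz_take_bits: "esz (fst (take_bits w)) \<le> esz w"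
proof -
  have "esz (fst ((bit_step ^^ k) s)) \<le> esz (fst s)" for k s
  proof (induction k)
    case (Suc k)
    have "esz (fst (bit_step t)) \<le> esz (fst t)" for t
      using esz_tl[of "fst t"] esz_tl[of "tl (fst t)"] by (auto simp: bit_step_def)
    from this[of "(bit_step ^^ k) s"] Suc show ?case by simp
  qed simp
  from this[of "length w" "(w, [])"] show ?thesis by (simp add: take_bits_def)
qed

lemma esz_take_nat: "esz (snd (take_nat B w)) \<le> esz w"
  using esz_take_bits[of w] esz_drop[of 2 "fst (take_bits w)"] by (simp add: take_nat_def)

lemma esz_take_gate: "esz (snd (take_gate B w)) \<le> esz w" "esz (fst (take_gate B w)) \<le> 7 + 3 * B"
proof -
  let ?a = "take_nat B (drop 2 w)"
  have "esz (snd ?a) \<le> esz w" using esz_take_nat[of B "drop 2 w"] esz_drop[of 2 w] by simp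
  then show "esz (snd (take_gate B w)) \<le> esz w"
    using esz_take_nat[of B "snd ?a"] by (simp add: take_gate_def Let_def)
  show "esz (fst (take_gate B w)) \<le> 7 + 3 * B"
    using esz_bool[of "hd w"] esz_bool[of "hd (tl w)"] take_nat_le[of B "drop 2 w"] take_nat_le[of B "snd ?a"]
    by (auto simp: take_gate_def Let_def wenc_bool_def)
qed

lemma ptime_items:
  assumes f: "ptime (\<lambda>t. f (fst t) (snd t))" and "ptime k" "ptime w" "pbounded H"
    and sz: "\<And>e v. esz (snd (f e v)) \<le> esz v" "\<And>e v. esz (fst (f e v)) \<le> H e"
  shows "ptime (\<lambda>e. items (f e) (k e) (w e))"
  unfolding items_def
proof (rule ptime_funpow[where H = "\<lambda>e. 2 * H e + 1"])
  have "ptime (\<lambda>t :: 'a \<times> bool list \<times> 'b list. f (fst t) (fst (snd t)))"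
    by (rule ptime_compose2[OF f]) (intro ptime_intros)+
  then show "ptime (\<lambda>t :: 'a \<times> bool list \<times> 'b list. (snd (f (fst t) (fst (snd t))), snd (snd t) @ [fst (f (fst t) (fst (snd t)))]))"
    by (intro ptime_intros)
  show "esz (snd (f e (fst s)), snd s @ [fst (f e (fst s))]) \<le> esz s + (2 * H e + 1)" for e s
    using sz[of e "fst s"] by (cases s) simp
qed (intro ptime_intros pbounded_intros assms)+

lemma ptime_parse0: "ptime parse"
proof -
  have 1: "ptime (\<lambda>x. items (take_gate (length x)) (k x) (w x))" if "ptime k" "ptime w" for k and w :: "bool list \<Rightarrow> bool list"
    by (rule ptime_items[where H = "\<lambda>x. 7 + 3 * length x"])
      (intro ptime_take_gate ptime_intros that pbounded_intros pbounded_nat esz_take_gate)+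
  have 2: "ptime (\<lambda>x. items (take_nat (length x)) (k x) (w x))" if "ptime k" "ptime w" for k and w :: "bool list \<Rightarrow> bool list"
    by (rule ptime_items[where H = "\<lambda>x. length x"])
      (simp add: take_nat_le | intro ptime_take_nat ptime_intros that pbounded_intros pbounded_nat esz_take_nat)+
  show ?thesis unfolding parse_def Let_def
    by (intro ptime_intros 1 2 ptime_take_nat)
qed

lemma ptime_labels: assumes "ptime n" "ptime k" "ptime w" shows "ptime (\<lambda>x. labels (n x) (k x) (w x))"
proof -
  have "ptime (\<lambda>x. items (take_label (n x)) (k x) (w x))"
  proof (rule ptime_items[where H = "\<lambda>x. 6 * n x + 1"])
    have "ptime (\<lambda>t. n (fst t))" by (rule ptime_compose[OF ptime_fst0 assms(1)])
    then show "ptime (\<lambda>t. take_label (n (fst t)) (snd t))" unfolding take_label_def by (intro ptime_intros)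
    show "esz (fst (take_label (n e) v)) \<le> 6 * n e + 1" for e v
      using esz_bools[of "take (n e) (tl v)"] by (auto simp: take_label_def)
    show "esz (snd (take_label (n e) v)) \<le> esz v" for e v
      by (simp add: take_label_def esz_drop)
  qed (intro assms pbounded_intros pbounded_nat)+
  then show ?thesis unfolding labels_def by (rule ptime_snd)
qed

lemma ptime_ceval0: "ptime (\<lambda>t. ceval (fst t) (snd t))"
proof -
  have "ptime (\<lambda>t :: circ \<times> bool list. foldl (\<lambda>vs g. vs @ [gate_out vs g]) (snd t) (fst (fst t)))"
  proof (rule ptime_foldl_additive[where H = "\<lambda>_. 3"])
    show "ptime (\<lambda>t :: (circ \<times> bool list) \<times> bool list \<times> bool \<times> bool \<times> nat \<times> nat. fst (snd t) @ [gate_out (fst (snd t)) (snd (snd t))])"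
      unfolding gate_out_def by (intro ptime_intros)
    show "esz (s @ [gate_out s x]) \<le> esz s + 3" for s x using esz_bool[of "gate_out s x"] by simp
  qed (intro ptime_intros pbounded_intros)+
  then have "ptime (\<lambda>t :: (circ \<times> bool list) \<times> nat. foldl (\<lambda>vs g. vs @ [gate_out vs g]) (snd (fst t)) (fst (fst (fst t))))"
    by (rule ptime_compose[OF ptime_fst0])
  then show ?thesis unfolding ceval_def by (intro ptime_map ptime_intros)
qed

lemmas ptime_ceval = ptime_compose2[OF ptime_ceval0]

lemma length_ceval: "length (ceval G z) = length (snd G)"
  by (simp add: ceval_def)

lemma esz_bools_le: "length (xs :: bool list) \<le> k \<Longrightarrow> esz xs \<le> 3 * k"
  using esz_bools[of xs] by simp

lemma ptime_ext0: "ptime (\<lambda>t. ext (ceval (fst t)) (fst (snd t)) (snd (snd t)))"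
proof -
  have "ptime (\<lambda>t :: circ \<times> nat \<times> bool list. (ext_step (ceval (fst t)) ^^ fst (snd t)) (snd (snd t), []))"
  proof (rule ptime_funpow[where H = "\<lambda>t. 6 * length (snd (fst t)) + 10"])
    show "ptime (\<lambda>t :: (circ \<times> nat \<times> bool list) \<times> bool list \<times> bool list. ext_step (ceval (fst (fst t))) (snd t))"
      unfolding ext_step_def by (intro ptime_intros ptime_ceval)
    show "esz (ext_step (ceval (fst e)) s) \<le> esz s + (6 * length (snd (fst e)) + 10)" for e :: "circ \<times> nat \<times> bool list" and s
      using esz_bools_le[of "butlast (ceval (fst e) (fst s))" "length (snd (fst e))"] esz_bool[of "last (ceval (fst e) (fst s))"]
      by (cases s) (simp add: ext_step_def length_ceval)
  qed (intro ptime_intros pbounded_intros pbounded_nat)+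
  then show ?thesis unfolding ext_def Let_def by (intro ptime_intros)
qed

lemma ptime_ext: "ptime G \<Longrightarrow> ptime k \<Longrightarrow> ptime z \<Longrightarrow> ptime (\<lambda>x. ext (ceval (G x)) (k x) (z x))"
  using ptime_compose[OF ptime_Pair[OF _ ptime_Pair] ptime_ext0, of G k z] by simp

text \<open>Each output bit has encoded cost at most 3. The term \<open>esz z\<close> covers
  \<open>k = 0\<close>, where the circuit is not applied and \<open>z\<close> may have any
  length.\<close>

lemma esz_ext: "esz (ext (ceval G) k z) \<le> esz z + 3 * (length (snd G) + k)"
proof (cases k)
  case 0 then show ?thesis by (simp add: ext_def)
next
  case (Suc j)
  have "length (snd ((ext_step (ceval G) ^^ i) (z, []))) = i" for i by (induction i) (auto simp: ext_step_def)
  then have "length (ext (ceval G) k z) \<le> length (snd G) + k"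
    unfolding ext_def Let_def Suc by (simp add: ext_step_def length_ceval)
  from esz_bools_le[OF this] show ?thesis by simp
qed

lemma ptime_kids:
  assumes "ptime G" "ptime n" "ptime c" shows "ptime (\<lambda>x. kids (ceval (G x)) (n x) (c x))"
  unfolding kids_def by (intro ptime_intros ptime_ext assms)

text \<open>The sizes of unspecified values such as \<open>hd []\<close> and
  \<open>the None\<close>, which malformed states may bring up; being constants, they only add to
  the bounds.\<close>

definition hd_junk :: nat where "hd_junk = esz (hd [] :: label) + esz (the None :: bool list) + esz (the (hd [] :: label))"

text \<open>A list cell already counts its head twice, so moving the head into the first component
  of a pair costs only a constant.\<close>

lemma esz_hd_label: "2 * esz (hd es :: label) + esz (tl es) \<le> esz es + 2 * hd_junk"
  by (cases es) (auto simp: hd_junk_def)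

lemma esz_the_hd: "2 * esz (the (hd es :: label)) + esz (tl es) \<le> esz es + 2 * hd_junk"
proof (cases es)
  case (Cons a fs) then show ?thesis by (cases a) (auto simp: hd_junk_def)
qed (auto simp: hd_junk_def)

text \<open>Additive growth is what \<open>ptime_funpow\<close> requires. A label in a claim is
  doubled twice, by \<open>Some\<close> and by the pair, which turns the
  \<open>3 * (length (snd G) + n)\<close> of \<open>esz_ext\<close> into
  \<open>12 * (length (snd G) + n)\<close>.\<close>

lemma esz_kids:
  "esz (fst (kids (ceval G) n c)) \<le> esz c + (12 * (length (snd G) + n) + 4 * hd_junk + 2)"
  "esz (snd (kids (ceval G) n c)) \<le> esz c + (12 * (length (snd G) + n) + 4 * hd_junk + 2)"
proof -
  obtain a es where c: "c = (a, es)" by (cases c)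
  have e: "esz (drop 2 es) \<le> esz (tl (tl es))" by (simp add: numeral_2_eq_2 drop_Suc)
  have "esz (fst (kids (ceval G) n c)) \<le> esz c + (12 * (length (snd G) + n) + 4 * hd_junk + 2) \<and>
    esz (snd (kids (ceval G) n c)) \<le> esz c + (12 * (length (snd G) + n) + 4 * hd_junk + 2)"
  proof (cases a)
    case None
    then show ?thesis using e esz_hd_label[of es] esz_hd_label[of "tl es"] esz_tl[of "tl es"] esz_tl[of es]
      by (simp add: c kids_def)
  next
    case (Some z)
    let ?y = "ext (ceval G) n z"
    show ?thesis using esz_ext[of G n z] esz_take[of n ?y] esz_drop[of n ?y] esz_drop[of 2 es]
      by (simp add: c kids_def Some)
  qed
  then show "esz (fst (kids (ceval G) n c)) \<le> esz c + (12 * (length (snd G) + n) + 4 * hd_junk + 2)"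
    "esz (snd (kids (ceval G) n c)) \<le> esz c + (12 * (length (snd G) + n) + 4 * hd_junk + 2)" by auto
qed

lemma ptime_same: "ptime a \<Longrightarrow> ptime b \<Longrightarrow> ptime (\<lambda>x. same (a x) (b x))"
  unfolding same_def by (intro ptime_intros)

lemma ptime_beats: "ptime a \<Longrightarrow> ptime b \<Longrightarrow> ptime (\<lambda>x. beats (a x) (b x))"
  unfolding beats_def by (intro ptime_intros ptime_lexle)

lemma ptime_beats_leaf:
  assumes "ptime G" "ptime n" "ptime p" "ptime a" "ptime b" shows "ptime (\<lambda>x. beats_leaf (ceval (G x)) (n x) (p x) (a x) (b x))"
  unfolding beats_leaf_def good_leaf_def by (intro ptime_intros ptime_lexle ptime_ext assms)

lemma esz_cmp_step:
  "esz (cmp_step (ceval G) n s) \<le> esz s + (40 + 36 * (length (snd G) + n) + 12 * hd_junk)"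
proof -
  obtain res p c c' where s: "s = (res, p, c, c')" by (cases s)
  show ?thesis using esz_kids[of G n c] esz_kids[of G n c']
    by (auto simp: s cmp_step_def Let_def wenc_bool_def)
qed

lemma ptime_cmp:
  assumes G: "ptime G" and n: "ptime n" and "ptime h" "ptime p" "ptime c" "ptime c'"
  shows "ptime (\<lambda>x. cmp (ceval (G x)) (n x) (h x) (p x) (c x) (c' x))"
proof -
  have "ptime (\<lambda>x. (cmp_step (ceval (G x)) (n x) ^^ h x) (None, p x, c x, c' x))"
  proof (rule ptime_funpow[where H = "\<lambda>x. 40 + 36 * (length (snd (G x)) + n x) + 12 * hd_junk"])
    have "ptime (\<lambda>t :: 'a \<times> cmp_state. G (fst t))" "ptime (\<lambda>t :: 'a \<times> cmp_state. n (fst t))"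
      by (rule ptime_compose[OF ptime_fst0 G], rule ptime_compose[OF ptime_fst0 n])
    then show "ptime (\<lambda>t. cmp_step (ceval (G (fst t))) (n (fst t)) (snd t))"
      unfolding cmp_step_def Let_def by (intro ptime_intros ptime_kids ptime_same ptime_beats)
  qed (intro ptime_intros pbounded_intros pbounded_nat assms esz_cmp_step)+
  then show ?thesis unfolding cmp_def by (intro ptime_intros ptime_beats_leaf assms)
qed

lemma ptime_fail:
  assumes "ptime h" "ptime p" "ptime es" shows "ptime (\<lambda>x. fail (h x) (p x) (es x))"
proof -
  have "ptime (\<lambda>x. (fail_step ^^ h x) (False, p x, es x))"
  proof (rule ptime_funpow[where H = "\<lambda>_. 20 + 4 * hd_junk"])
    show "ptime (\<lambda>t :: 'a \<times> fail_state. fail_step (snd t))" unfolding fail_step_def by (intro ptime_intros)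
    show "esz (fail_step s) \<le> esz s + (20 + 4 * hd_junk)" for s
    proof -
      obtain d p es where s: "s = (d, p, es)" by (cases s)
      show ?thesis
        using esz_the_hd[of es] esz_the_hd[of "tl es"] esz_drop[of 2 es] esz_tl[of es] esz_tl[of "tl es"]
        by (auto simp: s fail_step_def wenc_bool_def)
    qed
  qed (intro ptime_intros pbounded_intros assms)+
  then show ?thesis unfolding fail_def by (intro ptime_intros)
qed

lemma ptime_chain:
  assumes G: "ptime G" and "ptime t" "ptime bs" "ptime us" "ptime us'"
  shows "ptime (\<lambda>x. chain (ceval (G x)) (t x) (bs x) (us x) (us' x))"
proof -
  have "ptime (\<lambda>x. foldl (chain_step (ceval (G x))) (False, t x, us x, us' x) (bs x))"
  proof (rule ptime_foldl_additive[where H = "\<lambda>_. 20 + 4 * hd_junk"])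
    have "ptime (\<lambda>t :: 'a \<times> chain_state \<times> bool. G (fst t))" by (rule ptime_compose[OF ptime_fst0 G])
    then show "ptime (\<lambda>t :: 'a \<times> chain_state \<times> bool. chain_step (ceval (G (fst t))) (fst (snd t)) (snd (snd t)))"
      unfolding chain_step_def Let_def by (intro ptime_intros ptime_ceval ptime_lexle)
    \<comment> \<open>Outputs of \<open>C\<close> are only compared and never stored, so the growth
      does not depend on \<open>C\<close>.\<close>
    show "esz (chain_step C s b) \<le> esz s + (20 + 4 * hd_junk)" for C s b
    proof -
      obtain d t us us' where s: "s = (d, t, us, us')" by (cases s)
      show ?thesis
        using esz_the_hd[of us] esz_the_hd[of us'] esz_tl[of us] esz_tl[of us']
        by (auto simp: s chain_step_def Let_def wenc_bool_def)
    qed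
  qed (intro ptime_intros pbounded_intros assms)+
  then show ?thesis unfolding chain_def by (intro ptime_intros)
qed

lemma ptime_solve:
  assumes "ptime G" "ptime n" "ptime q" "ptime q'" shows "ptime (\<lambda>x. solve (ceval (G x)) (n x) (q x) (q' x))"
  unfolding solve_def Let_def by (intro ptime_intros ptime_chain ptime_fail ptime_cmp assms)

lemma ptime_verifier:
  assumes "ptime f" "ptime g" "ptime h" shows "ptime (\<lambda>x. verifier (f x) (g x) (h x))"
  unfolding verifier_def Let_def One_nat_def
  by (intro ptime_solve ptime_labels ptime_intros ptime_compose[OF assms(1) ptime_parse0] assms)

text \<open>The entry \<open>None\<close> plays the separator here, as \<open>opt_of_sym\<close>
  sends \<open>Hash\<close> to it.\<close>

definition bits_before :: "bool option list \<Rightarrow> bool list" where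
  "bits_before l = map the (takeWhile (\<lambda>c. c \<noteq> None) l)"

definition bits_after :: "bool option list \<Rightarrow> bool option list" where
  "bits_after l = drop (Suc (length (takeWhile (\<lambda>c. c \<noteq> None) l))) l"

definition verify_input :: "bool option list \<Rightarrow> bool list" where
  "verify_input l = verifier (bits_before l) (bits_before (bits_after l)) (bits_before (bits_after (bits_after l)))"

lemma ptime_verify_input: "ptime verify_input"
proof -
  have 1: "ptime (\<lambda>c :: bool option. c \<noteq> None)" by (intro ptime_intros)
  have 2: "ptime (\<lambda>x. bits_before (f x))" if "ptime f" for f :: "bool option list \<Rightarrow> bool option list"
    unfolding bits_before_def by (intro ptime_map ptime_takeWhile that 1 ptime_intros)
  have 3: "ptime (\<lambda>x. bits_after (f x))" if "ptime f" for f :: "bool option list \<Rightarrow> bool option list"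
    unfolding bits_after_def by (intro ptime_intros ptime_takeWhile that 1)
  show ?thesis unfolding verify_input_def by (intro ptime_verifier 2 3 ptime_intros)
qed

lemma takeWhile_Some: "takeWhile (\<lambda>c. c \<noteq> None) (map Some x @ None # r) = map Some x"
  by (induction x) auto

lemma bits_sep: "bits_before (map Some x @ None # r) = x" "bits_after (map Some x @ None # r) = r"
  by (simp_all add: bits_before_def bits_after_def takeWhile_Some comp_def del: not_None_eq)

lemma bits_end: "bits_before (map Some x) = x"
  by (induction x) (auto simp: bits_before_def)

lemma verify_triple_input:
  "verify_input (map opt_of_sym (takeWhile (\<lambda>s. s \<noteq> Bk) (triple_input x p1 p2))) = verifier x p1 p2"
proof -
  have o: "map opt_of_sym (syms u) = map Some u" for u by (induction u) (auto simp: sym_of_bool_def)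
  have t: "takeWhile (\<lambda>s. s \<noteq> Bk) (triple_input x p1 p2) = triple_input x p1 p2"
    by (auto simp: triple_input_def sym_of_bool_def takeWhile_eq_all_conv)
  have "map opt_of_sym (triple_input x p1 p2) = map Some x @ None # map Some p1 @ None # map Some p2"
    by (simp add: triple_input_def o del: map_map)
  then show ?thesis unfolding t verify_input_def by (simp only: bits_sep bits_end)
qed

theorem mainTheorem1:
  shows "single_valued_FS2P_solves avoid_solution"
proof -
  obtain M and p :: "nat poly" where "tm_wf M"
    "tm_computes_in_time M (\<lambda>w. verify_input (map opt_of_sym (takeWhile (\<lambda>s. s \<noteq> Bk) w))) (poly p)"
    using ptime_computable[OF ptime_verify_input] .
  then have "poly_time_computable3 verifier"
    unfolding poly_time_computable3_def using verify_triple_input by blast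
  moreover have "poly [:5, 10, 5:] = (\<lambda>N :: nat. 5 * (N + 1) * (N + 1))"
    by (rule ext) (simp add: algebra_simps)
  moreover have "\<exists>y. fs2p_outputs (\<lambda>N. 5 * (N + 1) * (N + 1)) verifier x y \<and> avoid_solution x y" for x
    using verifier_outputs[of x] verifier_avoids[of _ x] by metis
  ultimately show ?thesis unfolding single_valued_FS2P_solves_def by metis
qed

end
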